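(* Let $W$ be an $n$-dimensional real vector space, $n\ge3$, with a fixed positive Lebesgue measure. For linear functionals $\xi_1,\ldots,\xi_{n-2}\in W^*$, consider the graphing map $\overline\xi:W\to W\times\mathbb{R}^{n-2}$, $$\overline\xi(w)=\big(w,\xi_1(w),\ldots,\xi_{n-2}(w)\big).$$ Then for all convex bodies $A_1,\ldots,A_{n-1},B_1,\ldots,B_{n-1}\subset W$ with $B_1,\ldots,B_{n-1}$ centrally symmetric we have $$V\big(A_1,\ldots,A_{n-1},\overline\xi(B_1),\ldots,\overline\xi(B_{n-1})\big)^2\ \ge\ V\big(A_1,\ldots,A_{n-1},\overline\xi(A_1),\ldots,\overline\xi(A_{n-1})\big)\,V\big(B_1,\ldots,B_{n-1},\overline\xi(B_1),\ldots,\overline\xi(B_{n-1})\big),$$ where the mixed volume is taken in $W\times\mathbb{R}^{n-2}$.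
   Context: A convex body is a non-empty compact convex subset; it is centrally symmetric if it is symmetric about some point. $V$ denotes the usual mixed volume in the $(2n-2)$-dimensional space $W\times\mathbb{R}^{n-2}$, normalized by the product of the given measure on $W$ and the Lebesgue measure on $\mathbb{R}^{n-2}$, so that $V(A,\dots,A)$ is the volume of $A$. Convex bodies $A_i,B_i\subset W$ are regarded as subsets $A_i\times\{0\}$, $B_i\times\{0\}$ of $W\times\mathbb{R}^{n-2}$. *)

theory Defs
  imports "HOL-Analysis.Analysis" "HOL-Library.Multiset"
begin

definition convex_body :: "'a::euclidean_space set \<Rightarrow> bool" where
  "convex_body K \<longleftrightarrow> K \<noteq> {} \<and> compact K \<and> convex K"

definition centrally_symmetric :: "'a::real_vector set \<Rightarrow> bool" where
  "centrally_symmetric K \<longleftrightarrow> (\<exists>c. \<forall>v. c + v \<in> K \<longleftrightarrow> c - v \<in> K)"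

text \<open>A vector space without a distinguished inner product carries a Lebesgue measure only up to
  a positive factor.  Hence an arbitrary one is a positive multiple of the measure that the
  inner product of the type singles out.\<close>

definition positive_lebesgue_measure :: "'a::euclidean_space measure \<Rightarrow> bool" where
  "positive_lebesgue_measure \<mu> \<longleftrightarrow> (\<exists>c::real. c > 0 \<and> \<mu> = scale_measure (ennreal c) lborel)"

definition minkowski_comb :: "real \<Rightarrow> 'a::real_vector set \<Rightarrow> real \<Rightarrow> 'a set \<Rightarrow> 'a set" where
  "minkowski_comb s K t L = {s *\<^sub>R x + t *\<^sub>R y | x y. x \<in> K \<and> y \<in> L}"

text \<open>A tuple of bodies is a list whose length is the dimension of the ambient space.\<close>

definition body_tuple :: "'a::euclidean_space set list \<Rightarrow> bool" where
  "body_tuple Ks \<longleftrightarrow> length Ks = DIM('a) \<and> (\<forall>K\<in>set Ks. convex_body K)"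

definition is_mixed_volume ::
    "'a::euclidean_space measure \<Rightarrow> ('a set list \<Rightarrow> real) \<Rightarrow> bool" where
  "is_mixed_volume M V \<longleftrightarrow>
     (\<forall>Ks Ls. body_tuple Ks \<and> mset Ls = mset Ks \<longrightarrow> V Ls = V Ks) \<and>
     (\<forall>Ks K L Ls s t. body_tuple (Ks @ K # Ls) \<and> convex_body L \<and> 0 \<le> s \<and> 0 \<le> t \<longrightarrow>
        V (Ks @ minkowski_comb s K t L # Ls) = s * V (Ks @ K # Ls) + t * V (Ks @ L # Ls)) \<and>
     (\<forall>K. convex_body K \<longrightarrow> V (replicate DIM('a) K) = measure M K)"

text \<open>For a Lebesgue measure \<open>M\<close>, Minkowski's theorem on the volume of \<open>\<lambda>\<^sub>1 K\<^sub>1 + \<dots> + \<lambda>\<^sub>m K\<^sub>m\<close>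
  gives a functional satisfying \<open>is_mixed_volume M\<close>, and polarization shows that its values on
  tuples of convex bodies are determined, so that the choice below is immaterial there.\<close>

definition mixed_volume :: "'a::euclidean_space measure \<Rightarrow> 'a set list \<Rightarrow> real" where
  "mixed_volume M = (SOME V. is_mixed_volume M V)"

definition graphing_map ::
    "('k::finite \<Rightarrow> 'a \<Rightarrow> real) \<Rightarrow> 'a::euclidean_space \<Rightarrow> 'a \<times> (real ^ 'k)" where
  "graphing_map \<xi> w = (w, \<chi> j. \<xi> j w)"

text \<open>The tuple \<open>(A\<^sub>1 \<times> {0}, \<dots>, A\<^sub>m \<times> {0}, \<xi>(B\<^sub>1), \<dots>, \<xi>(B\<^sub>m))\<close>,
  where \<open>\<xi>\<close> is applied through its graphing map; bodies are indexed from 0.\<close>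

definition flat_graph_tuple ::
    "nat \<Rightarrow> ('k::finite \<Rightarrow> 'a \<Rightarrow> real) \<Rightarrow> (nat \<Rightarrow> 'a::euclidean_space set) \<Rightarrow> (nat \<Rightarrow> 'a set)
      \<Rightarrow> ('a \<times> (real ^ 'k)) set list" where
  "flat_graph_tuple m \<xi> A B =
     map (\<lambda>i. A i \<times> {0}) [0..<m] @ map (\<lambda>i. graphing_map \<xi> ` B i) [0..<m]"

end

theory Submission
  imports Defs
begin

text \<open>
  The inequality is a reversed Cauchy-Schwarz inequality.  Put \<open>k = n - 2\<close> and let \<open>f\<close> be the linear
  map with components \<open>\<xi>\<^sub>1, \<dots>, \<xi>\<^sub>k\<close>.  If \<open>f\<close> is not onto, then all bodies lie in the proper subspace
  \<open>W \<times> range f\<close> and the three mixed volumes vanish.  Otherwise \<open>W\<close> splits as a product of a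
  \<open>k\<close>-dimensional space, on which \<open>f\<close> is an isomorphism, and the plane \<open>f = 0\<close>.  A linear map then
  carries the product of two \<open>k\<close>-dimensional spaces and one plane onto the ambient space in such a way
  that the flat bodies come from the first and the last factor, and the graphs from the second and
  the last factor.

  Two such bodies \<open>C\<close> and \<open>D\<close> interact only through the plane: by Fubini, the volume of \<open>C + t D\<close> is
  the integral over pairs \<open>(c, d)\<close> of the area of a sum of two planar fibres \<open>C\<^sub>c\<close> and \<open>D\<^sub>d\<close>, suitably
  scaled.  Hence the mixed volume with half of its entries equal to \<open>C\<close> and the other half equal to
  \<open>D\<close> is a multiple of the double integral of the mixed areas \<open>V(C\<^sub>c, D\<^sub>d)\<close>, here called
  \<open>cross_area\<close>.  By polarization the mixed volumes of the theorem are the values \<open>q(a, a)\<close>,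
  \<open>q(a, b)\<close>, \<open>q(b, b)\<close> of one symmetric bilinear form at two vectors, where \<open>a\<close> is the alternating
  sum of the Minkowski sums of the \<open>A\<^sub>i\<close> over subsets of indices, and \<open>b\<close> that of the \<open>B\<^sub>i\<close>
  (\<open>join_mixvol\<close>).

  The form \<open>q\<close> has at most one positive direction.  In the plane this is Minkowski's inequality
  \<open>V(P, D)\<^sup>2 \<ge> V(P, P) V(D, D)\<close>: because the discriminant does not change when a multiple of \<open>D\<close> is added
  to \<open>P\<close>, it extends to formal differences of bodies, which says that the kernel
  \<open>V(P, D) V(Q, D) - V(P, Q) V(D, D)\<close> is positive semidefinite (\<open>mixed_area_hyperbolic\<close>).  Integrals of
  positive semidefinite kernels are nonnegative, so \<open>q(z, z)\<close> is bounded by the square of a linear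
  functional of \<open>z\<close> (\<open>cross_area_hyperbolic\<close>).  Since \<open>q(a, a)\<close> and \<open>q(b, b)\<close> are nonnegative, being
  mixed volumes, the inequality \<open>q(a, b)\<^sup>2 \<ge> q(a, a) q(b, b)\<close> follows.  Minkowski's inequality in the
  plane itself is obtained by Bonnesen's method, which compares the superlevel sets of the lengths of
  parallel chords.

  All of this presupposes that mixed volumes exist, are multilinear and nonnegative.  For a polytope
  \<open>P\<close> with interior points the gradient of \<open>f(x) = ln (\<Sum>\<^sub>p exp (x \<bullet> p))\<close>, where \<open>p\<close> runs through
  a finite set with convex hull \<open>P\<close>, maps the whole space bijectively onto the interior of \<open>P\<close> up to a
  null set, so the volume of \<open>P\<close> is the integral of the determinant of the Hessian of \<open>f\<close>.  Adding
  polytopes amounts to adding such functions.  Therefore the polarization of the volume is the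
  integral of the polarization of the determinant, that is of a mixed discriminant of positive
  semidefinite matrices, which is multilinear and nonnegative.  The general case follows by
  approximation (\<open>mixvol_add\<close>, \<open>mixvol_scale\<close>, \<open>mixvol_nonneg\<close>, \<open>mixed_volume_exists\<close>).
\<close>

abbreviation vol :: "'a::euclidean_space set \<Rightarrow> real" where
  "vol \<equiv> measure lborel"

section \<open>Polarization by alternating sums over subsets\<close>

text \<open>If \<open>F S\<close> is the value of a homogeneous polynomial of degree \<open>card I\<close> at the sum over \<open>S\<close>
  of vectors indexed by \<open>I\<close>, this is \<open>card I\<close> factorial times the polar form of the polynomial at
  these vectors.\<close>

definition polarize :: "'i set \<Rightarrow> ('i set \<Rightarrow> real) \<Rightarrow> real" where
  "polarize I F = (\<Sum>S\<in>Pow I. (-1) ^ card (I - S) * F S)"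

lemma sum_Pow_alternating:
  assumes "finite A"
  shows "(\<Sum>R\<in>Pow A. (-1) ^ card R) = (if A = {} then 1 else (0::real))"
  using assms
proof (induction A rule: finite_induct)
  case empty
  then show ?case by simp
next
  case (insert a A)
  have inj: "inj_on (insert a) (Pow A)"
    using insert.hyps by (auto simp: inj_on_def)
  have "(\<Sum>R\<in>Pow (insert a A). (-1) ^ card R) =
      (\<Sum>R\<in>Pow A. (-1) ^ card R) + (\<Sum>R\<in>insert a ` Pow A. (-1::real) ^ card R)"
    unfolding Pow_insert using insert.hyps by (intro sum.union_disjoint) auto
  also have "(\<Sum>R\<in>insert a ` Pow A. (-1::real) ^ card R) = (\<Sum>R\<in>Pow A. (-1) ^ card (insert a R))"
    by (subst sum.reindex[OF inj]) simp
  also have "\<dots> = (\<Sum>R\<in>Pow A. - ((-1) ^ card R))"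
  proof (rule sum.cong[OF refl])
    fix R assume "R \<in> Pow A"
    then have "finite R" "a \<notin> R" using insert.hyps finite_subset by auto
    then show "(-1::real) ^ card (insert a R) = - ((-1) ^ card R)" by simp
  qed
  finally show ?case by (simp add: sum_negf)
qed

lemma sum_Pow_alternating_interval:
  assumes "finite I" "T \<subseteq> I"
  shows "(\<Sum>S\<in>{S\<in>Pow I. T \<subseteq> S}. (-1) ^ card (I - S)) = (if T = I then 1 else (0::real))"
proof -
  have "(\<Sum>S\<in>{S\<in>Pow I. T \<subseteq> S}. (-1::real) ^ card (I - S)) = (\<Sum>R\<in>Pow (I - T). (-1) ^ card R)"
    by (rule sum.reindex_bij_witness[where i="\<lambda>R. I - R" and j="\<lambda>S. I - S"])
      (use assms in \<open>auto simp: double_diff\<close>)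
  also have "\<dots> = (if I - T = {} then 1 else 0)"
    using assms by (intro sum_Pow_alternating) auto
  finally show ?thesis using assms by auto
qed

text \<open>Inclusion and exclusion: a term \<open>l\<close> is counted by every \<open>S\<close> between \<open>supp l\<close> and \<open>I\<close>,
  and the signs cancel unless this interval has a single element.  Applied to a product expanded
  over choice functions, only the surjective choices survive.\<close>

lemma polarize_sum_supports:
  assumes "finite I" "finite L" "\<And>l. l \<in> L \<Longrightarrow> supp l \<subseteq> I"
  shows "polarize I (\<lambda>S. \<Sum>l\<in>{l\<in>L. supp l \<subseteq> S}. G l) = (\<Sum>l\<in>{l\<in>L. supp l = I}. G l)"
proof -
  have "polarize I (\<lambda>S. \<Sum>l\<in>{l\<in>L. supp l \<subseteq> S}. G l)
      = (\<Sum>S\<in>Pow I. \<Sum>l\<in>{l\<in>L. supp l \<subseteq> S}. (-1) ^ card (I - S) * G l)"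
    by (simp add: polarize_def sum_distrib_left)
  also have "\<dots> = (\<Sum>l\<in>L. \<Sum>S\<in>{S\<in>Pow I. supp l \<subseteq> S}. (-1) ^ card (I - S) * G l)"
    using assms by (intro sum.swap_restrict) auto
  also have "\<dots> = (\<Sum>l\<in>L. (if supp l = I then 1 else 0) * G l)"
    using assms
    by (intro sum.cong[OF refl], unfold sum_distrib_right[symmetric]) (simp only: sum_Pow_alternating_interval)
  also have "\<dots> = (\<Sum>l\<in>{l\<in>L. supp l = I}. G l)"
    using assms by (intro sum.mono_neutral_cong_right) auto
  finally show ?thesis .
qed

lemma polarize_reindex:
  assumes "bij_betw h J I"
  shows "polarize I F = polarize J (\<lambda>S. F (h ` S))"
proof -
  have inj: "inj_on h J" and im: "h ` J = I" using assms by (auto simp: bij_betw_def)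
  have "bij_betw ((`) h) (Pow J) (Pow I)"
    using assms by (rule bij_betw_Pow)
  then have "(\<Sum>S\<in>Pow I. (-1) ^ card (I - S) * F S) = (\<Sum>S\<in>Pow J. (-1) ^ card (I - h ` S) * F (h ` S))"
    by (rule sum.reindex_bij_betw[symmetric])
  also have "\<dots> = (\<Sum>S\<in>Pow J. (-1) ^ card (J - S) * F (h ` S))"
  proof (rule sum.cong[OF refl])
    fix S assume "S \<in> Pow J"
    then have "I - h ` S = h ` (J - S)" using inj im by (auto simp: inj_on_def)
    moreover have "card (h ` (J - S)) = card (J - S)"
      using inj by (intro card_image) (auto simp: inj_on_def)
    ultimately show "(-1) ^ card (I - h ` S) * F (h ` S) = (-1) ^ card (J - S) * F (h ` S)" by simp
  qed
  finally show ?thesis unfolding polarize_def .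
qed

lemma polarize_cong:
  assumes "\<And>S. S \<subseteq> I \<Longrightarrow> F S = G S"
  shows "polarize I F = polarize I G"
  unfolding polarize_def using assms by (intro sum.cong) auto

lemma polarize_add: "polarize I (\<lambda>S. F S + G S) = polarize I F + polarize I G"
  by (simp add: polarize_def sum.distrib distrib_left)

lemma polarize_mult: "polarize I (\<lambda>S. c * F S) = c * polarize I F"
  by (simp add: polarize_def sum_distrib_left mult.left_commute)

lemma polarize_tendsto:
  assumes "\<And>S. S \<subseteq> I \<Longrightarrow> ((\<lambda>j. F j S) \<longlongrightarrow> G S) net"
  shows "((\<lambda>j. polarize I (F j)) \<longlongrightarrow> polarize I G) net"
  unfolding polarize_def using assms by (intro tendsto_intros) auto

section \<open>Mixed discriminants\<close>

lemma permutes_UNIV_iff_bij: "p permutes UNIV \<longleftrightarrow> bij p"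
  using bij_imp_permutes[of p UNIV] by (auto simp: permutes_bij)

definition outer :: "real^'n \<Rightarrow> real^'n^'n" where
  "outer v = (\<chi> i j. v $ i * v $ j)"

text \<open>This is the mixed discriminant of the matrices, multiplied by the factorial of their
  size.\<close>

definition mixed_disc :: "('n::finite \<Rightarrow> real^'n^'n) \<Rightarrow> real" where
  "mixed_disc H = (\<Sum>\<phi>\<in>{\<phi>. bij \<phi>}. det (\<chi> r. H (\<phi> r) $ r))"

text \<open>The determinant of a sum is multilinear in the rows, so it expands over all assignments
  of a matrix to each row; the alternating sum retains the bijective ones.\<close>

lemma polarize_det:
  fixes H :: "'n::finite \<Rightarrow> real^'n^'n"
  shows "polarize UNIV (\<lambda>S. det (\<Sum>i\<in>S. H i)) = mixed_disc H"
proof -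
  have "det (\<Sum>i\<in>S. H i) = (\<Sum>\<phi>\<in>{\<phi>\<in>UNIV. range \<phi> \<subseteq> S}. det (\<chi> r. H (\<phi> r) $ r))" for S
  proof -
    have "(\<Sum>i\<in>S. H i) = (\<chi> r. \<Sum>i\<in>S. H i $ r)"
      by (simp add: vec_eq_iff)
    then have "det (\<Sum>i\<in>S. H i) = (\<Sum>\<phi>\<in>{\<phi>. \<forall>r. \<phi> r \<in> S}. det (\<chi> r. H (\<phi> r) $ r))"
      using det_linear_rows_sum[of S "\<lambda>r i. H i $ r"] by simp
    also have "{\<phi>. \<forall>r. \<phi> r \<in> S} = {\<phi>\<in>UNIV. range \<phi> \<subseteq> S}" by auto
    finally show ?thesis .
  qed
  then have "polarize UNIV (\<lambda>S. det (\<Sum>i\<in>S. H i))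
      = (\<Sum>\<phi>\<in>{\<phi>\<in>UNIV. range \<phi> = (UNIV::'n set)}. det (\<chi> r. H (\<phi> r) $ r))"
    by (simp only:) (rule polarize_sum_supports; simp)
  also have "{\<phi>\<in>UNIV. range (\<phi>::'n \<Rightarrow> 'n) = UNIV} = {\<phi>. bij \<phi>}"
    by (auto simp: bij_def dest: finite_UNIV_surj_inj[OF finite])
  finally show ?thesis by (simp add: mixed_disc_def)
qed

lemma
  fixes H :: "'n::finite \<Rightarrow> real^'n^'n"
  shows mixed_disc_add: "mixed_disc (H(i := X + Y)) = mixed_disc (H(i := X)) + mixed_disc (H(i := Y))"
    and mixed_disc_scale: "mixed_disc (H(i := c *\<^sub>R X)) = c * mixed_disc (H(i := X))"
proof -
  have row: "(\<chi> r. (H(i := Z)) (\<phi> r) $ r) = (\<chi> r. if r = inv \<phi> i then Z $ r else H (\<phi> r) $ r)"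
    if "bij \<phi>" for \<phi> Z
  proof -
    have "\<phi> r = i \<longleftrightarrow> r = inv \<phi> i" for r
      using that by (metis bij_inv_eq_iff)
    then show ?thesis by (auto simp: vec_eq_iff)
  qed
  have 1: "det (\<chi> r. (H(i := X + Y)) (\<phi> r) $ r) =
      det (\<chi> r. (H(i := X)) (\<phi> r) $ r) + det (\<chi> r. (H(i := Y)) (\<phi> r) $ r)" if "bij \<phi>" for \<phi>
    unfolding row[OF that] vector_add_component by (rule det_row_add)
  have 2: "det (\<chi> r. (H(i := c *\<^sub>R X)) (\<phi> r) $ r) = c * det (\<chi> r. (H(i := X)) (\<phi> r) $ r)"
    if "bij \<phi>" for \<phi>
    unfolding row[OF that] using det_row_mul[of "inv \<phi> i" c "\<lambda>r. X $ r" "\<lambda>r. H (\<phi> r) $ r"]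
    by (simp add: scalar_mult_eq_scaleR if_distrib[of "\<lambda>u. u $ _"] cong: if_cong)
  show "mixed_disc (H(i := X + Y)) = mixed_disc (H(i := X)) + mixed_disc (H(i := Y))"
    unfolding mixed_disc_def sum.distrib[symmetric] by (intro sum.cong) (simp_all only: 1 mem_Collect_eq)
  show "mixed_disc (H(i := c *\<^sub>R X)) = c * mixed_disc (H(i := X))"
    unfolding mixed_disc_def sum_distrib_left by (intro sum.cong) (simp_all only: 2 mem_Collect_eq)
qed

text \<open>For matrices of rank one, each summand is \<open>det v\<close> times one term of the Leibniz formula
  for \<open>det v\<close>.\<close>

lemma mixed_disc_outer:
  fixes v :: "'n::finite \<Rightarrow> real^'n"
  shows "mixed_disc (\<lambda>i. outer (v i)) = (det (\<chi> i. v i))\<^sup>2"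
proof -
  let ?M = "(\<chi> i. v i) :: real^'n^'n"
  have "det (\<chi> r. outer (v (\<phi> r)) $ r) = det ?M * (of_int (sign \<phi>) * (\<Prod>r\<in>UNIV. ?M $ \<phi> r $ r))"
    if "bij \<phi>" for \<phi>
  proof -
    have p: "\<phi> permutes UNIV" using that by (simp add: permutes_UNIV_iff_bij)
    have "(\<chi> r. outer (v (\<phi> r)) $ r) = (\<chi> r. (v (\<phi> r) $ r) *s v (\<phi> r))"
      by (simp add: vec_eq_iff outer_def)
    then have "det (\<chi> r. outer (v (\<phi> r)) $ r) = (\<Prod>r\<in>UNIV. v (\<phi> r) $ r) * det (\<chi> r. v (\<phi> r))"
      by (simp add: det_rows_mul)
    also have "det (\<chi> r. v (\<phi> r)) = of_int (sign \<phi>) * det ?M"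
      using det_permute_rows[OF p, of ?M] by simp
    finally show ?thesis by simp
  qed
  then have "mixed_disc (\<lambda>i. outer (v i)) =
      (\<Sum>\<phi>\<in>{\<phi>. bij \<phi>}. det ?M * (of_int (sign \<phi>) * (\<Prod>r\<in>UNIV. ?M $ \<phi> r $ r)))"
    unfolding mixed_disc_def by (intro sum.cong) auto
  also have "\<dots> = det ?M * (\<Sum>\<phi>\<in>{\<phi>. \<phi> permutes UNIV}. of_int (sign \<phi>) * (\<Prod>r\<in>UNIV. ?M $ \<phi> r $ r))"
    by (simp add: sum_distrib_left permutes_UNIV_iff_bij)
  also have "(\<Sum>\<phi>\<in>{\<phi>. \<phi> permutes UNIV}. of_int (sign \<phi>) * (\<Prod>r\<in>UNIV. ?M $ \<phi> r $ r)) = det (transpose ?M)"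
    by (simp add: det_def transpose_def)
  finally show ?thesis by (simp add: power2_eq_square)
qed

text \<open>The cone of positive semidefinite matrices is presented by generators, so that
  nonnegativity of a multilinear function on it can be tested on matrices of rank one.\<close>

inductive gram :: "real^'n^'n \<Rightarrow> bool" where
  gram_zero: "gram 0"
| gram_step: "gram M \<Longrightarrow> gram (M + outer v)"

lemma gram_outer: "gram (outer v)"
  using gram_step[OF gram_zero, of v] by simp

lemma gram_add: "gram M \<Longrightarrow> gram L \<Longrightarrow> gram (M + L)"
  by (rotate_tac 1, induction L rule: gram.induct) (auto simp: add.assoc[symmetric] intro: gram_step)

lemma gram_scale:
  assumes "gram M" "c \<ge> 0"
  shows "gram (c *\<^sub>R M)"
  using assms
proof (induction rule: gram.induct)
  case gram_zero
  then show ?case by (simp add: gram.gram_zero)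
next
  case (gram_step M v)
  have "c *\<^sub>R outer v = outer (sqrt c *\<^sub>R v)"
    using gram_step.prems by (simp add: vec_eq_iff outer_def)
  then show ?case
    using gram_step by (simp add: scaleR_add_right gram.gram_step)
qed

lemma gram_sum:
  assumes "\<And>i. i \<in> S \<Longrightarrow> gram (H i)"
  shows "gram (\<Sum>i\<in>S. H i)"
  using assms by (induction S rule: infinite_finite_induct) (auto intro: gram_add gram_zero)

text \<open>By multilinearity the general case reduces to matrices of rank one, where the mixed
  discriminant is a square.  The induction replaces the arguments of rank one by arbitrary members
  of the cone, one slot at a time.\<close>

lemma mixed_disc_nonneg:
  fixes H :: "'n::finite \<Rightarrow> real^'n^'n"
  assumes "\<And>i. gram (H i)"
  shows "mixed_disc H \<ge> 0"
proof -
  (* J is the set of slots that have already been generalized from rank one. *)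
  have "mixed_disc H \<ge> 0" if "finite J" "\<And>i. i \<in> J \<Longrightarrow> gram (H i)" "\<And>i. i \<notin> J \<Longrightarrow> \<exists>v. H i = outer v" for J H
    using that
  proof (induction J arbitrary: H rule: finite_induct)
    case empty
    then obtain v where "\<And>i. H i = outer (v i)" by (metis empty_iff)
    then have "H = (\<lambda>i. outer (v i))" by auto
    then show ?case by (simp add: mixed_disc_outer)
  next
    case (insert j J)
    have out: "mixed_disc (H(j := outer v)) \<ge> 0" for v
      using insert.prems insert.hyps by (intro insert.IH) auto
    have "mixed_disc (H(j := M)) \<ge> 0" if "gram M" for M
      using that
    proof (induction rule: gram.induct)
      case gram_zero
      then show ?case using mixed_disc_scale[of H j 0 0] by (simp del: fun_upd_apply)
    next
      case (gram_step M v)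
      then show ?case using out[of v] by (simp add: mixed_disc_add del: fun_upd_apply)
    qed
    from this[of "H j"] show ?case using insert.prems by simp
  qed
  from this[of UNIV H] show ?thesis using assms by simp
qed

lemma mixed_disc_const:
  fixes M :: "real^'n^'n"
  shows "mixed_disc (\<lambda>_. M) = fact CARD('n) * det M"
proof -
  have "{\<phi>::'n\<Rightarrow>'n. bij \<phi>} = {\<phi>. \<phi> permutes UNIV}"
    by (simp add: permutes_UNIV_iff_bij)
  then have "card {\<phi>::'n\<Rightarrow>'n. bij \<phi>} = fact CARD('n)"
    by (simp add: card_permutations)
  then show ?thesis by (simp add: mixed_disc_def)
qed

lemma det_gram_nonneg: "gram M \<Longrightarrow> det M \<ge> 0"
  using mixed_disc_nonneg[of "\<lambda>_. M"] by (simp add: mixed_disc_const zero_le_mult_iff) (use fact_gt_zero[of "CARD('a)", where 'a=real] in linarith)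

section \<open>Volume as the integral of a Hessian determinant\<close>

text \<open>A smooth strictly convex function \<open>f\<close> with gradient \<open>g\<close> and Hessian \<open>H\<close> whose gradients
  fill the interior of \<open>K\<close>.  The last condition says that \<open>f\<close> dominates the support function of
  \<open>K\<close> up to a constant, which makes \<open>\<lambda>x. f x - x \<bullet> y\<close> coercive for every interior point \<open>y\<close> of
  \<open>K\<close>.\<close>

definition potential ::
    "(real^'n) set \<Rightarrow> (real^'n \<Rightarrow> real) \<Rightarrow> (real^'n \<Rightarrow> real^'n) \<Rightarrow> (real^'n \<Rightarrow> real^'n^'n) \<Rightarrow> bool" where
  "potential K f g H \<longleftrightarrow>
     (\<forall>x. (f has_derivative (\<lambda>h. g x \<bullet> h)) (at x)) \<and>
     (\<forall>x. (g has_derivative (\<lambda>h. H x *v h)) (at x)) \<and>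
     (\<forall>x. gram (H x)) \<and> (\<forall>x h. h \<noteq> 0 \<longrightarrow> 0 < h \<bullet> (H x *v h)) \<and>
     (\<forall>x. g x \<in> K) \<and> (\<exists>C. \<forall>x. \<forall>y\<in>K. x \<bullet> y - C \<le> f x)"

text \<open>Support functions add under Minkowski addition, and potentials do so as well; this is
  what turns volumes of Minkowski sums into integrals of determinants of sums.\<close>

lemma potential_add:
  assumes "potential K f g H" "potential L f' g' H'"
  shows "potential (K + L) (\<lambda>x. f x + f' x) (\<lambda>x. g x + g' x) (\<lambda>x. H x + H' x)"
proof -
  obtain C C' where C: "\<And>x y. y \<in> K \<Longrightarrow> x \<bullet> y - C \<le> f x" and C': "\<And>x y. y \<in> L \<Longrightarrow> x \<bullet> y - C' \<le> f' x"
    using assms unfolding potential_def by metis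
  have "\<forall>x. \<forall>y\<in>K + L. x \<bullet> y - (C + C') \<le> f x + f' x"
  proof clarify
    fix x y assume "y \<in> K + L"
    then obtain a b where y: "y = a + b" "a \<in> K" "b \<in> L" by (rule set_plus_elim)
    then show "x \<bullet> y - (C + C') \<le> f x + f' x"
      using C[of a x] C'[of b x] by (simp add: inner_add_right)
  qed
  moreover have "((\<lambda>x. f x + f' x) has_derivative (\<lambda>h. (g x + g' x) \<bullet> h)) (at x)"
    "((\<lambda>x. g x + g' x) has_derivative (\<lambda>h. (H x + H' x) *v h)) (at x)" for x
    unfolding inner_add_left matrix_vector_mult_add_rdistrib
    using assms by (auto simp: potential_def intro: has_derivative_add)
  moreover have "0 < h \<bullet> ((H x + H' x) *v h)" if "h \<noteq> 0" for x h
    using assms that by (simp add: potential_def matrix_vector_mult_add_rdistrib inner_add_right add_pos_pos)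
  moreover have "gram (H x + H' x)" "g x + g' x \<in> K + L" for x
    using assms by (auto simp: potential_def intro: gram_add)
  ultimately show ?thesis unfolding potential_def by blast
qed

lemma potential_scale:
  assumes "potential K f g H" "s > 0"
  shows "potential ((*\<^sub>R) s ` K) (\<lambda>x. s * f x) (\<lambda>x. s *\<^sub>R g x) (\<lambda>x. s *\<^sub>R H x)"
proof -
  obtain C where C: "\<And>x y. y \<in> K \<Longrightarrow> x \<bullet> y - C \<le> f x"
    using assms unfolding potential_def by metis
  have "\<forall>x. \<forall>y\<in>(*\<^sub>R) s ` K. x \<bullet> y - s * C \<le> s * f x"
  proof clarify
    fix x y assume "y \<in> K"
    then have "s * (x \<bullet> y - C) \<le> s * f x" using C \<open>s > 0\<close> by (intro mult_left_mono) auto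
    then show "x \<bullet> (s *\<^sub>R y) - s * C \<le> s * f x" by (simp add: algebra_simps)
  qed
  moreover have "((\<lambda>x. s * f x) has_derivative (\<lambda>h. (s *\<^sub>R g x) \<bullet> h)) (at x)" for x
    using assms has_derivative_mult_right[of f "\<lambda>h. g x \<bullet> h" "at x" s] by (simp add: potential_def)
  moreover have "((\<lambda>x. s *\<^sub>R g x) has_derivative (\<lambda>h. (s *\<^sub>R H x) *v h)) (at x)" for x
    using assms has_derivative_scaleR_right[of g "\<lambda>h. H x *v h" "at x" s]
    by (simp add: potential_def scaleR_matrix_vector_assoc)
  moreover have "0 < h \<bullet> ((s *\<^sub>R H x) *v h)" if "h \<noteq> 0" for x h
    using assms that by (simp add: potential_def scaleR_matrix_vector_assoc[symmetric])
  moreover have "gram (s *\<^sub>R H x)" "s *\<^sub>R g x \<in> (*\<^sub>R) s ` K" for x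
    using assms by (auto simp: potential_def intro: gram_scale)
  ultimately show ?thesis unfolding potential_def by blast
qed

lemma potential_sum:
  assumes "finite S" "S \<noteq> {}" "\<And>i. i \<in> S \<Longrightarrow> potential (K i) (f i) (g i) (H i)"
  shows "potential (\<Sum>i\<in>S. K i) (\<lambda>x. \<Sum>i\<in>S. f i x) (\<lambda>x. \<Sum>i\<in>S. g i x) (\<lambda>x. \<Sum>i\<in>S. H i x)"
  using assms
  by (induction S rule: finite_ne_induct) (auto intro: potential_add)

text \<open>Positive definiteness of the Hessian makes the gradient strictly monotone along every
  segment.\<close>

lemma potential_inj:
  fixes g :: "real^'n \<Rightarrow> real^'n"
  assumes "potential K f g H"
  shows "inj g"
proof (rule injI, rule ccontr)
  fix x x' assume eq: "g x = g x'" and "x \<noteq> x'"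
  define h where "h = x' - x"
  have g: "\<And>x. (g has_derivative (\<lambda>h. H x *v h)) (at x)" and pos: "\<And>x h. h \<noteq> 0 \<Longrightarrow> 0 < h \<bullet> (H x *v h)"
    using assms by (auto simp: potential_def)
  have "((\<lambda>t. h \<bullet> g (x + t *\<^sub>R h)) has_derivative (\<lambda>s. h \<bullet> (H (x + t *\<^sub>R h) *v (s *\<^sub>R h)))) (at t)" for t
    by (rule has_derivative_inner_right, rule has_derivative_compose[where g=g and f="\<lambda>t. x + t *\<^sub>R h", OF _ g])
      (auto intro!: derivative_eq_intros)
  then have "((\<lambda>t. h \<bullet> g (x + t *\<^sub>R h)) has_real_derivative h \<bullet> (H (x + t *\<^sub>R h) *v h)) (at t)" for t
    unfolding has_field_derivative_def
    by (rule has_derivative_eq_rhs) (simp add: matrix_vector_mult_scaleR fun_eq_iff mult.commute)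
  moreover have "0 < h \<bullet> (H (x + t *\<^sub>R h) *v h)" for t
    using \<open>x \<noteq> x'\<close> by (intro pos) (simp add: h_def)
  ultimately have "h \<bullet> g (x + 0 *\<^sub>R h) < h \<bullet> g (x + 1 *\<^sub>R h)"
    by (intro DERIV_pos_imp_increasing[of 0 1 "\<lambda>t. h \<bullet> g (x + t *\<^sub>R h)"]) (simp, blast)
  then show False using eq by (simp add: h_def)
qed

text \<open>For an interior point \<open>y\<close> the function \<open>\<lambda>x. f x - x \<bullet> y\<close> attains its minimum, and the
  gradient of \<open>f\<close> at the minimizer is \<open>y\<close>.\<close>

lemma potential_interior:
  fixes g :: "real^'n \<Rightarrow> real^'n"
  assumes "potential K f g H"
  shows "interior K \<subseteq> range g"
proof
  fix y assume "y \<in> interior K"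
  then obtain r where r: "r > 0" "cball y r \<subseteq> K"
    by (meson mem_interior_cball)
  obtain C where C: "\<And>x y. y \<in> K \<Longrightarrow> x \<bullet> y - C \<le> f x"
    using assms unfolding potential_def by metis
  have f: "\<And>x. (f has_derivative (\<lambda>h. g x \<bullet> h)) (at x)" using assms by (auto simp: potential_def)
  define F where "F x = f x - x \<bullet> y" for x
  have F: "(F has_derivative (\<lambda>h. g x \<bullet> h - h \<bullet> y)) (at x)" for x
    unfolding F_def by (intro derivative_intros f)
  have coercive: "r * norm x - C \<le> F x" for x
  proof -
    have "y + (r / norm x) *\<^sub>R x \<in> K"
      using r by (intro subsetD[OF r(2)]) (auto simp: dist_norm divide_simps)
    from C[OF this, of x] have "x \<bullet> y + (r / norm x) * (x \<bullet> x) - C \<le> f x"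
      by (simp add: inner_add_right)
    moreover have "(r / norm x) * (x \<bullet> x) = r * norm x"
      by (simp add: power2_norm_eq_inner[symmetric] power2_eq_square)
    ultimately show ?thesis by (simp add: F_def)
  qed
  (* Outside the ball of radius R the function F exceeds F 0, so its minimum over the ball is global. *)
  define R where "R = (\<bar>F 0\<bar> + \<bar>C\<bar> + 1) / r"
  have "R > 0" using r by (simp add: R_def)
  have cont: "continuous_on S F" for S
    using F by (meson continuous_at_imp_continuous_on has_derivative_continuous)
  obtain x0 where x0: "x0 \<in> cball 0 R" "\<And>x. x \<in> cball 0 R \<Longrightarrow> F x0 \<le> F x"
    using continuous_attains_inf[of "cball 0 R" F] cont \<open>R > 0\<close> by force
  have "F x0 \<le> F x" for x
  proof (cases "norm x \<le> R")
    case True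
    then show ?thesis using x0 by simp
  next
    case False
    then have "r * R \<le> r * norm x" using r by simp
    moreover have "r * R = \<bar>F 0\<bar> + \<bar>C\<bar> + 1" using r by (simp add: R_def)
    moreover have "F x0 \<le> F 0" using x0 \<open>R > 0\<close> by simp
    ultimately show ?thesis using coercive[of x] by linarith
  qed
  then have "(\<lambda>h. g x0 \<bullet> h - h \<bullet> y) = (\<lambda>h. 0)"
    by (intro has_derivative_local_min[OF F]) simp
  then have "\<forall>h. g x0 \<bullet> h = y \<bullet> h"
    by (auto simp: fun_eq_iff inner_commute)
  then have "g x0 = y" by (simp add: vector_eq_rdot)
  then show "y \<in> range g" by blast
qed

text \<open>The gradient is a bijection from the whole space onto \<open>K\<close> up to the frontier of \<open>K\<close>,
  which is a null set because \<open>K\<close> is convex; the claim is the change of variables along this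
  bijection.\<close>

lemma potential_volume:
  fixes g :: "real^'n::{finite,wellorder} \<Rightarrow> real^'n::_"
  assumes pot: "potential K f g H" and K: "compact K" "convex K"
  shows "((\<lambda>x. det (H x)) has_integral vol K) UNIV"
proof -
  have g: "\<And>x. (g has_derivative (\<lambda>h. H x *v h)) (at x)" and gK: "range g \<subseteq> K" and gram: "\<And>x. gram (H x)"
    using pot by (auto simp: potential_def)
  have Kl: "K \<in> lmeasurable" using K by (simp add: lmeasurable_compact)
  have "sym_diff K (range g) \<subseteq> frontier K"
    using potential_interior[OF pot] gK closure_subset[of K] by (auto simp: frontier_def)
  then have neg: "negligible (sym_diff K (range g))"
    using negligible_convex_frontier[OF K(2)] negligible_subset by blast
  have *: "range g \<in> lmeasurable" "measure lebesgue (range g) = measure lebesgue K"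
    using lmeasurable_negligible_symdiff[OF Kl neg] measure_negligible_symdiff[OF Kl neg] by auto
  have "((\<lambda>x. \<bar>det (matrix ((*v) (H x)))\<bar>) has_integral measure lebesgue K) UNIV"
    using has_measure_differentiable_image[of UNIV g "\<lambda>x. (*v) (H x)" "measure lebesgue K"] * potential_inj[OF pot] g
    by auto
  moreover have "\<bar>det (matrix ((*v) (H x)))\<bar> = det (H x)" for x
    using det_gram_nonneg[OF gram] by simp
  moreover have "measure lebesgue K = vol K"
    using K by (simp add: measure_completion compact_imp_closed)
  ultimately show ?thesis by (simp only:)
qed

lemma outer_vector_mult: "outer v *v h = (v \<bullet> h) *\<^sub>R v"
proof -
  have "(outer v *v h) $ i = ((v \<bullet> h) *\<^sub>R v) $ i" for i
    unfolding outer_def matrix_vector_mult_def inner_vec_def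
    by (simp add: sum_distrib_left mult.assoc mult.commute[of _ "v $ i"])
  then show ?thesis by (simp add: vec_eq_iff)
qed

lemma matrix_sum_vector_mult: "(\<Sum>i\<in>S. (M i :: real^'n^'m)) *v h = (\<Sum>i\<in>S. M i *v h)"
  by (induction S rule: infinite_finite_induct) (auto simp: matrix_vector_mult_add_rdistrib)

text \<open>The logarithm of a sum of exponentials.  Its gradient at \<open>x\<close> is the mean of the points
  of \<open>F\<close> under the weights proportional to \<open>exp (x \<bullet> p)\<close>, and its Hessian is the covariance matrix
  of these weights, which is positive definite unless \<open>F\<close> lies in a hyperplane.\<close>

lemma potential_polytope:
  fixes F :: "(real^'n) set"
  assumes F: "finite F" "interior (convex hull F) \<noteq> {}"
  shows "\<exists>f g H. potential (convex hull F) f g H"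
proof -
  define e :: "real^'n \<Rightarrow> real^'n \<Rightarrow> real" where "e x p = exp (x \<bullet> p)" for x p
  define Z where "Z x = (\<Sum>p\<in>F. e x p)" for x
  define g where "g x = (1 / Z x) *\<^sub>R (\<Sum>p\<in>F. e x p *\<^sub>R p)" for x
  define H where "H x = (\<Sum>p\<in>F. (e x p / Z x) *\<^sub>R outer (p - g x))" for x
  have "F \<noteq> {}" using F(2) by auto
  then have Z: "Z x > 0" for x
    unfolding Z_def e_def using F by (intro sum_pos) auto
  have e_pos: "e x p > 0" for x p by (simp add: e_def)
  have w1: "(\<Sum>p\<in>F. e x p / Z x) = 1" for x
    using Z[of x] by (simp add: sum_divide_distrib[symmetric] Z_def[symmetric])
  have g_alt: "g x = (\<Sum>p\<in>F. (e x p / Z x) *\<^sub>R p)" for x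
    by (simp add: g_def scaleR_sum_right)
  have dZ: "(Z has_derivative (\<lambda>h. \<Sum>p\<in>F. e x p * (h \<bullet> p))) (at x)" for x
    unfolding Z_def e_def by (auto intro!: derivative_eq_intros simp: fun_eq_iff mult_ac)
  have dN: "((\<lambda>x. \<Sum>p\<in>F. e x p *\<^sub>R p) has_derivative (\<lambda>h. \<Sum>p\<in>F. (e x p * (h \<bullet> p)) *\<^sub>R p)) (at x)" for x
    unfolding e_def by (auto intro!: derivative_eq_intros simp: fun_eq_iff mult_ac)
  have gh: "(\<Sum>p\<in>F. e x p * (h \<bullet> p)) / Z x = g x \<bullet> h" for x h
    by (simp add: g_alt inner_sum_right sum_divide_distrib inner_commute[of _ h])
  have "((\<lambda>x. ln (Z x)) has_derivative (\<lambda>h. g x \<bullet> h)) (at x)" for x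
    by (rule has_derivative_eq_rhs[OF has_derivative_ln[OF Z dZ]])
      (simp add: gh[symmetric] divide_inverse)
  moreover have "(g has_derivative (\<lambda>h. H x *v h)) (at x)" for x
  proof -
    have "(g has_derivative (\<lambda>h. (1 / Z x) *\<^sub>R (\<Sum>p\<in>F. (e x p * (h \<bullet> p)) *\<^sub>R p)
        - ((\<Sum>p\<in>F. e x p * (h \<bullet> p)) / (Z x * Z x)) *\<^sub>R (\<Sum>p\<in>F. e x p *\<^sub>R p))) (at x)"
    proof -
      have "((\<lambda>x. 1 / Z x) has_derivative (\<lambda>h. - (\<Sum>p\<in>F. e x p * (h \<bullet> p)) / (Z x * Z x))) (at x)"
        using Z[of x]
        by (intro has_derivative_eq_rhs[OF has_derivative_divide[OF has_derivative_const dZ]])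
          (auto simp: fun_eq_iff divide_inverse mult_ac)
      from has_derivative_scaleR[OF this dN] show ?thesis
        unfolding g_def by (rule has_derivative_eq_rhs) (simp add: fun_eq_iff)
    qed
    moreover have "(1 / Z x) *\<^sub>R (\<Sum>p\<in>F. (e x p * (h \<bullet> p)) *\<^sub>R p)
        - ((\<Sum>p\<in>F. e x p * (h \<bullet> p)) / (Z x * Z x)) *\<^sub>R (\<Sum>p\<in>F. e x p *\<^sub>R p) = H x *v h" for h
    proof -
      define w where "w p = e x p / Z x" for p
      have w1': "(\<Sum>p\<in>F. w p) = 1" using w1[of x] by (simp add: w_def)
      have wg: "(\<Sum>p\<in>F. w p *\<^sub>R p) = g x" by (simp add: g_alt w_def)
      have wh: "(\<Sum>p\<in>F. w p * (h \<bullet> p)) = g x \<bullet> h"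
        unfolding gh[symmetric] by (simp add: w_def sum_divide_distrib)
      have "((\<Sum>p\<in>F. e x p * (h \<bullet> p)) / (Z x * Z x)) *\<^sub>R (\<Sum>p\<in>F. e x p *\<^sub>R p) = (g x \<bullet> h) *\<^sub>R g x"
        unfolding gh[symmetric] by (simp add: g_def)
      moreover have "(1 / Z x) *\<^sub>R (\<Sum>p\<in>F. (e x p * (h \<bullet> p)) *\<^sub>R p) = (\<Sum>p\<in>F. (w p * (h \<bullet> p)) *\<^sub>R p)"
        by (simp add: w_def scaleR_sum_right)
      moreover have "H x *v h = (\<Sum>p\<in>F. w p *\<^sub>R (((p - g x) \<bullet> h) *\<^sub>R (p - g x)))"
        by (simp add: H_def matrix_sum_vector_mult scaleR_matrix_vector_assoc[symmetric] outer_vector_mult w_def)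
      moreover have "\<dots> = (\<Sum>p\<in>F. (w p * (h \<bullet> p)) *\<^sub>R p) - (\<Sum>p\<in>F. w p * (h \<bullet> p)) *\<^sub>R g x
          - (g x \<bullet> h) *\<^sub>R (\<Sum>p\<in>F. w p *\<^sub>R p) + (\<Sum>p\<in>F. w p) *\<^sub>R ((g x \<bullet> h) *\<^sub>R g x)"
        unfolding scaleR_sum_left scaleR_sum_right sum_subtractf[symmetric] sum.distrib[symmetric]
        by (intro sum.cong refl) (simp add: algebra_simps inner_commute)
      ultimately show ?thesis by (simp add: w1' wg wh)
    qed
    ultimately show ?thesis by simp
  qed
  moreover have "gram (H x)" for x
    unfolding H_def using Z[of x] e_pos
    by (intro gram_sum gram_scale gram_outer) (simp add: less_imp_le)
  moreover have "0 < h \<bullet> (H x *v h)" if "h \<noteq> 0" for x h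
  proof -
    have eq: "h \<bullet> (H x *v h) = (\<Sum>p\<in>F. (e x p / Z x) * ((p - g x) \<bullet> h)\<^sup>2)"
      by (simp add: H_def matrix_sum_vector_mult scaleR_matrix_vector_assoc[symmetric] outer_vector_mult
          inner_sum_right power2_eq_square inner_commute mult.assoc)
    have "\<exists>p\<in>F. (p - g x) \<bullet> h \<noteq> 0"
    proof (rule ccontr)
      assume "\<not> ?thesis"
      then have "F \<subseteq> {p. h \<bullet> p = h \<bullet> g x}" by (auto simp: inner_diff_left inner_diff_right inner_commute)
      then have "convex hull F \<subseteq> {p. h \<bullet> p = h \<bullet> g x}"
        by (intro hull_minimal convex_hyperplane)
      then have "interior (convex hull F) \<subseteq> interior {p. h \<bullet> p = h \<bullet> g x}" by (rule interior_mono)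
      then show False using F(2) that by (simp add: interior_hyperplane)
    qed
    then obtain p where p: "p \<in> F" "(p - g x) \<bullet> h \<noteq> 0" by blast
    have "0 < (\<Sum>p\<in>F. (e x p / Z x) * ((p - g x) \<bullet> h)\<^sup>2)"
      using F(1) p e_pos Z[of x] by (intro sum_pos2[of _ p]) (auto simp: less_imp_le zero_less_mult_iff)
    then show ?thesis by (simp add: eq)
  qed
  moreover have "g x \<in> convex hull F" for x
    unfolding g_alt using e_pos[of x] Z[of x]
    by (intro convex_sum[OF F(1) convex_convex_hull w1]) (auto intro: hull_inc simp: less_imp_le)
  moreover have "x \<bullet> y - 0 \<le> ln (Z x)" if "y \<in> convex hull F" for x y
  proof -
    have "F \<subseteq> {y. x \<bullet> y \<le> ln (Z x)}"
    proof clarify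
      fix p assume "p \<in> F"
      then have "e x p \<le> Z x"
        unfolding Z_def using F e_pos by (intro member_le_sum) (auto simp: less_imp_le)
      then have "ln (e x p) \<le> ln (Z x)" using e_pos Z by simp
      then show "x \<bullet> p \<le> ln (Z x)" by (simp add: e_def)
    qed
    then have "convex hull F \<subseteq> {y. x \<bullet> y \<le> ln (Z x)}"
      by (intro hull_minimal convex_halfspace_le)
    then show ?thesis using that by auto
  qed
  ultimately show ?thesis unfolding potential_def by blast
qed

section \<open>Convex bodies and the polarized volume\<close>

text \<open>Minkowski's polarization formula for the mixed volume.  The functional \<open>m\<close> and the index
  set are arbitrary, so that the formula can be moved along linear maps and bijections of indices.\<close>

definition mixvol :: "('a::real_vector set \<Rightarrow> real) \<Rightarrow> 'i set \<Rightarrow> ('i \<Rightarrow> 'a set) \<Rightarrow> real" where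
  "mixvol m I K = polarize I (\<lambda>S. m (\<Sum>i\<in>S. K i)) / fact (card I)"

lemma mixvol_cong: "(\<And>i. i \<in> I \<Longrightarrow> K i = L i) \<Longrightarrow> mixvol m I K = mixvol m I L"
  unfolding mixvol_def by (intro arg_cong2[where f="(/)"] polarize_cong refl arg_cong[where f=m] sum.cong) auto

lemma mixvol_reindex:
  assumes "bij_betw h J I"
  shows "mixvol m I K = mixvol m J (\<lambda>j. K (h j))"
proof -
  have "sum K (h ` S) = (\<Sum>j\<in>S. K (h j))" if "S \<subseteq> J" for S
    using assms that by (subst sum.reindex) (auto simp: bij_betw_def inj_on_def)
  then show ?thesis
    unfolding mixvol_def polarize_reindex[OF assms] bij_betw_same_card[OF assms, symmetric]
    by (intro arg_cong2[where f="(/)"] polarize_cong refl) auto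
qed

lemma convex_body_plus: "convex_body K \<Longrightarrow> convex_body L \<Longrightarrow> convex_body (K + L)"
proof -
  assume KL: "convex_body K" "convex_body L"
  have "K + L = {x + y | x y. x \<in> K \<and> y \<in> L}"
    by (auto simp: set_plus_def)
  then show ?thesis
    using KL compact_sums[of K L] convex_set_plus[of K L] unfolding convex_body_def by auto
qed

lemma convex_body_zero: "convex_body 0"
  by (simp add: convex_body_def)

lemma convex_body_sum: "(\<And>i. i \<in> S \<Longrightarrow> convex_body (K i)) \<Longrightarrow> convex_body (\<Sum>i\<in>S. K i)"
  by (induction S rule: infinite_finite_induct) (simp_all add: convex_body_zero convex_body_plus del: set_zero)

lemma convex_body_linear_image: "linear T \<Longrightarrow> convex_body K \<Longrightarrow> convex_body (T ` K)"
  unfolding convex_body_def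
  by (auto intro!: convex_linear_image compact_continuous_image linear_continuous_on
      simp: linear_conv_bounded_linear[symmetric])

lemma convex_body_scale: "convex_body K \<Longrightarrow> convex_body ((*\<^sub>R) s ` K)"
  by (rule convex_body_linear_image) (simp_all add: linear_scale_self)

lemma convex_body_measurable [measurable]: "convex_body K \<Longrightarrow> K \<in> sets borel"
  by (simp add: convex_body_def borel_compact)

lemma det_zero_matrix: "det (0 :: real^'n^'n) = 0"
  by (rule det_zero_row(1)[of undefined]) (simp add: row_def vec_eq_iff)

text \<open>Each Minkowski sum over a nonempty set of indices has the sum of the potentials as a
  potential, so the alternating sum of volumes is the integral of the alternating sum of
  determinants.\<close>

lemma has_integral_mixed_disc:
  fixes K :: "'n::{finite,wellorder} \<Rightarrow> (real^'n::_) set"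
  assumes "\<And>i. convex_body (K i)" and pot: "\<And>i. potential (K i) (f i) (g i) (H i)"
  shows "((\<lambda>x. mixed_disc (\<lambda>i. H i x)) has_integral polarize UNIV (\<lambda>S. vol (\<Sum>i\<in>S. K i))) UNIV"
proof -
  have "((\<lambda>x. det (\<Sum>i\<in>S. H i x)) has_integral vol (\<Sum>i\<in>S. K i)) UNIV" for S
  proof (cases "S = {}")
    case True
    then show ?thesis by (simp add: det_zero_matrix)
  next
    case False
    have "convex_body (\<Sum>i\<in>S. K i)" using assms by (intro convex_body_sum)
    then show ?thesis
      using potential_volume[OF potential_sum[OF finite False pot]] by (simp add: convex_body_def)
  qed
  then show ?thesis
    unfolding polarize_det[symmetric] polarize_def
    by (intro has_integral_sum has_integral_mult_right) auto
qed

section \<open>Multilinearity and nonnegativity in coordinate spaces\<close>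

definition potential_body :: "(real^'n) set \<Rightarrow> bool" where
  "potential_body K \<longleftrightarrow> convex_body K \<and> (\<exists>f g H. potential K f g H)"

lemma potential_body_convex: "potential_body K \<Longrightarrow> convex_body K"
  by (simp add: potential_body_def)

lemma potential_body_plus: "potential_body K \<Longrightarrow> potential_body L \<Longrightarrow> potential_body (K + L)"
  unfolding potential_body_def by (meson convex_body_plus potential_add)

lemma potential_body_scale: "potential_body K \<Longrightarrow> s > 0 \<Longrightarrow> potential_body ((*\<^sub>R) s ` K)"
  unfolding potential_body_def by (meson convex_body_scale potential_scale)

text \<open>The Hessians of the remaining bodies can be chosen independently of the body in slot
  \<open>i\<close>; linearity in that slot then reduces to linearity of the mixed discriminant.\<close>

lemma potential_polarize_update:
  fixes K :: "'n::{finite,wellorder} \<Rightarrow> (real^'n::_) set"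
  assumes K: "\<And>j. potential_body (K j)"
  shows "\<exists>H. \<forall>C f g HC. convex_body C \<longrightarrow> potential C f g HC \<longrightarrow>
    ((\<lambda>x. mixed_disc ((\<lambda>j. H j x)(i := HC x))) has_integral
      polarize UNIV (\<lambda>S. vol (sum (K(i := C)) S))) UNIV"
proof -
  obtain f g H where H: "\<And>j. potential (K j) (f j) (g j) (H j)"
    using K unfolding potential_body_def by metis
  have "((\<lambda>x. mixed_disc ((\<lambda>j. H j x)(i := HC x))) has_integral
      polarize UNIV (\<lambda>S. vol (sum (K(i := C)) S))) UNIV"
    if "convex_body C" "potential C fc gc HC" for C fc gc HC
  proof -
    have "(\<lambda>j. (H(i := HC)) j x) = (\<lambda>j. H j x)(i := HC x)" for x by auto
    then show ?thesis
      using has_integral_mixed_disc[of "K(i := C)" "f(i := fc)" "g(i := gc)" "H(i := HC)"] K that H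
      by (auto simp: potential_body_def)
  qed
  then show ?thesis by blast
qed

lemma potential_polarize_add:
  fixes K :: "'n::{finite,wellorder} \<Rightarrow> (real^'n::_) set"
  assumes K: "\<And>i. potential_body (K i)" and A: "potential_body A" and B: "potential_body B"
  shows "polarize UNIV (\<lambda>S. vol (sum (K(i := A + B)) S)) =
    polarize UNIV (\<lambda>S. vol (sum (K(i := A)) S)) + polarize UNIV (\<lambda>S. vol (sum (K(i := B)) S))"
proof -
  obtain H where upd: "\<And>C f g HC. convex_body C \<Longrightarrow> potential C f g HC \<Longrightarrow>
    ((\<lambda>x. mixed_disc ((\<lambda>j. H j x)(i := HC x))) has_integral
      polarize UNIV (\<lambda>S. vol (sum (K(i := C)) S))) UNIV"
    using potential_polarize_update[of K i, OF K] by blast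
  obtain fa ga HA where HA: "convex_body A" "potential A fa ga HA" using A unfolding potential_body_def by metis
  obtain fb gb HB where HB: "convex_body B" "potential B fb gb HB" using B unfolding potential_body_def by metis
  show ?thesis
    using upd[OF convex_body_plus[OF HA(1) HB(1)] potential_add[OF HA(2) HB(2)]]
      has_integral_add[OF upd[OF HA] upd[OF HB]]
    unfolding mixed_disc_add by (rule has_integral_unique)
qed

lemma potential_polarize_scale:
  fixes K :: "'n::{finite,wellorder} \<Rightarrow> (real^'n::_) set"
  assumes K: "\<And>i. potential_body (K i)" and A: "potential_body A" and s: "s > 0"
  shows "polarize UNIV (\<lambda>S. vol (sum (K(i := (*\<^sub>R) s ` A)) S)) =
    s * polarize UNIV (\<lambda>S. vol (sum (K(i := A)) S))"
proof -
  obtain H where upd: "\<And>C f g HC. convex_body C \<Longrightarrow> potential C f g HC \<Longrightarrow>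
    ((\<lambda>x. mixed_disc ((\<lambda>j. H j x)(i := HC x))) has_integral
      polarize UNIV (\<lambda>S. vol (sum (K(i := C)) S))) UNIV"
    using potential_polarize_update[of K i, OF K] by blast
  obtain fa ga HA where HA: "convex_body A" "potential A fa ga HA" using A unfolding potential_body_def by metis
  show ?thesis
    using upd[OF convex_body_scale[OF HA(1)] potential_scale[OF HA(2) s]] has_integral_mult_right[OF upd[OF HA]]
    unfolding mixed_disc_scale by (rule has_integral_unique)
qed

lemma potential_polarize_nonneg:
  fixes K :: "'n::{finite,wellorder} \<Rightarrow> (real^'n::_) set"
  assumes K: "\<And>i. potential_body (K i)"
  shows "polarize UNIV (\<lambda>S. vol (sum K S)) \<ge> 0"
proof -
  obtain f g H where H: "\<And>i. potential (K i) (f i) (g i) (H i)"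
    using K unfolding potential_body_def by metis
  have "mixed_disc (\<lambda>i. H i x) \<ge> 0" for x
    using H by (intro mixed_disc_nonneg) (auto simp: potential_def)
  then show ?thesis
    using has_integral_nonneg[OF has_integral_mixed_disc[OF _ H]] K by (auto simp: potential_body_def)
qed

text \<open>The factor \<open>c\<close> makes the notion stable under Minkowski sums and multiples.\<close>

definition outer_approx :: "real \<Rightarrow> 'a::euclidean_space set \<Rightarrow> (nat \<Rightarrow> 'a set) \<Rightarrow> bool" where
  "outer_approx c K P \<longleftrightarrow> 0 \<le> c \<and> (\<forall>j. K \<subseteq> P j \<and> P j \<subseteq> K + cball 0 (c / Suc j))"

lemma cball_plus_cball: "cball 0 r + cball 0 s \<subseteq> cball (0::'a::euclidean_space) (r + s)"
  by (auto simp: set_plus_def intro: norm_triangle_mono)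

lemma outer_approx_plus:
  assumes "outer_approx c K P" "outer_approx d L Q"
  shows "outer_approx (c + d) (K + L) (\<lambda>j. P j + Q j)"
proof -
  have "P j + Q j \<subseteq> K + L + cball 0 ((c + d) / Suc j)" for j
  proof -
    have "P j + Q j \<subseteq> (K + cball 0 (c / Suc j)) + (L + cball 0 (d / Suc j))"
      using assms unfolding outer_approx_def by (intro set_plus_mono2) auto
    also have "\<dots> = (K + L) + (cball 0 (c / Suc j) + cball 0 (d / Suc j))"
      by (simp add: algebra_simps)
    also have "\<dots> \<subseteq> (K + L) + cball 0 ((c + d) / Suc j)"
      unfolding add_divide_distrib by (intro set_plus_mono2 cball_plus_cball subset_refl)
    finally show ?thesis .
  qed
  moreover have "K + L \<subseteq> P j + Q j" for j
    using assms unfolding outer_approx_def by (intro set_plus_mono2) auto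
  ultimately show ?thesis
    using assms unfolding outer_approx_def by simp
qed

lemma outer_approx_scale:
  assumes "outer_approx c K P" "s \<ge> 0"
  shows "outer_approx (s * c) ((*\<^sub>R) s ` K) (\<lambda>j. (*\<^sub>R) s ` P j)"
proof -
  have "(*\<^sub>R) s ` P j \<subseteq> (*\<^sub>R) s ` K + cball 0 (s * c / Suc j)" for j
  proof (rule image_subsetI)
    fix x assume "x \<in> P j"
    then obtain a b where x: "x = a + b" "a \<in> K" "norm b \<le> c / Suc j"
      using assms by (fastforce simp: outer_approx_def elim: set_plus_elim)
    from x(3) have "norm (s *\<^sub>R b) \<le> s * (c / Suc j)"
      using \<open>s \<ge> 0\<close> mult_left_mono[of "norm b" "c / Suc j" s] by simp
    then show "s *\<^sub>R x \<in> (*\<^sub>R) s ` K + cball 0 (s * c / Suc j)"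
      unfolding x scaleR_add_right using x(2) by (intro set_plus_intro) auto
  qed
  moreover have "(*\<^sub>R) s ` K \<subseteq> (*\<^sub>R) s ` P j" for j
    using assms unfolding outer_approx_def by (intro image_mono) auto
  ultimately show ?thesis using assms unfolding outer_approx_def by simp
qed

lemma outer_approx_sum:
  assumes "\<And>i. i \<in> S \<Longrightarrow> outer_approx (c i) (K i) (P i)"
  shows "outer_approx (\<Sum>i\<in>S. c i) (\<Sum>i\<in>S. K i) (\<lambda>j. \<Sum>i\<in>S. P i j)"
  using assms
proof (induction S rule: infinite_finite_induct)
  case (insert i S)
  then show ?case by (simp add: outer_approx_plus)
qed (auto simp: outer_approx_def set_plus_def)

text \<open>Squeeze \<open>P j\<close> between \<open>K\<close> and its compact neighbourhoods of radius \<open>c / Suc j\<close>, which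
  decrease to \<open>K\<close>.\<close>

lemma measure_outer_approx:
  assumes K: "convex_body K" and P: "\<And>j. convex_body (P j)" and approx: "outer_approx c K P"
  shows "(\<lambda>j. vol (P j)) \<longlonglongrightarrow> vol K"
proof (rule tendsto_sandwich[where f="\<lambda>_. vol K" and h="\<lambda>j. vol (K + cball 0 (c / Suc j))"])
  define N where "N j = K + cball 0 (c / Suc j)" for j :: nat
  have c: "0 \<le> c" and KP: "\<And>j. K \<subseteq> P j" and PN: "\<And>j. P j \<subseteq> N j"
    using approx by (auto simp: outer_approx_def N_def)
  have N: "convex_body (N j)" for j
    unfolding N_def using c by (intro convex_body_plus K) (auto simp: convex_body_def not_less)
  have fin: "emeasure lborel L < \<infinity>" if "convex_body L" for L :: "'a set"
    using that by (intro emeasure_bounded_finite) (simp add: convex_body_def compact_imp_bounded)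
  have mono: "vol L \<le> vol L'" if "L \<subseteq> L'" "convex_body L" "convex_body L'" for L L' :: "'a set"
    using that fin[of L'] by (intro measure_mono_fmeasurable) (auto simp: fmeasurable_def)
  have "decseq N"
    unfolding decseq_def N_def using c
    by (intro allI impI set_plus_mono2 subset_refl cball_subset_cball_iff[THEN iffD2])
      (auto intro!: disjI1 frac_le)
  have "(\<Inter>j. N j) = K"
  proof
    show "K \<subseteq> (\<Inter>j. N j)" using KP PN by blast
    show "(\<Inter>j. N j) \<subseteq> K"
    proof
      fix x assume x: "x \<in> (\<Inter>j. N j)"
      have "infdist x K \<le> c / Suc j" for j
      proof -
        obtain a b where "x = a + b" "a \<in> K" "norm b \<le> c / Suc j"
          using x[THEN INT_D, of j] by (auto simp: N_def elim!: set_plus_elim)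
        then show ?thesis
          using infdist_le[of a K x] by (simp add: dist_norm)
      qed
      moreover have "(\<lambda>j. c / Suc j) \<longlonglongrightarrow> 0"
        using LIMSEQ_inverse_real_of_nat[THEN tendsto_mult_left, of c] by (simp add: field_simps)
      ultimately have "infdist x K \<le> 0" by (intro LIMSEQ_le_const) auto
      then have "infdist x K = 0" using infdist_nonneg[of x K] by simp
      then show "x \<in> K"
        using K in_closed_iff_infdist_zero[of K x] by (simp add: convex_body_def compact_imp_closed)
    qed
  qed
  moreover have "(\<lambda>j. vol (N j)) \<longlonglongrightarrow> vol (\<Inter>j. N j)"
    using N fin[OF N] \<open>decseq N\<close> by (intro Lim_measure_decseq) (auto simp: less_top[symmetric])
  ultimately show "(\<lambda>j. vol (K + cball 0 (c / Suc j))) \<longlonglongrightarrow> vol K"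
    unfolding N_def by simp
  show "\<forall>\<^sub>F j in sequentially. vol (P j) \<le> vol (K + cball 0 (c / Suc j))"
    using mono[OF PN P N] by (simp add: N_def)
  show "\<forall>\<^sub>F j in sequentially. vol K \<le> vol (P j)"
    using mono[OF KP K P] by simp
qed (rule tendsto_const)

text \<open>The polytope spanned by a fine net of \<open>K\<close> thickened by a small cube.  The cube ensures
  that the polytope covers \<open>K\<close> and that it has interior points even when \<open>K\<close> has none.\<close>

lemma potential_body_between:
  fixes K :: "(real^'n) set"
  assumes K: "convex_body K" and "\<epsilon> > 0"
  shows "\<exists>P. potential_body P \<and> K \<subseteq> P \<and> P \<subseteq> K + cball 0 \<epsilon>"
proof -
  define d where "d = \<epsilon> / DIM(real^'n)"
  have d: "d > 0" using \<open>\<epsilon> > 0\<close> by (simp add: d_def)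
  define D where "D = (\<Sum>i\<in>Basis. d *\<^sub>R i :: real^'n)"
  have Di: "D \<bullet> i = d" if "i \<in> Basis" for i
    using that by (simp add: D_def inner_sum_left inner_Basis if_distrib cong: if_cong)
  obtain S :: "(real^'n) set" where S: "finite S" "cbox (-D) D = convex hull S"
    using cube_convex_hull[OF d, of 0] by (auto simp: D_def)
  obtain F0 where F0: "finite F0" "F0 \<subseteq> K" "K \<subseteq> (\<Union>x\<in>F0. ball x d)"
  proof (rule compactE_image[of K K "\<lambda>x. ball x d"])
    show "compact K" using K by (simp add: convex_body_def)
  qed (use d in auto)
  have near: "y + z \<in> convex hull (F0 + S)" if "y \<in> F0" "norm z < d" for y z
  proof -
    have "z \<in> cbox (-D) D"
      using that(2) Basis_le_norm[of _ z] by (fastforce simp: mem_box Di abs_le_iff)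
    then show ?thesis
      unfolding convex_hull_set_plus S(2)[symmetric] using that(1) by (intro set_plus_intro hull_inc)
  qed
  have sub: "K \<subseteq> convex hull (F0 + S)"
  proof
    fix x assume "x \<in> K"
    then obtain y where "y \<in> F0" "norm (x - y) < d"
      using F0(3) by (auto simp: dist_norm norm_minus_commute)
    then show "x \<in> convex hull (F0 + S)" using near[of y "x - y"] by simp
  qed
  obtain y where "y \<in> F0" using F0(3) K by (auto simp: convex_body_def)
  have "ball y d \<subseteq> convex hull (F0 + S)"
  proof
    fix x assume "x \<in> ball y d"
    then show "x \<in> convex hull (F0 + S)"
      using near[OF \<open>y \<in> F0\<close>, of "x - y"] by (simp add: dist_norm norm_minus_commute)
  qed
  then have "interior (convex hull (F0 + S)) \<noteq> {}"
    using d interior_maximal[of "ball y d"] by (metis centre_in_ball empty_iff open_ball subsetD)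
  moreover have "finite (F0 + S)" using F0(1) S(1) by (rule finite_set_plus)
  ultimately have "\<exists>f g H. potential (convex hull (F0 + S)) f g H" by (intro potential_polytope)
  moreover have "convex_body (convex hull (F0 + S))"
    using \<open>finite (F0 + S)\<close> \<open>interior _ \<noteq> {}\<close> interior_subset
    by (auto simp: convex_body_def finite_imp_compact_convex_hull)
  moreover have "convex hull (F0 + S) \<subseteq> K + cball 0 \<epsilon>"
    unfolding convex_hull_set_plus
  proof (rule set_plus_mono2)
    show "convex hull F0 \<subseteq> K" using F0(2) K by (intro hull_minimal) (auto simp: convex_body_def)
    show "convex hull S \<subseteq> cball 0 \<epsilon>"
      unfolding S(2)[symmetric]
    proof
      fix z assume "z \<in> cbox (-D) D"
      then have "\<bar>z \<bullet> i\<bar> \<le> d" if "i \<in> Basis" for i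
        using that by (force simp: mem_box Di abs_le_iff)
      then have "(\<Sum>i\<in>Basis. \<bar>z \<bullet> i\<bar>) \<le> DIM(real^'n) * d"
        by (rule sum_bounded_above)
      then show "z \<in> cball 0 \<epsilon>"
        using norm_le_l1[of z] by (simp add: d_def)
    qed
  qed
  ultimately show ?thesis using sub unfolding potential_body_def by blast
qed

lemma potential_outer_approx:
  fixes K :: "(real^'n) set"
  assumes "convex_body K"
  shows "\<exists>P. (\<forall>j. potential_body (P j)) \<and> outer_approx 1 K P"
proof -
  have "\<forall>j. \<exists>P. potential_body P \<and> K \<subseteq> P \<and> P \<subseteq> K + cball 0 (1 / real (Suc j))"
    using potential_body_between[OF assms] by simp
  then obtain P where "\<forall>j. potential_body (P j) \<and> K \<subseteq> P j \<and> P j \<subseteq> K + cball 0 (1 / real (Suc j))" by metis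
  then show ?thesis by (intro exI[of _ P]) (auto simp: outer_approx_def)
qed

lemma polarize_outer_approx:
  fixes K :: "'i \<Rightarrow> 'a::euclidean_space set"
  assumes "\<And>i. convex_body (K i)" "\<And>i j. convex_body (P i j)" "\<And>i. outer_approx (c i) (K i) (P i)"
  shows "(\<lambda>j. polarize I (\<lambda>S. vol (\<Sum>i\<in>S. P i j))) \<longlonglongrightarrow>
    polarize I (\<lambda>S. vol (\<Sum>i\<in>S. K i))"
  by (intro polarize_tendsto measure_outer_approx convex_body_sum assms) (rule outer_approx_sum, rule assms)

text \<open>The approximation of the bodies outside slot \<open>i\<close> is chosen first, so that identities
  between different entries of slot \<open>i\<close> can be passed to the limit along one sequence.\<close>

lemma polarize_approx_update:
  fixes K :: "'n::{finite,wellorder} \<Rightarrow> (real^'n::_) set"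
  assumes K: "\<And>k. convex_body (K k)"
  shows "\<exists>P. (\<forall>j k. potential_body (P j k)) \<and>
    (\<forall>Q C c. (\<forall>j. potential_body (Q j)) \<longrightarrow> outer_approx c C Q \<longrightarrow> convex_body C \<longrightarrow>
      (\<lambda>j. polarize UNIV (\<lambda>S. vol (sum ((P j)(i := Q j)) S))) \<longlonglongrightarrow>
      polarize UNIV (\<lambda>S. vol (sum (K(i := C)) S)))"
proof -
  have "\<exists>P. (\<forall>j. potential_body (P j)) \<and> outer_approx 1 (K k) P" for k
    using potential_outer_approx[OF K] .
  then obtain P where P: "\<And>k j. potential_body (P k j)" "\<And>k. outer_approx 1 (K k) (P k)"
    by metis
  have "(\<lambda>j. polarize UNIV (\<lambda>S. vol (sum ((\<lambda>k. P k j)(i := Q j)) S))) \<longlonglongrightarrow>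
      polarize UNIV (\<lambda>S. vol (sum (K(i := C)) S))"
    if "\<forall>j. potential_body (Q j)" "outer_approx c C Q" "convex_body C" for Q C c
  proof -
    have "(\<lambda>k. P k j)(i := Q j) = (\<lambda>k. (P(i := Q)) k j)" for j by (simp add: fun_eq_iff)
    then show ?thesis
      using polarize_outer_approx[of "K(i := C)" "P(i := Q)" "(\<lambda>_. 1)(i := c)" UNIV] P that K
      by (auto simp: potential_body_convex)
  qed
  then show ?thesis using P(1) by (intro exI[of _ "\<lambda>j k. P k j"]) blast
qed

lemma polarize_volume_add:
  fixes K :: "'n::{finite,wellorder} \<Rightarrow> (real^'n::_) set"
  assumes K: "\<And>i. convex_body (K i)" and A: "convex_body A" and B: "convex_body B"
  shows "polarize UNIV (\<lambda>S. vol (sum (K(i := A + B)) S)) =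
    polarize UNIV (\<lambda>S. vol (sum (K(i := A)) S)) + polarize UNIV (\<lambda>S. vol (sum (K(i := B)) S))"
proof -
  obtain P where P: "\<And>j k. potential_body (P j k)"
    and lim: "\<And>Q C c. \<forall>j. potential_body (Q j) \<Longrightarrow> outer_approx c C Q \<Longrightarrow> convex_body C \<Longrightarrow>
      (\<lambda>j. polarize UNIV (\<lambda>S. vol (sum ((P j)(i := Q j)) S))) \<longlonglongrightarrow>
      polarize UNIV (\<lambda>S. vol (sum (K(i := C)) S))"
    using polarize_approx_update[of K i, OF K] by blast
  obtain PA where PA: "\<forall>j. potential_body (PA j)" "outer_approx 1 A PA" using potential_outer_approx[OF A] by metis
  obtain PB where PB: "\<forall>j. potential_body (PB j)" "outer_approx 1 B PB" using potential_outer_approx[OF B] by metis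
  have PAB: "\<forall>j. potential_body (PA j + PB j)" using PA(1) PB(1) by (simp add: potential_body_plus)
  have eq: "polarize UNIV (\<lambda>S. vol (sum ((P j)(i := PA j + PB j)) S)) =
      polarize UNIV (\<lambda>S. vol (sum ((P j)(i := PA j)) S)) +
      polarize UNIV (\<lambda>S. vol (sum ((P j)(i := PB j)) S))" for j
    using P PA(1) PB(1) by (intro potential_polarize_add) auto
  show ?thesis
    by (rule LIMSEQ_unique[OF lim[OF PAB outer_approx_plus[OF PA(2) PB(2)] convex_body_plus[OF A B]],
          unfolded eq, OF tendsto_add[OF lim[OF PA A] lim[OF PB B]]])
qed

lemma polarize_volume_scale:
  fixes K :: "'n::{finite,wellorder} \<Rightarrow> (real^'n::_) set"
  assumes K: "\<And>i. convex_body (K i)" and A: "convex_body A" and s: "s > 0"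
  shows "polarize UNIV (\<lambda>S. vol (sum (K(i := (*\<^sub>R) s ` A)) S)) =
    s * polarize UNIV (\<lambda>S. vol (sum (K(i := A)) S))"
proof -
  obtain P where P: "\<And>j k. potential_body (P j k)"
    and lim: "\<And>Q C c. \<forall>j. potential_body (Q j) \<Longrightarrow> outer_approx c C Q \<Longrightarrow> convex_body C \<Longrightarrow>
      (\<lambda>j. polarize UNIV (\<lambda>S. vol (sum ((P j)(i := Q j)) S))) \<longlonglongrightarrow>
      polarize UNIV (\<lambda>S. vol (sum (K(i := C)) S))"
    using polarize_approx_update[of K i, OF K] by blast
  obtain PA where PA: "\<forall>j. potential_body (PA j)" "outer_approx 1 A PA" using potential_outer_approx[OF A] by metis
  have PsA: "\<forall>j. potential_body ((*\<^sub>R) s ` PA j)" using PA(1) s by (simp add: potential_body_scale)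
  have eq: "polarize UNIV (\<lambda>S. vol (sum ((P j)(i := (*\<^sub>R) s ` PA j)) S)) =
      s * polarize UNIV (\<lambda>S. vol (sum ((P j)(i := PA j)) S))" for j
    using P PA(1) s by (intro potential_polarize_scale) auto
  show ?thesis
    by (rule LIMSEQ_unique[OF lim[OF PsA outer_approx_scale[OF PA(2) less_imp_le[OF s]] convex_body_scale[OF A]],
          unfolded eq, OF tendsto_mult_left[OF lim[OF PA A]]])
qed

lemma polarize_volume_nonneg:
  fixes K :: "'n::{finite,wellorder} \<Rightarrow> (real^'n::_) set"
  assumes K: "\<And>i. convex_body (K i)"
  shows "polarize UNIV (\<lambda>S. vol (sum K S)) \<ge> 0"
proof -
  have "\<exists>P. (\<forall>j. potential_body (P j)) \<and> outer_approx 1 (K i) P" for i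
    using potential_outer_approx[OF K] .
  then obtain P where P: "\<And>i j. potential_body (P i j)" "\<And>i. outer_approx 1 (K i) (P i)"
    by metis
  have "(\<lambda>j. polarize UNIV (\<lambda>S. vol (\<Sum>i\<in>S. P i j))) \<longlonglongrightarrow>
      polarize UNIV (\<lambda>S. vol (sum K S))"
    using polarize_outer_approx[of K P "\<lambda>_. 1" UNIV] P K by (auto simp: potential_body_convex)
  moreover have "polarize UNIV (\<lambda>S. vol (\<Sum>i\<in>S. P i j)) \<ge> 0" for j
    using potential_polarize_nonneg P(1) .
  ultimately show ?thesis by (intro LIMSEQ_le_const) auto
qed

section \<open>Mixed volumes in arbitrary Euclidean spaces\<close>

text \<open>A well-ordered index type with as many elements as the dimension: it makes every
  Euclidean space isometric to a space of coordinate vectors for which the change of variables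
  above is stated.\<close>

typedef (overloaded) 'a basis_index = "{..<DIM('a::euclidean_space)}"
  by (rule exI[of _ 0]) simp

instance basis_index :: (euclidean_space) finite
proof
  have "(UNIV :: 'a basis_index set) = Abs_basis_index ` {..<DIM('a)}"
    by (metis (no_types) Rep_basis_index Rep_basis_index_inverse UNIV_eq_I image_eqI)
  then show "finite (UNIV :: 'a basis_index set)" by (metis finite_imageI finite_lessThan)
qed

instantiation basis_index :: (euclidean_space) linorder
begin
definition less_eq_basis_index :: "'a basis_index \<Rightarrow> 'a basis_index \<Rightarrow> bool" where
  "less_eq_basis_index i j \<longleftrightarrow> Rep_basis_index i \<le> Rep_basis_index j"
definition less_basis_index :: "'a basis_index \<Rightarrow> 'a basis_index \<Rightarrow> bool" where
  "less_basis_index i j \<longleftrightarrow> Rep_basis_index i < Rep_basis_index j"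
instance
proof (intro_classes, unfold less_eq_basis_index_def less_basis_index_def)
  fix x y :: "'a basis_index"
  assume "Rep_basis_index x \<le> Rep_basis_index y" "Rep_basis_index y \<le> Rep_basis_index x"
  then show "x = y" by (intro Rep_basis_index_inject[THEN iffD1] antisym)
qed linarith+

end

instance basis_index :: (euclidean_space) wellorder
proof
  fix P :: "'a basis_index \<Rightarrow> bool" and a
  assume step: "\<And>x. (\<And>y. y < x \<Longrightarrow> P y) \<Longrightarrow> P x"
  show "P a"
  proof (induction a rule: measure_induct_rule[of Rep_basis_index])
    case (less x)
    show ?case by (rule step, rule less) (simp only: less_basis_index_def)
  qed
qed

lemma CARD_basis_index: "CARD('a::euclidean_space basis_index) = DIM('a)"
proof -
  have "CARD('a basis_index) = card {..<DIM('a)}"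
    by (rule type_definition.card[OF type_definition_basis_index])
  then show ?thesis by simp
qed

text \<open>A bijection between orthonormal bases extends to a linear map that carries boxes to
  boxes with the same side lengths.\<close>

lemma lborel_isomorphism:
  assumes "DIM('b::euclidean_space) = DIM('a::euclidean_space)"
  shows "\<exists>T::'b \<Rightarrow> 'a. linear T \<and> bij T \<and> (\<forall>S\<in>sets borel. vol (T ` S) = vol S)"
proof -
  obtain h where h: "bij_betw h (Basis::'b set) (Basis::'a set)"
    using assms finite_same_card_bij[OF finite_Basis finite_Basis] by metis
  define T :: "'b \<Rightarrow> 'a" where "T x = (\<Sum>b\<in>Basis. (x \<bullet> b) *\<^sub>R h b)" for x
  define U :: "'a \<Rightarrow> 'b" where "U y = (\<Sum>b\<in>Basis. (y \<bullet> h b) *\<^sub>R b)" for y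
  have hB: "h b \<in> Basis" if "b \<in> Basis" for b using h that by (auto simp: bij_betw_def)
  have hh: "h b \<bullet> h c = (if b = c then 1 else 0)" if "b \<in> Basis" "c \<in> Basis" for b c
    using h that hB by (auto simp: inner_Basis bij_betw_def inj_on_def)
  have Th: "T x \<bullet> h b = x \<bullet> b" if "b \<in> Basis" for x b
    using that by (simp add: T_def inner_sum_left hh if_distrib cong: if_cong)
  have Ub: "U y \<bullet> b = y \<bullet> h b" if "b \<in> Basis" for y b
    using that by (simp add: U_def inner_sum_left inner_Basis if_distrib cong: if_cong)
  have UT: "U (T x) = x" for x by (rule euclidean_eqI) (simp add: Ub Th)
  have TU: "T (U y) = y" for y
  proof (rule euclidean_eqI)
    fix c :: 'a assume "c \<in> Basis"
    then obtain b where "b \<in> Basis" "c = h b" using h by (auto simp: bij_betw_def)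
    then show "T (U y) \<bullet> c = y \<bullet> c" by (simp add: Ub Th)
  qed
  have linT: "linear T" and linU: "linear U"
    unfolding T_def U_def by (auto intro!: linearI simp: inner_add_left scaleR_add_left sum.distrib scaleR_sum_right)
  have mT: "T \<in> borel_measurable borel" and mU: "U \<in> borel_measurable borel"
    using linT linU by (auto intro!: borel_measurable_continuous_onI linear_continuous_on simp: linear_conv_bounded_linear[symmetric])
  have "lborel = distr lborel borel T"
  proof (rule lborel_eqI)
    fix l u :: 'a assume lu: "\<And>b. b \<in> Basis \<Longrightarrow> l \<bullet> b \<le> u \<bullet> b"
    have "T -` box l u = box (U l) (U u)"
    proof (rule set_eqI)
      fix x
      have "T x \<in> box l u \<longleftrightarrow> (\<forall>b\<in>Basis. l \<bullet> h b < T x \<bullet> h b \<and> T x \<bullet> h b < u \<bullet> h b)"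
        using h unfolding mem_box bij_betw_def by (metis (no_types, lifting) image_iff)
      then show "x \<in> T -` box l u \<longleftrightarrow> x \<in> box (U l) (U u)"
        by (simp add: mem_box Th Ub)
    qed
    then have "emeasure (distr lborel borel T) (box l u) = emeasure lborel (box (U l) (U u))"
      using mT by (simp add: emeasure_distr)
    also have "\<dots> = (\<Prod>b\<in>Basis. (U u - U l) \<bullet> b)"
      using lu hB by (intro emeasure_lborel_box) (simp add: Ub)
    also have "(\<Prod>b\<in>Basis. (U u - U l) \<bullet> b) = (\<Prod>b\<in>Basis. (u - l) \<bullet> h b)"
      by (intro prod.cong) (simp_all add: Ub inner_diff_left)
    also have "\<dots> = (\<Prod>c\<in>Basis. (u - l) \<bullet> c)"
      by (rule prod.reindex_bij_betw[OF h])
    finally show "emeasure (distr lborel borel T) (box l u) = (\<Prod>c\<in>Basis. (u - l) \<bullet> c)" .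
  qed simp
  then have *: "vol X = vol (T -` X)" if "X \<in> sets borel" for X
    using measure_distr[of T lborel borel X] mT that by simp
  have "vol (T ` S) = vol S" if "S \<in> sets borel" for S
  proof -
    have eq: "T ` S = U -` S" using UT TU by (auto simp: image_iff) metis
    have "U -` S \<in> sets borel" using measurable_sets[OF mU that] by simp
    then have "vol (T ` S) = vol (T -` U -` S)" unfolding eq by (rule *)
    also have "T -` U -` S = S" using UT by auto
    finally show ?thesis .
  qed
  moreover have "bij T" using UT TU by (intro o_bij[of U]) auto
  ultimately show ?thesis using linT by blast
qed

lemma measure_lborel_scaleR:
  fixes K :: "'a::euclidean_space set"
  assumes K: "convex_body K" and "s \<ge> 0"
  shows "vol ((*\<^sub>R) s ` K) = s ^ DIM('a) * vol K"
proof (cases "s = 0")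
  case True
  then have "(*\<^sub>R) s ` K = {0}" using K by (auto simp: convex_body_def)
  then show ?thesis using True by simp
next
  case False
  have eq: "(\<lambda>x. 0 + s *\<^sub>R x) -` (*\<^sub>R) s ` K = K" using False by (auto simp: image_iff)
  have "(*\<^sub>R) s ` K \<in> sets borel" using K by (intro convex_body_measurable convex_body_scale)
  then have "emeasure lborel ((*\<^sub>R) s ` K) = ennreal (s ^ DIM('a)) * emeasure lborel K"
    using False \<open>s \<ge> 0\<close>
    by (subst lborel_affine[of s 0]) (simp_all add: emeasure_density emeasure_distr nn_integral_cmult_indicator eq[simplified])
  then show ?thesis using \<open>s \<ge> 0\<close> by (simp add: measure_def enn2real_mult)
qed

text \<open>For convex \<open>K\<close> the sum of a point of \<open>K\<close> and a point of \<open>c\<close> times \<open>K\<close> is \<open>1 + c\<close> times a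
  convex combination of points of \<open>K\<close>.\<close>

lemma sum_convex_const:
  fixes K :: "'a::real_vector set"
  assumes "finite S" "convex K" "K \<noteq> {}"
  shows "(\<Sum>i\<in>S. K) = (*\<^sub>R) (real (card S)) ` K"
  using assms(1)
proof (induction S rule: finite_induct)
  case empty
  then show ?case using assms by auto
next
  case (insert i S)
  define c where "c = real (card S)"
  have "K + (*\<^sub>R) c ` K = (*\<^sub>R) (1 + c) ` K"
  proof (intro equalityI subsetI)
    fix x assume "x \<in> K + (*\<^sub>R) c ` K"
    then obtain a b where ab: "a \<in> K" "b \<in> K" "x = a + c *\<^sub>R b" by (auto elim!: set_plus_elim)
    have pos: "0 < 1 + c" "0 \<le> c" by (simp_all add: c_def add_pos_nonneg)
    have "(1 / (1 + c)) *\<^sub>R a + (c / (1 + c)) *\<^sub>R b \<in> K"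
      using ab pos assms(2) by (intro convexD) (auto simp: add_divide_distrib[symmetric])
    moreover have "x = (1 + c) *\<^sub>R ((1 / (1 + c)) *\<^sub>R a + (c / (1 + c)) *\<^sub>R b)"
      using pos by (simp add: ab scaleR_add_right)
    ultimately show "x \<in> (*\<^sub>R) (1 + c) ` K" by blast
  next
    fix x assume "x \<in> (*\<^sub>R) (1 + c) ` K"
    then show "x \<in> K + (*\<^sub>R) c ` K" by (auto simp: scaleR_add_left)
  qed
  then show ?case using insert by (simp add: c_def add.commute)
qed

lemma det_mat: "det (mat c :: real^'n^'n) = c ^ CARD('n)"
  by (simp add: det_diagonal mat_def)

text \<open>The alternating sum of the powers is \<open>mixed_disc\<close> of identity matrices.\<close>

lemma polarize_power:
  fixes n_type :: "'n::finite itself"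
  shows "polarize (UNIV::'n set) (\<lambda>S. real (card S) ^ CARD('n)) = fact CARD('n)"
proof -
  have "det (\<Sum>i\<in>S. (mat 1 :: real^'n^'n)) = real (card S) ^ CARD('n)" for S :: "'n set"
  proof -
    have eq: "(\<Sum>i\<in>S. (mat 1 :: real^'n^'n)) = mat (real (card S))"
      by (simp add: vec_eq_iff mat_def del: sum_constant) simp
    show ?thesis unfolding eq by (rule det_mat)
  qed
  then show ?thesis
    using polarize_det[of "\<lambda>_::'n. mat 1 :: real^'n^'n"] by (simp add: mixed_disc_const det_I)
qed

lemma image_plus_linear:
  assumes "linear T"
  shows "T ` (A + B) = T ` A + T ` B"
proof (intro equalityI subsetI)
  fix y assume "y \<in> T ` (A + B)"
  then obtain a b where "a \<in> A" "b \<in> B" "y = T a + T b"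
    using linear_add[OF assms] by (auto elim!: set_plus_elim)
  then show "y \<in> T ` A + T ` B" by blast
next
  fix y assume "y \<in> T ` A + T ` B"
  then obtain a b where "a \<in> A" "b \<in> B" "y = T (a + b)"
    using linear_add[OF assms] by (auto elim!: set_plus_elim)
  then show "y \<in> T ` (A + B)" by blast
qed

lemma image_sum_linear:
  assumes "linear T"
  shows "T ` (\<Sum>i\<in>S. K i) = (\<Sum>i\<in>S. T ` K i)"
  by (induction S rule: infinite_finite_induct) (simp_all add: image_plus_linear linear_0 assms)

text \<open>The indices of the bodies are matched with the coordinates, and the bodies are moved to
  the coordinate space by an isometry.\<close>

lemma mixvol_coordinates:
  fixes I :: "'i set"
  assumes "finite I" "card I = DIM('a::euclidean_space)"
  shows "\<exists>(h :: 'a basis_index \<Rightarrow> 'i) (U :: 'a \<Rightarrow> real^'a basis_index). bij_betw h UNIV I \<and> linear U \<and>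
    (\<forall>K :: 'i \<Rightarrow> 'a set. (\<forall>i\<in>I. convex_body (K i)) \<longrightarrow>
      polarize I (\<lambda>S. vol (sum K S)) = polarize UNIV (\<lambda>S. vol (\<Sum>j\<in>S. U ` K (h j))))"
proof -
  obtain h :: "'a basis_index \<Rightarrow> 'i" where h: "bij_betw h UNIV I"
    using assms finite_same_card_bij[of "UNIV :: 'a basis_index set" I] by (auto simp: CARD_basis_index)
  obtain U :: "'a \<Rightarrow> real^'a basis_index" where U: "linear U" "bij U"
    "\<And>S. S \<in> sets borel \<Longrightarrow> vol (U ` S) = vol S"
    using lborel_isomorphism[where 'b='a and 'a="real^'a basis_index"] by (auto simp: CARD_basis_index)
  have "polarize I (\<lambda>S. vol (sum K S)) = polarize UNIV (\<lambda>S. vol (\<Sum>j\<in>S. U ` K (h j)))"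
    if K: "\<forall>i\<in>I. convex_body (K i)" for K
    unfolding polarize_reindex[OF h]
  proof (rule polarize_cong)
    fix S :: "'a basis_index set"
    have "sum K (h ` S) = (\<Sum>j\<in>S. K (h j))"
      using h by (subst sum.reindex) (auto simp: bij_betw_def inj_on_def)
    moreover have "convex_body (\<Sum>j\<in>S. K (h j))"
      using K h by (intro convex_body_sum) (auto simp: bij_betw_def)
    ultimately show "vol (sum K (h ` S)) = vol (\<Sum>j\<in>S. U ` K (h j))"
      by (simp add: image_sum_linear[OF U(1), symmetric] U(3) convex_body_measurable del: measure_lborel_box)
  qed
  then show ?thesis using h U(1) by blast
qed

lemma mixvol_coordinates_update:
  fixes K :: "'i \<Rightarrow> 'a::euclidean_space set"
  assumes I: "finite I" "card I = DIM('a)" and i: "i \<in> I" and K: "\<And>j. j \<in> I \<Longrightarrow> convex_body (K j)"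
  shows "\<exists>(j :: 'a basis_index) (U :: 'a \<Rightarrow> real^'a basis_index) L. linear U \<and> (\<forall>l. convex_body (L l)) \<and>
    (\<forall>C. convex_body C \<longrightarrow> mixvol vol I (K(i := C)) =
      polarize UNIV (\<lambda>S. vol (sum (L(j := U ` C)) S)) / fact (card I))"
proof -
  obtain h :: "'a basis_index \<Rightarrow> 'i" and U :: "'a \<Rightarrow> real^'a basis_index" where h: "bij_betw h UNIV I" and U: "linear U"
    and eq: "\<And>K. \<forall>i\<in>I. convex_body (K i) \<Longrightarrow>
      polarize I (\<lambda>S. vol (sum K S)) = polarize UNIV (\<lambda>S. vol (\<Sum>j\<in>S. U ` K (h j)))"
    using mixvol_coordinates[OF I] by blast
  obtain j where j: "h j = i" using h i by (auto simp: bij_betw_def)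
  have upd: "(\<lambda>l. U ` (K(i := C)) (h l)) = (\<lambda>l. U ` K (h l))(j := U ` C)" for C
    using h j by (auto simp: fun_eq_iff bij_betw_def inj_on_def)
  have "mixvol vol I (K(i := C)) =
      polarize UNIV (\<lambda>S. vol (sum ((\<lambda>l. U ` K (h l))(j := U ` C)) S)) / fact (card I)"
    if "convex_body C" for C
    unfolding mixvol_def upd[symmetric] using that K by (subst eq) auto
  moreover have "convex_body (U ` K (h l))" for l
    using h K U by (intro convex_body_linear_image) (auto simp: bij_betw_def)
  ultimately show ?thesis using U by (intro exI[of _ j] exI[of _ U] exI[of _ "\<lambda>l. U ` K (h l)"]) blast
qed

context
  fixes K :: "'i \<Rightarrow> 'a::euclidean_space set" and I :: "'i set"
  assumes I: "finite I" "card I = DIM('a)" and K: "\<And>j. j \<in> I \<Longrightarrow> convex_body (K j)"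
begin

lemma mixvol_add:
  assumes i: "i \<in> I" and A: "convex_body A" and B: "convex_body B"
  shows "mixvol vol I (K(i := A + B)) =
    mixvol vol I (K(i := A)) + mixvol vol I (K(i := B))"
proof -
  obtain j :: "'a basis_index" and L and U :: "'a \<Rightarrow> real^'a basis_index" where U: "linear U" and L: "\<And>l. convex_body (L l)"
    and eq: "\<And>C. convex_body C \<Longrightarrow> mixvol vol I (K(i := C)) =
      polarize UNIV (\<lambda>S. vol (sum (L(j := U ` C)) S)) / fact (card I)"
    using mixvol_coordinates_update[where K=K, OF I i K] by blast
  have sum: "U ` (A + B) = U ` A + U ` B"
    by (rule image_plus_linear[OF U])
  show ?thesis
    unfolding eq[OF A] eq[OF B] eq[OF convex_body_plus[OF A B]] add_divide_distrib[symmetric] sum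
    by (intro arg_cong2[where f="(/)"] polarize_volume_add refl L convex_body_linear_image U A B)
qed

lemma mixvol_zero:
  assumes "i \<in> I"
  shows "mixvol vol I (K(i := 0)) = 0"
  using mixvol_add[OF assms convex_body_zero convex_body_zero] by simp

lemma mixvol_scale:
  assumes i: "i \<in> I" and A: "convex_body A" and s: "s \<ge> 0"
  shows "mixvol vol I (K(i := (*\<^sub>R) s ` A)) = s * mixvol vol I (K(i := A))"
proof (cases "s = 0")
  case True
  then have "(*\<^sub>R) s ` A = 0" using A by (auto simp: convex_body_def)
  then show ?thesis using True mixvol_zero[OF i] by simp
next
  case False
  obtain j :: "'a basis_index" and L and U :: "'a \<Rightarrow> real^'a basis_index" where U: "linear U" and L: "\<And>l. convex_body (L l)"
    and eq: "\<And>C. convex_body C \<Longrightarrow> mixvol vol I (K(i := C)) =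
      polarize UNIV (\<lambda>S. vol (sum (L(j := U ` C)) S)) / fact (card I)"
    using mixvol_coordinates_update[where K=K, OF I i K] by blast
  have scale: "U ` (*\<^sub>R) s ` A = (*\<^sub>R) s ` U ` A"
    using U by (simp add: image_image linear_cmul)
  have "polarize UNIV (\<lambda>S. vol (sum (L(j := (*\<^sub>R) s ` U ` A)) S)) =
      s * polarize UNIV (\<lambda>S. vol (sum (L(j := U ` A)) S))"
    using False s by (intro polarize_volume_scale L convex_body_linear_image U A) auto
  then show ?thesis
    unfolding eq[OF A] eq[OF convex_body_scale[OF A]] scale times_divide_eq_right by (rule arg_cong)
qed

lemma mixvol_nonneg: "mixvol vol I K \<ge> 0"
proof -
  obtain h :: "'a basis_index \<Rightarrow> 'i" and U :: "'a \<Rightarrow> real^'a basis_index" where h: "bij_betw h UNIV I" and U: "linear U"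
    and eq: "\<And>K. \<forall>i\<in>I. convex_body (K i) \<Longrightarrow>
      polarize I (\<lambda>S. vol (sum K S)) = polarize UNIV (\<lambda>S. vol (\<Sum>j\<in>S. U ` K (h j)))"
    using mixvol_coordinates[OF I] by blast
  have "convex_body (U ` K (h l))" for l
    using h K U by (intro convex_body_linear_image) (auto simp: bij_betw_def)
  then show ?thesis
    unfolding mixvol_def using K by (subst eq) (auto intro!: divide_nonneg_nonneg polarize_volume_nonneg)
qed

end

text \<open>A sum of \<open>s\<close> copies of \<open>A\<close> is the dilate of \<open>A\<close> by \<open>s\<close>, so only the polarization of the
  power function enters.\<close>

lemma mixvol_const:
  fixes A :: "'a::euclidean_space set" and I :: "'i set"
  assumes I: "finite I" "card I = DIM('a)" and A: "convex_body A"
  shows "mixvol vol I (\<lambda>_. A) = vol A"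
proof -
  have "vol (\<Sum>i\<in>S. A) = vol A * real (card S) ^ DIM('a)" if "S \<subseteq> I" for S
    using that I(1) A finite_subset[of S I]
    by (subst sum_convex_const) (auto simp: measure_lborel_scaleR convex_body_def)
  then have "polarize I (\<lambda>S. vol (\<Sum>i\<in>S. A)) = vol A * polarize I (\<lambda>S. real (card S) ^ DIM('a))"
    unfolding polarize_mult[symmetric] by (rule polarize_cong)
  also have "polarize I (\<lambda>S. real (card S) ^ DIM('a)) = fact (card I)"
  proof -
    obtain h :: "'a basis_index \<Rightarrow> 'i" where h: "bij_betw h UNIV I"
      using I finite_same_card_bij[of "UNIV :: 'a basis_index set" I] by (auto simp: CARD_basis_index)
    have "card (h ` S) = card S" for S
      using h by (intro card_image) (auto simp: bij_betw_def inj_on_def)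
    then show ?thesis
      unfolding polarize_reindex[OF h] using polarize_power[where 'n="'a basis_index"] I
      by (simp add: CARD_basis_index)
  qed
  finally show ?thesis by (simp add: mixvol_def)
qed

section \<open>Existence and uniqueness of the mixed volume\<close>

lemma minkowski_comb_eq: "minkowski_comb s K t L = (*\<^sub>R) s ` K + (*\<^sub>R) t ` L"
  by (auto simp: minkowski_comb_def set_plus_def)

lemma mixed_volume_exists:
  fixes M :: "'a::euclidean_space measure"
  assumes M: "\<And>K. measure M K = c * vol K"
  shows "\<exists>V. is_mixed_volume M V"
proof (intro exI)
  let ?I = "{..<DIM('a)}"
  define V where "V Ks = c * mixvol vol ?I (\<lambda>i. Ks ! i)" for Ks :: "'a set list"
  show "is_mixed_volume M V"
    unfolding is_mixed_volume_def
  proof (intro conjI allI impI; (elim conjE)?)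
    fix Ks Ls :: "'a set list" assume "body_tuple Ks" "mset Ls = mset Ks"
    then obtain p where p: "p permutes {..<length Ks}" "permute_list p Ks = Ls" and l: "length Ks = DIM('a)"
      using mset_eq_permutation by (metis body_tuple_def)
    have "mixvol vol ?I (\<lambda>i. Ks ! i) = mixvol vol ?I (\<lambda>i. Ks ! p i)"
      using permutes_imp_bij[OF p(1)] l by (intro mixvol_reindex) simp
    also have "\<dots> = mixvol vol ?I (\<lambda>i. Ls ! i)"
      using p l by (intro mixvol_cong) (auto simp: permute_list_nth)
    finally show "V Ls = V Ks" by (simp add: V_def)
  next
    fix Ks Ls :: "'a set list" and K L :: "'a set" and s t :: real
    assume tup: "body_tuple (Ks @ K # Ls)" and L: "convex_body L" and st: "0 \<le> s" "0 \<le> t"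
    define F where "F i = (Ks @ K # Ls) ! i" for i
    have K: "convex_body K" using tup by (auto simp: body_tuple_def)
    have F: "convex_body (F i)" if "i \<in> ?I" for i
    proof -
      have "F i \<in> set (Ks @ K # Ls)"
        unfolding F_def using tup that by (intro nth_mem) (simp add: body_tuple_def)
      then show ?thesis using tup unfolding body_tuple_def by blast
    qed
    have i: "length Ks \<in> ?I" using tup by (auto simp: body_tuple_def)
    have V: "V (Ks @ C # Ls) = c * mixvol vol ?I (F(length Ks := C))" for C
      unfolding V_def F_def by (intro arg_cong[where f="\<lambda>x. c * x"] mixvol_cong) (auto simp: nth_append nth_Cons')
    have add: "mixvol vol ?I (F(length Ks := (*\<^sub>R) s ` K + (*\<^sub>R) t ` L)) =
        mixvol vol ?I (F(length Ks := (*\<^sub>R) s ` K)) +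
        mixvol vol ?I (F(length Ks := (*\<^sub>R) t ` L))"
      using F i K L by (intro mixvol_add convex_body_scale) auto
    have scale: "mixvol vol ?I (F(length Ks := (*\<^sub>R) r ` A)) =
        r * mixvol vol ?I (F(length Ks := A))" if "convex_body A" "0 \<le> r" for r A
      using F i that by (intro mixvol_scale) auto
    show "V (Ks @ minkowski_comb s K t L # Ls) = s * V (Ks @ K # Ls) + t * V (Ks @ L # Ls)"
      unfolding V minkowski_comb_eq add scale[OF K st(1)] scale[OF L st(2)] by (simp add: algebra_simps)
  next
    fix K :: "'a set" assume K: "convex_body K"
    have "mixvol vol ?I (\<lambda>i. replicate DIM('a) K ! i) = mixvol vol ?I (\<lambda>_. K)"
      by (intro mixvol_cong) auto
    then show "V (replicate DIM('a) K) = measure M K"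
      using K by (simp add: V_def M mixvol_const)
  qed
qed

lemma length_eq_distinct_iff_cover:
  assumes "length l = n"
  shows "set l = {..<n} \<longleftrightarrow> distinct l \<and> set l \<subseteq> {..<n}"
proof
  assume l: "set l = {..<n}"
  have "distinct l" by (rule card_distinct) (simp add: l assms)
  then show "distinct l \<and> set l \<subseteq> {..<n}" using l by simp
next
  assume "distinct l \<and> set l \<subseteq> {..<n}"
  then show "set l = {..<n}" using assms by (intro card_subset_eq) (auto simp: distinct_card)
qed

lemma card_lists_cover: "card {l. length l = n \<and> set l = {..<n}} = fact n"
proof -
  have "{l. length l = n \<and> set l = {..<n}} = {l. length l = n \<and> distinct l \<and> set l \<subseteq> {..<n}}"
    using length_eq_distinct_iff_cover by blast
  then show ?thesis
    using card_lists_distinct_length_eq[of "{..<n}" n] by (simp add: fact_prod)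
qed

text \<open>Multilinearity expands the volume of a Minkowski sum over a set \<open>S\<close> of indices into the
  values of \<open>V\<close> on all words over \<open>S\<close> whose length is the dimension.  The alternating sum over \<open>S\<close>
  retains the words in which every index occurs; these are the rearrangements of the original
  tuple, and \<open>V\<close> is symmetric.\<close>

lemma mixed_volume_eq:
  fixes M :: "'a::euclidean_space measure"
  assumes V: "is_mixed_volume M V" and Ks: "body_tuple Ks"
  shows "V Ks = mixvol (measure M) {..<DIM('a)} (\<lambda>i. Ks ! i)"
proof -
  let ?N = "DIM('a)" and ?K = "\<lambda>i. Ks ! i"
  have len: "length Ks = ?N" and body: "\<And>i. i < ?N \<Longrightarrow> convex_body (?K i)"
    using Ks by (auto simp: body_tuple_def)
  have comb: "V (Xs @ minkowski_comb s K t L # Ys) = s * V (Xs @ K # Ys) + t * V (Xs @ L # Ys)"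
    if "body_tuple (Xs @ K # Ys)" "convex_body L" "0 \<le> s" "0 \<le> t" for Xs Ys K L s t
    using V that unfolding is_mixed_volume_def by blast
  have slot: "V (Xs @ (\<Sum>i\<in>S. ?K i) # Ys) = (\<Sum>i\<in>S. V (Xs @ ?K i # Ys))"
    if S: "S \<subseteq> {..<?N}" and XY: "length Xs + length Ys + 1 = ?N" "\<forall>X\<in>set (Xs @ Ys). convex_body X" for Xs Ys S
  proof -
    have "finite S" using S finite_subset by blast
    then show ?thesis using S
    proof (induction S rule: finite_induct)
      case empty
      have "body_tuple (Xs @ 0 # Ys)" using XY by (auto simp: body_tuple_def convex_body_zero simp del: set_zero)
      from comb[OF this convex_body_zero, of 0 0] show ?case by (simp add: minkowski_comb_def)
    next
      case (insert i S)
      have S: "convex_body (\<Sum>i\<in>S. ?K i)" using insert.prems body by (intro convex_body_sum) auto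
      have "body_tuple (Xs @ ?K i # Ys)" using XY body insert.prems by (auto simp: body_tuple_def)
      from comb[OF this S, of 1 1] insert show ?case by (simp add: minkowski_comb_eq)
    qed
  qed
  have expand: "V (Xs @ replicate j (\<Sum>i\<in>S. ?K i)) = (\<Sum>l\<in>{l. length l = j \<and> set l \<subseteq> S}. V (Xs @ map ?K l))"
    if S: "S \<subseteq> {..<?N}" and "length Xs + j = ?N" "\<forall>X\<in>set Xs. convex_body X" for Xs S j
    using that(2,3)
  proof (induction j arbitrary: Xs)
    case 0
    have "{l. l = [] \<and> set l \<subseteq> S} = {[]}" by auto
    then show ?case by simp
  next
    case (Suc j)
    have fin: "finite S" using S finite_subset by blast
    have KS: "convex_body (\<Sum>i\<in>S. ?K i)" using S body by (intro convex_body_sum) auto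
    have "V (Xs @ replicate (Suc j) (\<Sum>i\<in>S. ?K i)) = (\<Sum>i\<in>S. V ((Xs @ [?K i]) @ replicate j (\<Sum>i\<in>S. ?K i)))"
      using slot[OF S, of Xs "replicate j (\<Sum>i\<in>S. ?K i)"] Suc.prems KS by (auto simp: set_replicate_conv_if split: if_splits)
    also have "\<dots> = (\<Sum>i\<in>S. \<Sum>l\<in>{l. length l = j \<and> set l \<subseteq> S}. V ((Xs @ [?K i]) @ map ?K l))"
      using Suc.prems S body by (intro sum.cong refl Suc.IH) auto
    also have "\<dots> = (\<Sum>(i,l)\<in>S \<times> {l. length l = j \<and> set l \<subseteq> S}. V (Xs @ map ?K (i # l)))"
      using fin by (subst sum.cartesian_product) (simp add: case_prod_unfold)
    also have "\<dots> = (\<Sum>l\<in>{l. length l = Suc j \<and> set l \<subseteq> S}. V (Xs @ map ?K l))"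
      by (rule sum.reindex_bij_witness[where i="\<lambda>l. (hd l, tl l)" and j="\<lambda>(i,l). i # l"])
        (auto simp: length_Suc_conv)
    finally show ?case .
  qed
  let ?L = "{l. length l = ?N \<and> set l \<subseteq> {..<?N}}"
  have "measure M (\<Sum>i\<in>S. ?K i) = (\<Sum>l\<in>{l\<in>?L. set l \<subseteq> S}. V (map ?K l))" if S: "S \<subseteq> {..<?N}" for S
  proof -
    have "convex_body (\<Sum>i\<in>S. ?K i)" using S body by (intro convex_body_sum) auto
    then have "measure M (\<Sum>i\<in>S. ?K i) = V (replicate ?N (\<Sum>i\<in>S. ?K i))"
      using V unfolding is_mixed_volume_def by simp
    also have "\<dots> = (\<Sum>l\<in>{l. length l = ?N \<and> set l \<subseteq> S}. V (map ?K l))"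
      using expand[OF S, of "[]" ?N] by simp
    also have "{l. length l = ?N \<and> set l \<subseteq> S} = {l\<in>?L. set l \<subseteq> S}" using S by auto
    finally show ?thesis .
  qed
  then have 1: "polarize {..<?N} (\<lambda>S. measure M (\<Sum>i\<in>S. ?K i)) =
      polarize {..<?N} (\<lambda>S. \<Sum>l\<in>{l\<in>?L. set l \<subseteq> S}. V (map ?K l))"
    by (rule polarize_cong)
  have 2: "polarize {..<?N} (\<lambda>S. \<Sum>l\<in>{l\<in>?L. set l \<subseteq> S}. V (map ?K l)) =
      (\<Sum>l\<in>{l\<in>?L. set l = {..<?N}}. V (map ?K l))"
    using finite_lists_length_eq[of "{..<?N}" ?N]
    by (intro polarize_sum_supports) (auto simp: conj_commute)
  have 3: "(\<Sum>l\<in>{l\<in>?L. set l = {..<?N}}. V (map ?K l)) = (\<Sum>l\<in>{l\<in>?L. set l = {..<?N}}. V Ks)"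
  proof (rule sum.cong[OF refl])
    fix l assume l: "l \<in> {l\<in>?L. set l = {..<?N}}"
    then have "distinct l" by (intro card_distinct) auto
    then have "mset l = mset [0..<?N]"
      using l by (intro set_eq_iff_mset_eq_distinct[THEN iffD1]) (auto simp: atLeast0LessThan)
    then have "mset (map ?K l) = mset (map ?K [0..<?N])" by simp
    moreover have "map ?K [0..<?N] = Ks" using len by (metis map_nth)
    ultimately show "V (map ?K l) = V Ks"
      using V Ks unfolding is_mixed_volume_def by metis
  qed
  have "{l\<in>?L. set l = {..<?N}} = {l. length l = ?N \<and> set l = {..<?N}}" by blast
  then have 4: "card {l\<in>?L. set l = {..<?N}} = fact ?N"
    by (simp only: card_lists_cover)
  show ?thesis
    unfolding mixvol_def 1 2 3 sum_constant 4 by simp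
qed

section \<open>Mixed areas in the plane\<close>

definition mixed_area :: "(real \<times> real) set \<Rightarrow> (real \<times> real) set \<Rightarrow> real" where
  "mixed_area P Q = (vol (P + Q) - vol P - vol Q) / 2"

lemma mixed_area_eq_mixvol: "mixed_area P Q = mixvol vol UNIV (\<lambda>b. if b then P else Q)"
proof -
  have "Pow (UNIV :: bool set) = {{}, {True}, {False}, {True, False}}"
    by (auto simp: Pow_def UNIV_bool)
  moreover have "{True, False} \<noteq> {True}" "{True, False} \<noteq> {False}" by auto
  ultimately show ?thesis
    by (simp add: mixed_area_def mixvol_def polarize_def UNIV_bool insert_Diff_if)
qed

lemma mixed_area_commute: "mixed_area P Q = mixed_area Q P"
  by (simp add: mixed_area_def add.commute)

lemma mixed_area_plus:
  assumes "convex_body P" "convex_body P'" "convex_body Q"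
  shows "mixed_area (P + P') Q = mixed_area P Q + mixed_area P' Q"
  using mixvol_add[of "UNIV :: bool set" "\<lambda>_. Q" True P P'] assms
  by (simp add: mixed_area_eq_mixvol fun_upd_def)

lemma mixed_area_scale:
  assumes "convex_body P" "convex_body Q" "0 \<le> s"
  shows "mixed_area ((*\<^sub>R) s ` P) Q = s * mixed_area P Q"
  using mixvol_scale[of "UNIV :: bool set" "\<lambda>_. Q" True P s] assms
  by (simp add: mixed_area_eq_mixvol fun_upd_def)

lemma mixed_area_same: "convex_body P \<Longrightarrow> mixed_area P P = vol P"
  using mixvol_const[of "UNIV :: bool set" P] by (simp add: mixed_area_eq_mixvol)

lemma mixed_area_sum:
  assumes "finite I" "\<And>i. i \<in> I \<Longrightarrow> convex_body (P i)" "convex_body Q" "\<And>i. i \<in> I \<Longrightarrow> 0 \<le> c i"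
  shows "mixed_area (\<Sum>i\<in>I. (*\<^sub>R) (c i) ` P i) Q = (\<Sum>i\<in>I. c i * mixed_area (P i) Q)"
  using assms
proof (induction I rule: finite_induct)
  case empty
  then show ?case by (simp add: mixed_area_def)
next
  case (insert i I)
  then show ?case
    by (simp add: mixed_area_plus mixed_area_scale convex_body_scale convex_body_sum)
qed

section \<open>Minkowski's inequality in the plane\<close>

lemma sets_pair_lborel:
  fixes P :: "('a::euclidean_space \<times> 'b::euclidean_space) set"
  shows "P \<in> sets borel \<Longrightarrow> P \<in> sets (lborel \<Otimes>\<^sub>M lborel)"
  unfolding lborel_prod by simp

definition slice_length :: "(real \<times> real) set \<Rightarrow> real \<Rightarrow> real" where
  "slice_length P x = vol (Pair x -` P)"

lemma convex_body_slice:
  fixes P :: "('a::euclidean_space \<times> 'b::euclidean_space) set"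
  assumes "convex_body P" "Pair x -` P \<noteq> {}"
  shows "convex_body (Pair x -` P)"
proof -
  have "compact (Pair x -` P)"
  proof -
    have eq: "Pair x -` P = snd ` (P \<inter> {x} \<times> UNIV)" by force
    have "compact (P \<inter> {x} \<times> UNIV)"
      using assms by (intro compact_Int_closed closed_Times) (auto simp: convex_body_def)
    then show ?thesis
      unfolding eq by (intro compact_continuous_image continuous_on_snd continuous_on_id)
  qed
  moreover have "convex (Pair x -` P)"
  proof (rule convexI)
    fix y z u v assume y: "y \<in> Pair x -` P" "z \<in> Pair x -` P" and u: "0 \<le> u" "0 \<le> v" "u + v = (1::real)"
    then have "u *\<^sub>R (x, y) + v *\<^sub>R (x, z) \<in> P"
      using assms by (intro convexD) (auto simp: convex_body_def)
    moreover have "u *\<^sub>R x + v *\<^sub>R x = x" using u by (simp add: scaleR_add_left[symmetric])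
    ultimately show "u *\<^sub>R y + v *\<^sub>R z \<in> Pair x -` P" by simp
  qed
  ultimately show ?thesis using assms by (simp add: convex_body_def)
qed

text \<open>The Brunn-Minkowski inequality on the line.  The set \<open>X\<close> stands for \<open>I + J\<close> or any
  larger set whose measurability is known.\<close>

lemma interval_sum_length:
  fixes I J X :: "real set"
  assumes I: "convex I" "bounded I" "I \<noteq> {}" "I \<in> sets borel"
    and J: "convex J" "bounded J" "J \<noteq> {}" "J \<in> sets borel"
    and X: "X \<in> sets borel" "bounded X" "I + J \<subseteq> X"
  shows "vol I + vol J \<le> vol X"
proof -
  have len: "vol A \<le> Sup A - Inf A" and "Inf A \<le> Sup A" if A: "bounded A" "A \<noteq> {}" "A \<in> sets borel" for A :: "real set"
  proof -
    have bdd: "bdd_above A" "bdd_below A" using A bounded_imp_bdd_above bounded_imp_bdd_below by auto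
    have sub: "A \<subseteq> {Inf A..Sup A}" using bdd by (auto intro: cInf_lower cSup_upper)
    then show "Inf A \<le> Sup A" using A by auto
    have "vol A \<le> vol {Inf A..Sup A}"
      using sub A by (intro measure_mono_fmeasurable) (simp_all add: fmeasurable_def emeasure_lborel_Icc_eq)
    then show "vol A \<le> Sup A - Inf A" using \<open>Inf A \<le> Sup A\<close> by simp
  qed
  have "convex (I + J)" using I J by (simp add: convex_set_plus)
  have "{Inf I + Inf J <..< Sup I + Sup J} \<subseteq> I + J"
  proof
    fix z assume "z \<in> {Inf I + Inf J <..< Sup I + Sup J}"
    then have z: "Inf I + Inf J < z" "z < Sup I + Sup J" by auto
    have "Inf I < z - Inf J" "z - Sup J < Sup I" using z by auto
    obtain i where i: "i \<in> I" "i < z - Inf J"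
      using cInf_lessD[OF I(3) \<open>Inf I < z - Inf J\<close>] by blast
    obtain j where j: "j \<in> J" "j < z - i"
      using cInf_lessD[OF J(3), of "z - i"] i by auto
    obtain i' where i': "i' \<in> I" "z - Sup J < i'"
      using less_cSupD[OF I(3) \<open>z - Sup J < Sup I\<close>] by blast
    obtain j' where j': "j' \<in> J" "z - i' < j'"
      using less_cSupD[OF J(3), of "z - i'"] i' by auto
    have "i + j \<in> I + J" "i' + j' \<in> I + J"
      using set_plus_intro[OF i(1) j(1)] set_plus_intro[OF i'(1) j'(1)] by simp_all
    moreover have "z \<in> {i + j .. i' + j'}" using j j' by auto
    moreover have "is_interval (I + J)" using \<open>convex (I + J)\<close> by (simp add: is_interval_convex_1)
    ultimately show "z \<in> I + J"
      unfolding is_interval_1 by (meson atLeastAtMost_iff)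
  qed
  then have "vol {Inf I + Inf J <..< Sup I + Sup J} \<le> vol X"
    using X emeasure_bounded_finite[of X] by (intro measure_mono_fmeasurable) (auto simp: fmeasurable_def)
  moreover have "Inf I + Inf J \<le> Sup I + Sup J"
    using \<open>\<And>A. \<lbrakk>bounded A; A \<noteq> {}; A \<in> sets borel\<rbrakk> \<Longrightarrow> Inf A \<le> Sup A\<close> I J by (intro add_mono) auto
  ultimately show ?thesis using len[OF I(2,3,4)] len[OF J(2,3,4)] by simp
qed

lemma slice_plus_subset: "Pair x -` P + Pair x' -` Q \<subseteq> Pair (x + x') -` (P + Q)"
proof
  fix z assume "z \<in> Pair x -` P + Pair x' -` Q"
  then obtain y y' where "(x, y) \<in> P" "(x', y') \<in> Q" "z = y + y'" by (auto elim!: set_plus_elim)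
  then show "z \<in> Pair (x + x') -` (P + Q)"
    using set_plus_intro[of "(x, y)" P "(x', y')" Q] by simp
qed

lemma slice_length_plus:
  assumes P: "convex_body P" and Q: "convex_body Q"
    and "Pair x -` P \<noteq> {}" "Pair x' -` Q \<noteq> {}"
  shows "slice_length P x + slice_length Q x' \<le> slice_length (P + Q) (x + x')"
proof -
  have p: "convex_body (Pair x -` P)" and q: "convex_body (Pair x' -` Q)"
    using assms by (auto intro: convex_body_slice)
  obtain y y' where "y \<in> Pair x -` P" "y' \<in> Pair x' -` Q" using assms(3,4) by blast
  then have "y + y' \<in> Pair (x + x') -` (P + Q)"
    by (intro subsetD[OF slice_plus_subset] set_plus_intro)
  then have "Pair (x + x') -` (P + Q) \<noteq> {}" by blast
  then have s: "convex_body (Pair (x + x') -` (P + Q))"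
    by (rule convex_body_slice[OF convex_body_plus[OF P Q]])
  have body: "convex A" "bounded A" "A \<noteq> {}" "A \<in> sets borel" if "convex_body A" for A :: "real set"
    using that by (simp_all add: convex_body_def compact_imp_bounded borel_compact)
  show ?thesis
    unfolding slice_length_def
    by (rule interval_sum_length[OF body[OF p] body[OF q] body(4)[OF s] body(2)[OF s] slice_plus_subset])
qed

lemma slice_length_pos_nonempty: "0 < slice_length P x \<Longrightarrow> Pair x -` P \<noteq> {}"
  by (auto simp: slice_length_def)

lemma slice_length_scale:
  assumes "convex_body P" "0 < r"
  shows "slice_length ((*\<^sub>R) r ` P) (r * x) = r * slice_length P x"
proof -
  have "(r * x, y) \<in> (*\<^sub>R) r ` P \<longleftrightarrow> (x, y / r) \<in> P" for y
  proof
    assume "(r * x, y) \<in> (*\<^sub>R) r ` P"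
    then obtain p where "p \<in> P" "(r * x, y) = r *\<^sub>R p" by blast
    moreover from this have "p = (x, y / r)" using \<open>0 < r\<close> by (auto simp: prod_eq_iff)
    ultimately show "(x, y / r) \<in> P" by simp
  next
    assume "(x, y / r) \<in> P"
    moreover have "(r * x, y) = r *\<^sub>R (x, y / r)" using \<open>0 < r\<close> by simp
    ultimately show "(r * x, y) \<in> (*\<^sub>R) r ` P" by (rule rev_image_eqI)
  qed
  moreover have "y \<in> (*\<^sub>R) r ` Pair x -` P \<longleftrightarrow> (x, y / r) \<in> P" for y
  proof
    assume "y \<in> (*\<^sub>R) r ` Pair x -` P"
    then show "(x, y / r) \<in> P" using \<open>0 < r\<close> by auto
  next
    assume "(x, y / r) \<in> P"
    then have "y / r \<in> Pair x -` P" by simp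
    moreover have "y = r *\<^sub>R (y / r)" using \<open>0 < r\<close> by simp
    ultimately show "y \<in> (*\<^sub>R) r ` Pair x -` P" by (rule rev_image_eqI)
  qed
  ultimately have eq: "Pair (r * x) -` (*\<^sub>R) r ` P = (*\<^sub>R) r ` Pair x -` P"
    by (intro set_eqI) (simp only: vimage_eq)
  show ?thesis
  proof (cases "Pair x -` P = {}")
    case True
    then show ?thesis unfolding slice_length_def eq by simp
  next
    case False
    show ?thesis
      unfolding slice_length_def eq
      using measure_lborel_scaleR[OF convex_body_slice[OF assms(1) False], of r] assms(2) by simp
  qed
qed

lemma slice_length_measurable:
  assumes "convex_body P"
  shows "slice_length P \<in> borel_measurable borel"
proof -
  have "P \<in> sets (lborel \<Otimes>\<^sub>M lborel)" using assms by (intro sets_pair_lborel convex_body_measurable)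
  then show ?thesis
    unfolding slice_length_def using lborel.measurable_emeasure_Pair[of P lborel] by (simp add: measure_def)
qed

lemma ennreal_slice_length:
  assumes "convex_body P"
  shows "ennreal (slice_length P x) = emeasure lborel (Pair x -` P)"
proof (cases "Pair x -` P = {}")
  case False
  then have "compact (Pair x -` P)" using convex_body_slice[OF assms] by (simp add: convex_body_def)
  then show ?thesis
    using emeasure_compact_finite[of "Pair x -` P"]
    unfolding slice_length_def by (intro emeasure_eq_ennreal_measure[symmetric]) auto
qed (simp add: slice_length_def)

text \<open>Convexity of \<open>P\<close> together with the one-dimensional Brunn-Minkowski inequality for its
  chords.\<close>

lemma level_set_convex:
  assumes P: "convex_body P" and "0 < l"
  shows "convex {x. l \<le> slice_length P x}"
proof (rule convexI)
  fix x y u v :: real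
  assume x: "x \<in> {x. l \<le> slice_length P x}" and y: "y \<in> {x. l \<le> slice_length P x}"
    and u: "0 \<le> u" "0 \<le> v" "u + v = 1"
  consider "u = 0" | "v = 0" | "0 < u" "0 < v" using u by linarith
  then show "u *\<^sub>R x + v *\<^sub>R y \<in> {x. l \<le> slice_length P x}"
  proof cases
    case 3
    have "(*\<^sub>R) u ` P + (*\<^sub>R) v ` P \<subseteq> P"
    proof
      fix z assume "z \<in> (*\<^sub>R) u ` P + (*\<^sub>R) v ` P"
      then obtain a b where "a \<in> P" "b \<in> P" "z = u *\<^sub>R a + v *\<^sub>R b" by (auto elim!: set_plus_elim)
      then show "z \<in> P" using P u by (auto simp: convex_body_def intro: convexD)
    qed
    moreover have "P \<subseteq> (*\<^sub>R) u ` P + (*\<^sub>R) v ` P"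
    proof
      fix p assume "p \<in> P"
      then show "p \<in> (*\<^sub>R) u ` P + (*\<^sub>R) v ` P"
        using u set_plus_intro[OF imageI imageI, of p P p P "(*\<^sub>R) u" "(*\<^sub>R) v"]
        by (simp add: scaleR_add_left[symmetric])
    qed
    ultimately have eq: "(*\<^sub>R) u ` P + (*\<^sub>R) v ` P = P" by blast
    have sl: "slice_length ((*\<^sub>R) u ` P) (u * x) = u * slice_length P x"
        "slice_length ((*\<^sub>R) v ` P) (v * y) = v * slice_length P y"
      using slice_length_scale[OF P] 3 by auto
    have "l * u + l * v \<le> u * slice_length P x + v * slice_length P y"
      using x y u by (intro add_mono) (simp_all add: mult.commute[of l] mult_left_mono)
    then have "l \<le> u * slice_length P x + v * slice_length P y"
      using u by (simp add: distrib_left[symmetric])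
    also have "\<dots> \<le> slice_length ((*\<^sub>R) u ` P + (*\<^sub>R) v ` P) (u * x + v * y)"
      unfolding sl[symmetric] using P 3 x y \<open>0 < l\<close>
      by (intro slice_length_plus convex_body_scale slice_length_pos_nonempty)
        (auto simp: sl intro!: mult_pos_pos)
    finally show ?thesis by (simp add: eq)
  qed (use x y u in auto)
qed

lemma level_set_bounded:
  assumes "convex_body P" "0 < l"
  shows "bounded {x. l \<le> slice_length P x}"
proof (rule bounded_subset)
  show "bounded (fst ` P)"
    using assms by (intro bounded_fst[OF compact_imp_bounded]) (simp add: convex_body_def)
  show "{x. l \<le> slice_length P x} \<subseteq> fst ` P"
    using slice_length_pos_nonempty assms(2) by (force simp: image_iff)
qed

text \<open>Both sides measure the region below the graph of the chord length, sliced in the two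
  coordinate directions.\<close>

lemma layer_cake_area:
  assumes P: "convex_body P"
  shows "emeasure lborel P = (\<integral>\<^sup>+l. emeasure lborel {x. 0 < l \<and> l \<le> slice_length P x} \<partial>lborel)"
proof -
  have [measurable]: "slice_length P \<in> borel_measurable borel" by (rule slice_length_measurable[OF P])
  define A where "A = {p :: real \<times> real. 0 < snd p \<and> snd p \<le> slice_length P (fst p)}"
  have "{p \<in> space (borel \<Otimes>\<^sub>M borel). 0 < snd p \<and> snd p \<le> slice_length P (fst p)} \<in> sets (borel \<Otimes>\<^sub>M borel)"
    by measurable
  then have A: "A \<in> sets (lborel \<Otimes>\<^sub>M lborel)"
    unfolding A_def borel_prod by (intro sets_pair_lborel) simp
  have PP: "P \<in> sets (lborel \<Otimes>\<^sub>M lborel)" using P by (intro sets_pair_lborel convex_body_measurable)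
  have "emeasure lborel P = (\<integral>\<^sup>+x. emeasure lborel (Pair x -` P) \<partial>lborel)"
    using lborel.emeasure_pair_measure_alt[OF PP] by (simp add: lborel_prod)
  also have "\<dots> = (\<integral>\<^sup>+x. emeasure lborel (Pair x -` A) \<partial>lborel)"
  proof (rule nn_integral_cong)
    fix x :: real
    have "Pair x -` A = {0<..slice_length P x}" by (auto simp: A_def)
    then show "emeasure lborel (Pair x -` P) = emeasure lborel (Pair x -` A)"
      using ennreal_slice_length[OF P, of x] by (simp add: slice_length_def)
  qed
  also have "\<dots> = emeasure (lborel \<Otimes>\<^sub>M lborel) A"
    using lborel.emeasure_pair_measure_alt[OF A] by simp
  also have "\<dots> = (\<integral>\<^sup>+l. emeasure lborel ((\<lambda>x. (x, l)) -` A) \<partial>lborel)"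
    by (rule lborel_pair.emeasure_pair_measure_alt2[OF A])
  also have "\<dots> = (\<integral>\<^sup>+l. emeasure lborel {x. 0 < l \<and> l \<le> slice_length P x} \<partial>lborel)"
    by (simp add: A_def vimage_def)
  finally show ?thesis .
qed

text \<open>If the longest chords of \<open>P\<close> and \<open>Q\<close> have the same length \<open>M\<close>, then for every \<open>l\<close> with \<open>0 < l < M\<close>
  both superlevel sets at height \<open>l\<close> are nonempty intervals, and their sum lies in the superlevel
  set of \<open>P + Q\<close> at height \<open>2 * l\<close>.  Integrating over \<open>l\<close> and substituting \<open>2 * l\<close> gives the
  factor two.\<close>

lemma bonnesen_equal_heights:
  assumes P: "convex_body P" and Q: "convex_body Q"
    and heightP: "\<And>x. slice_length P x \<le> M" "\<And>l. l < M \<Longrightarrow> \<exists>x. l \<le> slice_length P x"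
    and heightQ: "\<And>x. slice_length Q x \<le> M" "\<And>l. l < M \<Longrightarrow> \<exists>x. l \<le> slice_length Q x"
  shows "2 * (vol P + vol Q) \<le> vol (P + Q)"
proof -
  have PQ: "convex_body (P + Q)" using P Q by (rule convex_body_plus)
  note [measurable] = slice_length_measurable[OF P] slice_length_measurable[OF Q] slice_length_measurable[OF PQ]
  define E where "E R l = emeasure lborel {x. 0 < l \<and> l \<le> slice_length R x}" for R and l :: real
  have Em: "E R \<in> borel_measurable borel" if [measurable]: "slice_length R \<in> borel_measurable borel" for R
  proof -
    have "{p \<in> space (borel \<Otimes>\<^sub>M borel). 0 < fst p \<and> fst p \<le> slice_length R (snd p)} \<in> sets (borel \<Otimes>\<^sub>M borel)"
      by measurable
    then have "{p :: real \<times> real. 0 < fst p \<and> fst p \<le> slice_length R (snd p)} \<in> sets (lborel \<Otimes>\<^sub>M lborel)"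
      unfolding borel_prod by (intro sets_pair_lborel) simp
    from lborel.measurable_emeasure_Pair[OF this] show ?thesis by (simp add: E_def[abs_def] vimage_def)
  qed
  note [measurable] = Em[OF slice_length_measurable[OF P]] Em[OF slice_length_measurable[OF Q]] Em[OF slice_length_measurable[OF PQ]]
  have key: "E P l + E Q l \<le> E (P + Q) (2 * l)" if "l \<noteq> M" for l
  proof (cases "0 < l \<and> l < M")
    case False
    have "E R l = 0" if "\<And>x. slice_length R x \<le> M" for R
    proof -
      have "\<not> (0 < l \<and> l \<le> slice_length R x)" for x
        using that[of x] False \<open>l \<noteq> M\<close> by linarith
      then have "{x. 0 < l \<and> l \<le> slice_length R x} = {}" by blast
      then show ?thesis by (simp only: E_def emeasure_empty)
    qed
    then have "E P l = 0" "E Q l = 0" using heightP(1) heightQ(1) by auto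
    then show ?thesis by simp
  next
    case True
    let ?I = "{x. l \<le> slice_length P x}" and ?J = "{x. l \<le> slice_length Q x}"
      and ?X = "{x. 2 * l \<le> slice_length (P + Q) x}"
    have "?I + ?J \<subseteq> ?X"
    proof
      fix z assume "z \<in> ?I + ?J"
      then obtain x y where xy: "z = x + y" "l \<le> slice_length P x" "l \<le> slice_length Q y"
        by (auto elim!: set_plus_elim)
      then have "slice_length P x + slice_length Q y \<le> slice_length (P + Q) z"
        using True unfolding xy(1) by (intro slice_length_plus P Q slice_length_pos_nonempty) auto
      then show "z \<in> ?X" using xy by simp
    qed
    then have "vol ?I + vol ?J \<le> vol ?X"
      using True heightP(2)[of l] heightQ(2)[of l]
      by (intro interval_sum_length level_set_convex level_set_bounded P Q PQ) auto
    moreover have "E R l' = ennreal (vol {x. l' \<le> slice_length R x})"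
      if "convex_body R" "0 < l'" for R l'
      using that emeasure_bounded_finite[OF level_set_bounded[OF that]]
      by (simp add: E_def emeasure_eq_ennreal_measure)
    ultimately show ?thesis
      using True P Q PQ by (simp add: ennreal_plus[symmetric] del: ennreal_plus)
  qed
  have layer: "emeasure lborel R = integral\<^sup>N lborel (E R)" if "convex_body R" for R
    using layer_cake_area[OF that] by (simp add: E_def[abs_def])
  have "2 * (emeasure lborel P + emeasure lborel Q) = 2 * (\<integral>\<^sup>+l. E P l + E Q l \<partial>lborel)"
    by (simp add: nn_integral_add layer[OF P] layer[OF Q])
  also have "\<dots> \<le> 2 * (\<integral>\<^sup>+l. E (P + Q) (2 * l) \<partial>lborel)"
    (* At the single height l = M one superlevel set may be empty while the other is not. *)
    using AE_lborel_singleton[of M] key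
    by (intro mult_left_mono nn_integral_mono_AE) (auto elim!: eventually_mono)
  also have "\<dots> = (\<integral>\<^sup>+l. E (P + Q) l \<partial>lborel)"
    using nn_integral_real_affine[of "E (P + Q)" 2 0] by simp
  also have "\<dots> = emeasure lborel (P + Q)"
    by (simp add: layer[OF PQ])
  finally have le: "2 * (emeasure lborel P + emeasure lborel Q) \<le> emeasure lborel (P + Q)" .
  have fin: "emeasure lborel R = ennreal (vol R)" if "convex_body R" for R :: "(real \<times> real) set"
    using that emeasure_compact_finite[of R] by (intro emeasure_eq_ennreal_measure) (auto simp: convex_body_def)
  have "ennreal (2 * (vol P + vol Q)) \<le> ennreal (vol (P + Q))"
    using le by (simp add: fin P Q PQ ennreal_mult ennreal_plus)
  then show ?thesis by (subst (asm) ennreal_le_iff) simp_all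
qed

text \<open>The height is the supremum of the chord lengths; it is positive because a body whose
  chords all have length \<open>0\<close> has area \<open>0\<close>.\<close>

lemma slice_height_exists:
  assumes P: "convex_body P" and pos: "0 < vol P"
  shows "\<exists>M>0. (\<forall>x. slice_length P x \<le> M) \<and> (\<forall>l<M. \<exists>x. l \<le> slice_length P x)"
proof -
  have "bounded P" using P by (simp add: convex_body_def compact_imp_bounded)
  then obtain B where B: "\<And>p. p \<in> P \<Longrightarrow> norm p \<le> B" unfolding bounded_iff by blast
  have bound: "slice_length P x \<le> 2 * \<bar>B\<bar>" for x
  proof -
    have "Pair x -` P \<subseteq> {-\<bar>B\<bar>..\<bar>B\<bar>}"
    proof
      fix y assume "y \<in> Pair x -` P"
      then have "norm (snd (x, y)) \<le> B" using B[of "(x, y)"] norm_snd_le[of y x] by simp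
      then show "y \<in> {-\<bar>B\<bar>..\<bar>B\<bar>}" by auto
    qed
    then have "vol (Pair x -` P) \<le> vol {-\<bar>B\<bar>..\<bar>B\<bar>}"
    proof (rule measure_mono_fmeasurable)
      show "Pair x -` P \<in> sets lborel"
        using convex_body_measurable[OF convex_body_slice[OF P, of x]] by (cases "Pair x -` P = {}") simp_all
    qed (auto simp: fmeasurable_def emeasure_lborel_Icc_eq)
    then show ?thesis by (simp add: slice_length_def)
  qed
  define M where "M = Sup (range (slice_length P))"
  have bdd: "bdd_above (range (slice_length P))" using bound by (auto simp: bdd_above_def)
  have "\<exists>x. 0 < slice_length P x"
  proof (rule ccontr)
    assume "\<not> ?thesis"
    then have "{x. 0 < l \<and> l \<le> slice_length P x} = {}" for l by (auto simp: not_less intro: order_trans)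
    then have "emeasure lborel P = 0"
      using layer_cake_area[OF P] by (simp only: emeasure_empty nn_integral_const mult_zero_left)
    then show False using pos by (simp add: measure_def)
  qed
  then have "0 < M" unfolding M_def using bdd by (subst less_cSup_iff) auto
  moreover have "slice_length P x \<le> M" for x unfolding M_def using bdd by (intro cSup_upper) auto
  moreover have "\<exists>x. l \<le> slice_length P x" if "l < M" for l
    using that less_cSup_iff[of "range (slice_length P)" l] bdd unfolding M_def by (auto intro: less_imp_le)
  ultimately show ?thesis by blast
qed

text \<open>Scale \<open>Q\<close> so that the longest chords become equal; the resulting bound
  \<open>area P + r\<^sup>2 * area Q \<le> 2 * r * mixed_area P Q\<close> implies the claim by the inequality between
  arithmetic and geometric means.\<close>

lemma minkowski_plane:
  assumes P: "convex_body P" and Q: "convex_body Q"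
  shows "vol P * vol Q \<le> (mixed_area P Q)\<^sup>2"
proof (cases "0 < vol P \<and> 0 < vol Q")
  case False
  then have "vol P = 0 \<or> vol Q = 0"
    by (auto simp: not_less measure_le_0_iff)
  then show ?thesis by auto
next
  case True
  obtain M where M: "M > 0" "\<And>x. slice_length P x \<le> M" "\<And>l. l < M \<Longrightarrow> \<exists>x. l \<le> slice_length P x"
    using slice_height_exists[OF P] True by metis
  obtain N where N: "N > 0" "\<And>x. slice_length Q x \<le> N" "\<And>l. l < N \<Longrightarrow> \<exists>x. l \<le> slice_length Q x"
    using slice_height_exists[OF Q] True by metis
  define r where "r = M / N"
  have r: "r > 0" "r * N = M" using M N by (auto simp: r_def)
  let ?Q = "(*\<^sub>R) r ` Q"
  have Q': "convex_body ?Q" using Q by (rule convex_body_scale)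
  have len: "slice_length ?Q x = r * slice_length Q (x / r)" for x
    using slice_length_scale[OF Q r(1), of "x / r"] r by simp
  have "slice_length ?Q x \<le> M" for x
    unfolding len r(2)[symmetric] using N(2) r by (intro mult_left_mono) auto
  moreover have "\<exists>x. l \<le> slice_length ?Q x" if "l < M" for l
  proof -
    have "l / r < N" using that r by (simp add: divide_simps mult.commute)
    then obtain x where "l / r \<le> slice_length Q x" using N(3) by blast
    then have "l \<le> slice_length ?Q (r * x)" using r by (simp add: len divide_simps mult.commute)
    then show ?thesis ..
  qed
  ultimately have "2 * (vol P + vol ?Q) \<le> vol (P + ?Q)"
    using M by (intro bonnesen_equal_heights P Q') auto
  moreover have "vol ?Q = r\<^sup>2 * vol Q"
    using measure_lborel_scaleR[OF Q, of r] r by (simp add: power2_eq_square)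
  moreover have "vol (P + ?Q) = vol P + vol ?Q + 2 * (r * mixed_area P Q)"
    using mixed_area_scale[OF Q P, of r] r
    by (simp add: mixed_area_commute[of P] ) (simp add: mixed_area_def add.commute field_simps)
  ultimately have ineq: "vol P + r\<^sup>2 * vol Q \<le> 2 * (r * mixed_area P Q)"
    by (simp add: algebra_simps)
  have "4 * r\<^sup>2 * (vol P * vol Q) \<le> (vol P + r\<^sup>2 * vol Q)\<^sup>2"
    using zero_le_power2[of "vol P - r\<^sup>2 * vol Q"]
    by (simp add: power2_eq_square algebra_simps)
  also have "\<dots> \<le> (2 * (r * mixed_area P Q))\<^sup>2"
    using ineq by (intro power_mono) auto
  also have "\<dots> = 4 * r\<^sup>2 * (mixed_area P Q)\<^sup>2" by (simp add: power_mult_distrib)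
  finally show ?thesis using r by simp
qed

text \<open>Minkowski's inequality for the formal combination \<open>\<Sum>\<^sub>i x\<^sub>i P\<^sub>i\<close>, whose coefficients may
  be negative.  Replacing \<open>D\<close> by \<open>D + \<epsilon> \<Sum>\<^sub>i P\<^sub>i\<close> and adding a large multiple of it makes all
  coefficients nonnegative without changing the discriminant; at the end \<open>\<epsilon>\<close> tends to \<open>0\<close>.\<close>

lemma mixed_area_hyperbolic:
  fixes x :: "'i \<Rightarrow> real"
  assumes I: "finite I" and P: "\<And>i. i \<in> I \<Longrightarrow> convex_body (P i)" and D: "convex_body D"
  shows "vol D * (\<Sum>i\<in>I. \<Sum>j\<in>I. x i * x j * mixed_area (P i) (P j))
    \<le> (\<Sum>i\<in>I. x i * mixed_area (P i) D)\<^sup>2"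
proof -
  define L where "L R = (\<Sum>i\<in>I. x i * mixed_area (P i) R)" for R
  define S where "S = (\<Sum>i\<in>I. P i)"
  have S: "convex_body S" unfolding S_def using P by (rule convex_body_sum)
  define a where "a = (\<Sum>i\<in>I. x i * L (P i))"
  have a: "a = (\<Sum>i\<in>I. \<Sum>j\<in>I. x i * x j * mixed_area (P i) (P j))"
    unfolding a_def L_def by (simp add: sum_distrib_left mult.assoc mixed_area_commute)
  have L_plus: "L (Q + R) = L Q + L R" if "convex_body Q" "convex_body R" for Q R
    unfolding L_def sum.distrib[symmetric]
    using that P by (intro sum.cong refl) (simp add: mixed_area_commute[of "P _"] mixed_area_plus distrib_left)
  have L_scale: "L ((*\<^sub>R) s ` Q) = s * L Q" if "convex_body Q" "0 \<le> s" for Q s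
    unfolding L_def sum_distrib_left
    using that P by (intro sum.cong refl) (simp add: mixed_area_commute[of "P _"] mixed_area_scale)
  have eps: "a * (mixed_area D D + 2 * \<epsilon> * mixed_area D S + \<epsilon>\<^sup>2 * mixed_area S S) \<le> (L D + \<epsilon> * L S)\<^sup>2"
    if \<epsilon>: "\<epsilon> > 0" for \<epsilon>
  proof -
    define De where "De = D + (*\<^sub>R) \<epsilon> ` S"
    have De: "convex_body De" unfolding De_def using D S by (intro convex_body_plus convex_body_scale)
    (* This t makes all coefficients x i + t * \<epsilon> nonnegative, so that Q is a convex body. *)
    define t where "t = (\<Sum>i\<in>I. \<bar>x i\<bar>) / \<epsilon>"
    have t: "t \<ge> 0" using \<epsilon> by (simp add: t_def sum_nonneg)
    have pos: "0 \<le> x i + t * \<epsilon>" if "i \<in> I" for i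
      using member_le_sum[of i I "\<lambda>i. \<bar>x i\<bar>"] that I \<epsilon> by (simp add: t_def)
    define Q where "Q = (\<Sum>i\<in>I. (*\<^sub>R) (x i + t * \<epsilon>) ` P i) + (*\<^sub>R) t ` D"
    have Q: "convex_body Q" unfolding Q_def using P D by (intro convex_body_plus convex_body_sum convex_body_scale)
    have VDe: "mixed_area De R = mixed_area D R + \<epsilon> * (\<Sum>i\<in>I. mixed_area (P i) R)" if R: "convex_body R" for R
    proof -
      have "mixed_area S R = (\<Sum>i\<in>I. mixed_area (P i) R)"
        using mixed_area_sum[where c="\<lambda>_. 1", OF I P R] by (simp add: S_def)
      then show ?thesis unfolding De_def using D S R \<epsilon> by (simp add: mixed_area_plus mixed_area_scale convex_body_scale)
    qed
    have VQ: "mixed_area Q R = L R + t * mixed_area De R" if R: "convex_body R" for R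
    proof -
      have "mixed_area Q R = (\<Sum>i\<in>I. (x i + t * \<epsilon>) * mixed_area (P i) R) + t * mixed_area D R"
        unfolding Q_def using P D R t pos I
        by (simp add: mixed_area_plus mixed_area_scale convex_body_scale convex_body_sum mixed_area_sum)
      then show ?thesis
        by (simp add: VDe[OF R] L_def distrib_right distrib_left sum.distrib sum_distrib_left mult.assoc)
    qed
    have "L Q = (\<Sum>i\<in>I. x i * mixed_area Q (P i))"
      by (simp add: L_def mixed_area_commute)
    also have "\<dots> = (\<Sum>i\<in>I. x i * (L (P i) + t * mixed_area De (P i)))"
      using VQ P by (intro sum.cong refl) simp
    also have "\<dots> = a + t * L De"
      by (simp add: a_def L_def[of De] distrib_left sum.distrib sum_distrib_left mixed_area_commute mult.left_commute)
    finally have LQ: "L Q = a + t * L De" .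
    have QDe: "mixed_area Q De = L De + t * mixed_area De De" by (rule VQ[OF De])
    have QQ: "mixed_area Q Q = a + 2 * t * L De + t\<^sup>2 * mixed_area De De"
      using VQ[OF Q] LQ QDe by (simp add: mixed_area_commute[of De Q] algebra_simps power2_eq_square)
    have "mixed_area Q Q * mixed_area De De \<le> (mixed_area Q De)\<^sup>2"
      using minkowski_plane[OF Q De] by (simp add: mixed_area_same Q De)
    then have "a * mixed_area De De \<le> (L De)\<^sup>2"
      unfolding QQ QDe by (simp add: power2_eq_square algebra_simps)
    moreover have "mixed_area De De = mixed_area D D + 2 * \<epsilon> * mixed_area D S + \<epsilon>\<^sup>2 * mixed_area S S"
    proof -
      have De_R: "mixed_area De R = mixed_area D R + \<epsilon> * mixed_area S R" if "convex_body R" for R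
        unfolding De_def using D S that \<epsilon> by (simp add: mixed_area_plus mixed_area_scale convex_body_scale)
      have "mixed_area D De = mixed_area D D + \<epsilon> * mixed_area D S"
        using De_R[OF D] by (simp only: mixed_area_commute[of D De] mixed_area_commute[of D S])
      moreover have "mixed_area S De = mixed_area D S + \<epsilon> * mixed_area S S"
        using De_R[OF S] by (simp only: mixed_area_commute[of S De])
      ultimately show ?thesis
        using De_R[OF De] by (simp add: power2_eq_square algebra_simps)
    qed
    moreover have "L De = L D + \<epsilon> * L S"
      unfolding De_def using D S \<epsilon> by (simp add: L_plus L_scale convex_body_scale)
    ultimately show ?thesis by simp
  qed
  have "((\<lambda>\<epsilon>. a * (mixed_area D D + 2 * \<epsilon> * mixed_area D S + \<epsilon>\<^sup>2 * mixed_area S S)) \<longlongrightarrow>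
      a * (mixed_area D D + 2 * 0 * mixed_area D S + 0\<^sup>2 * mixed_area S S)) (at_right 0)"
    by (intro tendsto_intros)
  moreover have "((\<lambda>\<epsilon>. (L D + \<epsilon> * L S)\<^sup>2) \<longlongrightarrow> (L D + 0 * L S)\<^sup>2) (at_right 0)"
    by (intro tendsto_intros)
  ultimately have "a * (mixed_area D D + 2 * 0 * mixed_area D S + 0\<^sup>2 * mixed_area S S) \<le> (L D + 0 * L S)\<^sup>2"
    using eps by (intro tendsto_le[OF trivial_limit_at_right_real]) (auto intro: eventually_mono[OF eventually_at_right_less])
  then show ?thesis
    using a by (simp add: L_def mixed_area_same D mult.commute)
qed

section \<open>Integrals of positive semidefinite kernels\<close>

text \<open>Up to powers of the total mass \<open>\<tau>\<close>, the right-hand side is the expectation of the double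
  sum of \<open>G\<close> over the points \<open>cs\<close> and \<open>m\<close> further independent random points.  The induction
  integrates out one random point at a time.\<close>

lemma (in finite_measure) psd_kernel_sample:
  fixes G :: "'a \<Rightarrow> 'a \<Rightarrow> real"
  assumes UNIV: "space M = UNIV"
    and meas: "case_prod G \<in> borel_measurable (M \<Otimes>\<^sub>M M)"
    and bound: "\<And>c d. \<bar>G c d\<bar> \<le> B" and sym: "\<And>c d. G c d = G d c"
    and psd: "\<And>cs. 0 \<le> (\<Sum>c\<leftarrow>cs. \<Sum>d\<leftarrow>cs. G c d)"
    and \<tau>: "\<tau> = measure M UNIV" "\<tau> > 0"
  shows "0 \<le> \<tau>\<^sup>2 * (\<Sum>c\<leftarrow>cs. \<Sum>d\<leftarrow>cs. G c d) + 2 * real m * \<tau> * (\<Sum>c\<leftarrow>cs. \<integral>d. G c d \<partial>M)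
    + real m * (real m - 1) * (\<integral>c. (\<integral>d. G c d \<partial>M) \<partial>M) + real m * \<tau> * (\<integral>c. G c c \<partial>M)"
proof (induction m arbitrary: cs)
  case 0
  then show ?case using psd[of cs] by simp
next
  case (Suc m)
  define g where "g c = (\<integral>d. G c d \<partial>M)" for c
  define \<Gamma> where "\<Gamma> = (\<integral>c. g c \<partial>M)"
  define \<delta> where "\<delta> = (\<integral>c. G c c \<partial>M)"
  note [measurable] = meas
  have int_G: "integrable M (G c)" for c
    using bound UNIV by (intro integrable_const_bound[of _ B]) auto
  have int_diag: "integrable M (\<lambda>c. G c c)"
    using bound by (intro integrable_const_bound[of _ B]) auto
  have g_bound: "norm (g c) \<le> B * \<tau>" for c
  proof -
    have "norm (g c) \<le> (\<integral>d. norm (G c d) \<partial>M)"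
      unfolding g_def by (rule integral_norm_bound)
    also have "\<dots> \<le> (\<integral>d. B \<partial>M)"
      using bound int_G[of c] by (intro integral_mono) auto
    finally show ?thesis by (simp add: \<tau> UNIV mult.commute)
  qed
  have int_g: "integrable M g"
  proof (rule integrable_const_bound[of _ "B * \<tau>"])
    show "g \<in> borel_measurable M" unfolding g_def by measurable
  qed (use g_bound in auto)
  define k where "k = \<tau>\<^sup>2 * (\<Sum>b\<leftarrow>cs. \<Sum>d\<leftarrow>cs. G b d) + 2 * real m * \<tau> * (\<Sum>b\<leftarrow>cs. g b)
      + real m * (real m - 1) * \<Gamma> + real m * \<tau> * \<delta>"
  have row: "integrable M (\<lambda>c. \<Sum>b\<leftarrow>cs. G c b) \<and> (\<integral>c. (\<Sum>b\<leftarrow>cs. G c b) \<partial>M) = (\<Sum>b\<leftarrow>cs. g b)" for cs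
  proof (induction cs)
    case (Cons b cs)
    have eq: "(\<lambda>c. G c b) = G b" by (rule ext) (rule sym)
    have "integrable M (\<lambda>c. G c b)" "(\<integral>c. G c b \<partial>M) = g b"
      unfolding eq g_def by (rule int_G, rule refl)
    then show ?case using Cons by simp
  qed simp
  define H where "H c = k + 2 * \<tau>\<^sup>2 * (\<Sum>b\<leftarrow>cs. G c b) + \<tau>\<^sup>2 * G c c + 2 * real m * \<tau> * g c" for c
  have "0 \<le> H c" for c
  proof -
    have "(\<Sum>b\<leftarrow>cs. G b c + (\<Sum>d\<leftarrow>cs. G b d)) = (\<Sum>b\<leftarrow>cs. G c b) + (\<Sum>b\<leftarrow>cs. \<Sum>d\<leftarrow>cs. G b d)"
      by (simp add: sum_list_addf sym[of _ c])
    then show ?thesis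
      using Suc.IH[of "c # cs"] by (simp add: H_def k_def g_def \<Gamma>_def \<delta>_def algebra_simps)
  qed
  then have "0 \<le> (\<integral>c. H c \<partial>M)" by (rule Bochner_Integration.integral_nonneg)
  also have "(\<integral>c. H c \<partial>M) = \<tau> * k + 2 * \<tau>\<^sup>2 * (\<Sum>b\<leftarrow>cs. g b) + \<tau>\<^sup>2 * \<delta> + 2 * real m * \<tau> * \<Gamma>"
    unfolding H_def using row int_diag int_g by (simp add: \<tau>(1) UNIV \<delta>_def \<Gamma>_def)
  also have "\<dots> = \<tau> * (\<tau>\<^sup>2 * (\<Sum>c\<leftarrow>cs. \<Sum>d\<leftarrow>cs. G c d) + 2 * real (Suc m) * \<tau> * (\<Sum>b\<leftarrow>cs. g b)
    + real (Suc m) * (real (Suc m) - 1) * \<Gamma> + real (Suc m) * \<tau> * \<delta>)"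
    by (simp add: k_def algebra_simps power2_eq_square)
  finally show ?case
    using \<tau>(2) by (simp add: zero_le_mult_iff g_def \<Gamma>_def \<delta>_def)
qed

text \<open>With \<open>m\<close> random points the off-diagonal part grows like \<open>m\<^sup>2\<close> and the diagonal part only
  like \<open>m\<close>, so a negative double integral would contradict positivity for large \<open>m\<close>.\<close>

lemma (in finite_measure) psd_kernel_integral_nonneg:
  fixes G :: "'a \<Rightarrow> 'a \<Rightarrow> real"
  assumes "space M = UNIV" "case_prod G \<in> borel_measurable (M \<Otimes>\<^sub>M M)"
    and "\<And>c d. \<bar>G c d\<bar> \<le> B" "\<And>c d. G c d = G d c"
    and "\<And>cs. 0 \<le> (\<Sum>c\<leftarrow>cs. \<Sum>d\<leftarrow>cs. G c d)"
  shows "0 \<le> (\<integral>c. (\<integral>d. G c d \<partial>M) \<partial>M)"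
proof (cases "measure M UNIV > 0")
  case False
  then have "emeasure M (space M) = 0"
    using assms(1) measure_nonneg[of M UNIV] by (simp add: emeasure_eq_measure)
  then have "AE x in M. False" by (intro AE_I[of _ _ "space M"]) auto
  then have "(\<integral>c. (\<integral>d. G c d \<partial>M) \<partial>M) = 0"
    by (intro integral_eq_zero_AE) (auto elim: eventually_mono)
  then show ?thesis by simp
next
  case True
  define \<Gamma> where "\<Gamma> = (\<integral>c. (\<integral>d. G c d \<partial>M) \<partial>M)"
  define \<delta> where "\<delta> = measure M UNIV * (\<integral>c. G c c \<partial>M)"
  have sample: "0 \<le> real m * (real m - 1) * \<Gamma> + real m * \<delta>" for m
    using psd_kernel_sample[OF assms refl True, of "[]" m] by (simp add: \<Gamma>_def \<delta>_def mult.assoc)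
  have "\<not> \<Gamma> < 0"
  proof
    assume "\<Gamma> < 0"
    obtain m :: nat where m: "1 + \<delta> / - \<Gamma> < m" using reals_Archimedean2 by blast
    have "\<delta> < (real m - 1) * - \<Gamma>"
      using m \<open>\<Gamma> < 0\<close> by (simp add: field_simps)
    moreover have "m > 0"
    proof (rule ccontr)
      assume "\<not> m > 0"
      then have "\<delta> < \<Gamma>" using \<open>\<delta> < _\<close> by simp
      moreover have "0 \<le> \<delta>" using sample[of 1] by simp
      ultimately show False using \<open>\<Gamma> < 0\<close> by simp
    qed
    ultimately have "real m * ((real m - 1) * \<Gamma> + \<delta>) < 0"
      by (intro mult_pos_neg) auto
    then show False using sample[of m] by (simp add: algebra_simps)
  qed
  then show ?thesis by (simp add: \<Gamma>_def)
qed

section \<open>Volumes of slices\<close>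

lemma slice_measure_measurable:
  fixes P :: "('a::euclidean_space \<times> 'b::euclidean_space) set"
  assumes "P \<in> sets borel"
  shows "(\<lambda>x. vol (Pair x -` P)) \<in> borel_measurable borel"
  using lborel.measurable_emeasure_Pair[OF sets_pair_lborel[OF assms]] by (simp add: measure_def)

lemma slice_measure_bounded:
  fixes P :: "('a::euclidean_space \<times> 'b::euclidean_space) set"
  assumes "convex_body P"
  shows "vol (Pair x -` P) \<le> vol (snd ` P)"
proof (rule measure_mono_fmeasurable)
  show "Pair x -` P \<subseteq> snd ` P" by force
  show "Pair x -` P \<in> sets lborel"
    using convex_body_measurable[OF convex_body_slice[OF assms, of x]] by (cases "Pair x -` P = {}") simp_all
  have "compact (snd ` P)"
    using assms by (intro compact_continuous_image continuous_on_snd continuous_on_id) (simp add: convex_body_def)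
  then show "snd ` P \<in> fmeasurable lborel"
    using emeasure_compact_finite by (simp add: fmeasurable_def borel_compact)
qed

lemma integrable_bounded_support:
  fixes f :: "'a::euclidean_space \<Rightarrow> real"
  assumes "f \<in> borel_measurable borel" "\<And>x. \<bar>f x\<bar> \<le> B" "compact U" "\<And>x. x \<notin> U \<Longrightarrow> f x = 0"
  shows "integrable lborel f"
proof (rule Bochner_Integration.integrable_bound)
  show "integrable lborel (\<lambda>x. B * indicator U x)"
    using assms(3) emeasure_compact_finite[of U] by (intro integrable_mult_right) (simp add: integrable_indicator_iff borel_compact)
  show "AE x in lborel. norm (f x) \<le> norm (B * indicator U x)"
    using assms(2,4) by (intro AE_I2) (auto simp: indicator_def intro: order_trans[OF _ abs_ge_self])
qed (use assms(1) in simp)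

lemma slice_empty_iff: "Pair x -` P = {} \<longleftrightarrow> x \<notin> fst ` P"
  by force

lemma slice_measure_integrable:
  fixes P :: "('a::euclidean_space \<times> 'b::euclidean_space) set"
  assumes "convex_body P"
  shows "integrable lborel (\<lambda>x. vol (Pair x -` P))"
proof (rule integrable_bounded_support)
  show "compact (fst ` P)"
    using assms by (intro compact_continuous_image continuous_on_fst continuous_on_id) (simp add: convex_body_def)
  show "\<bar>vol (Pair x -` P)\<bar> \<le> vol (snd ` P)" for x
    using slice_measure_bounded[OF assms] by simp
  show "vol (Pair x -` P) = 0" if "x \<notin> fst ` P" for x
    using that slice_empty_iff[of x P] by simp
qed (intro slice_measure_measurable convex_body_measurable assms)

lemma measure_eq_integral_slices:
  fixes P :: "('a::euclidean_space \<times> 'b::euclidean_space) set"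
  assumes P: "convex_body P"
  shows "vol P = (\<integral>x. vol (Pair x -` P) \<partial>lborel)"
proof -
  have fin: "emeasure lborel (Pair x -` P) = ennreal (vol (Pair x -` P))" for x
  proof (cases "Pair x -` P = {}")
    case False
    then have "compact (Pair x -` P)" using convex_body_slice[OF P] by (simp add: convex_body_def)
    then show ?thesis
      using emeasure_compact_finite[of "Pair x -` P"] by (intro emeasure_eq_ennreal_measure) auto
  qed simp
  have "emeasure lborel P = (\<integral>\<^sup>+x. ennreal (vol (Pair x -` P)) \<partial>lborel)"
    unfolding fin[symmetric]
    using lborel.emeasure_pair_measure_alt[OF sets_pair_lborel[OF convex_body_measurable[OF P]]] by (simp add: lborel_prod)
  also have "\<dots> = ennreal (\<integral>x. vol (Pair x -` P) \<partial>lborel)"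
    using slice_measure_integrable[OF P] by (intro nn_integral_eq_integral) auto
  finally show ?thesis
    by (simp add: measure_def enn2real_ennreal Bochner_Integration.integral_nonneg)
qed

lemma measurable_fst_borel: "fst \<in> borel_measurable (borel :: ('a::euclidean_space \<times> 'b::euclidean_space) measure)"
  and measurable_snd_borel: "snd \<in> borel_measurable (borel :: ('a::euclidean_space \<times> 'b::euclidean_space) measure)"
  by (auto intro!: borel_measurable_continuous_onI continuous_on_fst continuous_on_snd continuous_on_id)

lemma integral_lborel_product:
  fixes f :: "'a::euclidean_space \<times> 'b::euclidean_space \<Rightarrow> real"
  assumes "integrable lborel f"
  shows "(\<integral>p. f p \<partial>lborel) = (\<integral>x. (\<integral>y. f (x, y) \<partial>lborel) \<partial>lborel)"
  using lborel_pair.integral_fst'[of f] assms by (simp add: lborel_prod)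

section \<open>Bodies that share a plane\<close>

type_synonym plane = "real \<times> real"

text \<open>The two embeddings use different copies of the base but the same plane, as flat bodies
  and graphs do after a linear change of coordinates.\<close>

definition left_embed :: "'c::euclidean_space \<times> plane \<Rightarrow> ('c \<times> 'c) \<times> plane" where
  "left_embed z = ((fst z, 0), snd z)"

definition right_embed :: "'c::euclidean_space \<times> plane \<Rightarrow> ('c \<times> 'c) \<times> plane" where
  "right_embed z = ((0, fst z), snd z)"

lemma linear_left_embed: "linear left_embed" and linear_right_embed: "linear right_embed"
  by (auto intro!: linearI simp: left_embed_def right_embed_def)

lemma join_slice:
  "Pair (c, d) -` (left_embed ` C + right_embed ` C') = Pair c -` C + Pair d -` C'"
proof (intro equalityI subsetI)
  fix y assume "y \<in> Pair (c, d) -` (left_embed ` C + right_embed ` C')"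
  then obtain z z' where z: "z \<in> C" "z' \<in> C'" "((c, d), y) = left_embed z + right_embed z'"
    by (auto elim!: set_plus_elim)
  then have "fst z = c" "fst z' = d" "y = snd z + snd z'" by (auto simp: left_embed_def right_embed_def)
  moreover have "snd z \<in> Pair (fst z) -` C" "snd z' \<in> Pair (fst z') -` C'" using z by auto
  ultimately show "y \<in> Pair c -` C + Pair d -` C'" using set_plus_intro by blast
next
  fix y assume "y \<in> Pair c -` C + Pair d -` C'"
  then obtain a b where "(c, a) \<in> C" "(d, b) \<in> C'" "y = a + b" by (auto elim!: set_plus_elim)
  then show "y \<in> Pair (c, d) -` (left_embed ` C + right_embed ` C')"
    using set_plus_intro[OF imageI[of "(c, a)" C left_embed] imageI[of "(d, b)" C' right_embed]]
    by (simp add: left_embed_def[of "(c, a)"] right_embed_def[of "(d, b)"])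
qed

lemma convex_body_join:
  "convex_body C \<Longrightarrow> convex_body C' \<Longrightarrow> convex_body (left_embed ` C + right_embed ` C')"
  by (intro convex_body_plus convex_body_linear_image linear_left_embed linear_right_embed)

text \<open>Fibres over points outside the projection of a body are empty and must contribute
  nothing, whereas \<open>mixed_area\<close> is only meaningful for nonempty sets.\<close>

definition fibre_area :: "plane set \<Rightarrow> plane set \<Rightarrow> real" where
  "fibre_area P Q = (if P = {} \<or> Q = {} then 0 else mixed_area P Q)"

lemma fibre_area_commute: "fibre_area P Q = fibre_area Q P"
  by (simp add: fibre_area_def mixed_area_commute)

lemma convex_body_fst: "convex_body P \<Longrightarrow> convex_body (fst ` P)"
  for P :: "('a::euclidean_space \<times> 'b::euclidean_space) set"
  by (rule convex_body_linear_image[OF linear_fst])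

context
  fixes C C' :: "('c::euclidean_space \<times> plane) set"
  assumes C: "convex_body C" and C': "convex_body C'"
begin

text \<open>The indicator functions remove the areas of fibres whose partner is empty.  In this form
  measurability and boundedness can be read off.\<close>

lemma fibre_area_slices:
  "fibre_area (Pair (fst p) -` C) (Pair (snd p) -` C') =
    (vol (Pair p -` (left_embed ` C + right_embed ` C'))
      - indicator (fst ` C') (snd p) * vol (Pair (fst p) -` C)
      - indicator (fst ` C) (fst p) * vol (Pair (snd p) -` C')) / 2"
proof -
  obtain c d where p: "p = (c, d)" by (cases p)
  have [simp]: "{} + B = {}" "B + {} = {}" for B :: "plane set" by (auto simp: set_plus_def)
  show ?thesis
    unfolding p join_slice fst_conv snd_conv
    using slice_empty_iff[of c C] slice_empty_iff[of d C']
    by (cases "Pair c -` C = {}"; cases "Pair d -` C' = {}")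
      (simp_all add: fibre_area_def mixed_area_def)
qed

lemma fibre_area_measurable:
  "(\<lambda>p. fibre_area (Pair (fst p) -` C) (Pair (snd p) -` C')) \<in> borel_measurable borel"
proof -
  have [measurable]: "fst ` C \<in> sets borel" "fst ` C' \<in> sets borel"
    using C C' by (auto intro: convex_body_measurable convex_body_fst)
  have [measurable]: "(\<lambda>x. vol (Pair x -` C)) \<in> borel_measurable borel"
      "(\<lambda>x. vol (Pair x -` C')) \<in> borel_measurable borel"
      "(\<lambda>x. vol (Pair x -` (left_embed ` C + right_embed ` C'))) \<in> borel_measurable borel"
    using C C' by (auto intro!: slice_measure_measurable convex_body_measurable convex_body_join)
  note [measurable] = measurable_fst_borel measurable_snd_borel
  show ?thesis unfolding fibre_area_slices by measurable
qed

lemma fibre_area_bounded: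
  "\<bar>fibre_area (Pair c -` C) (Pair d -` C')\<bar> \<le>
    vol (snd ` (left_embed ` C + right_embed ` C')) + vol (snd ` C) + vol (snd ` C')"
proof -
  have part: "indicator X y * vol (Pair x -` R) \<le> vol (snd ` R)"
    "0 \<le> indicator X y * vol (Pair x -` R)"
    if "convex_body R" for R :: "('c \<times> plane) set" and x X and y :: 'c
    using slice_measure_bounded[OF that, of x] by (auto simp: indicator_def)
  have bound: "\<bar>f\<bar> \<le> B0 + B1 + B2"
    if "f = (m - a - b) / 2" "0 \<le> m" "m \<le> B0" "0 \<le> a" "a \<le> B1" "0 \<le> b" "b \<le> B2"
    for f m a b B0 B1 B2 :: real
  proof -
    have "2 * f = m - a - b" using that(1) by simp
    then show ?thesis using that(2-) by linarith
  qed
  show ?thesis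
    using C C' convex_body_join[OF C C']
    by (intro bound[OF fibre_area_slices[of "(c, d)", unfolded fst_conv snd_conv]] part slice_measure_bounded) auto
qed

lemma fibre_area_support: "c \<notin> fst ` C \<or> d \<notin> fst ` C' \<Longrightarrow> fibre_area (Pair c -` C) (Pair d -` C') = 0"
  unfolding fibre_area_def slice_empty_iff by simp

lemma fibre_area_integrable:
  "integrable lborel (\<lambda>p. fibre_area (Pair (fst p) -` C) (Pair (snd p) -` C'))"
proof (rule integrable_bounded_support[OF fibre_area_measurable fibre_area_bounded])
  show "compact (fst ` C \<times> fst ` C')"
    using convex_body_fst[OF C] convex_body_fst[OF C'] by (intro compact_Times) (auto simp: convex_body_def)
  show "fibre_area (Pair (fst p) -` C) (Pair (snd p) -` C') = 0" if "p \<notin> fst ` C \<times> fst ` C'" for p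
    using that by (intro fibre_area_support) (auto simp: mem_Times_iff)
qed

end

text \<open>The mixed area of the Minkowski integrals of the fibres of the two bodies.\<close>

definition cross_area :: "('c::euclidean_space \<times> plane) set \<Rightarrow> ('c \<times> plane) set \<Rightarrow> real" where
  "cross_area C C' = (\<integral>p. fibre_area (Pair (fst p) -` C) (Pair (snd p) -` C') \<partial>lborel)"

lemma cross_area_commute:
  assumes C: "convex_body C" and C': "convex_body C'"
  shows "cross_area C C' = cross_area C' C"
proof -
  let ?f = "\<lambda>c d. fibre_area (Pair c -` C) (Pair d -` C')"
  have int: "integrable (lborel \<Otimes>\<^sub>M lborel) (\<lambda>(c, d). ?f c d)"
    using fibre_area_integrable[OF C C'] by (simp add: lborel_prod split_beta')
  have "cross_area C C' = (\<integral>c. (\<integral>d. ?f c d \<partial>lborel) \<partial>lborel)"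
    unfolding cross_area_def using integral_lborel_product[OF fibre_area_integrable[OF C C']] by simp
  also have "\<dots> = (\<integral>d. (\<integral>c. ?f c d \<partial>lborel) \<partial>lborel)"
    using lborel_pair.Fubini_integral[OF int] by simp
  also have "\<dots> = cross_area C' C"
    unfolding cross_area_def using integral_lborel_product[OF fibre_area_integrable[OF C' C]]
    by (simp add: fibre_area_commute[of _ "Pair _ -` C'"])
  finally show ?thesis .
qed

text \<open>A fixed planar body is the fibre over \<open>0\<close> of its copy in the product.\<close>

lemma fibre_area_body:
  fixes C :: "('c::euclidean_space \<times> plane) set"
  assumes C: "convex_body C" and D: "convex_body D"
  shows "(\<lambda>c. fibre_area (Pair c -` C) D) \<in> borel_measurable borel"
    and "\<exists>B. \<forall>c. \<bar>fibre_area (Pair c -` C) D\<bar> \<le> B"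
proof -
  let ?D = "(\<lambda>y. (0 :: 'c, y)) ` D"
  have D': "convex_body ?D" using D by (intro convex_body_linear_image) (auto intro: linearI)
  have slice: "Pair 0 -` ?D = D" by auto
  have "(\<lambda>c :: 'c. (c, 0 :: 'c)) \<in> borel_measurable borel"
    by (intro borel_measurable_continuous_onI continuous_on_Pair continuous_on_id continuous_on_const)
  from measurable_compose[OF this fibre_area_measurable[OF C D']]
  show "(\<lambda>c. fibre_area (Pair c -` C) D) \<in> borel_measurable borel" by (simp add: slice)
  show "\<exists>B. \<forall>c. \<bar>fibre_area (Pair c -` C) D\<bar> \<le> B"
    using fibre_area_bounded[OF C D', of _ 0] by (auto simp: slice)
qed

text \<open>The planar inequality applied to all nonempty fibres over the points of \<open>cs\<close> at once.\<close>

lemma psd_fibre_kernel: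
  fixes C :: "'j \<Rightarrow> ('c::euclidean_space \<times> plane) set"
  assumes J: "finite J" and C: "\<And>j. j \<in> J \<Longrightarrow> convex_body (C j)" and D: "convex_body D"
  shows "vol D * (\<Sum>c\<leftarrow>cs. \<Sum>d\<leftarrow>cs. \<Sum>i\<in>J. \<Sum>j\<in>J. x i * x j * fibre_area (Pair c -` C i) (Pair d -` C j))
    \<le> (\<Sum>c\<leftarrow>cs. \<Sum>i\<in>J. x i * fibre_area (Pair c -` C i) D)\<^sup>2"
proof -
  define n where "n = length cs"
  define P where "P = (\<lambda>(r, i). Pair (cs ! r) -` C i)"
  define I where "I = {q \<in> {..<n} \<times> J. P q \<noteq> {}}"
  have fin: "finite ({..<n} \<times> J)" using J by simp
  have I: "finite I" unfolding I_def using fin by simp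
  have P: "convex_body (P q)" if "q \<in> I" for q
    using that C by (auto simp: I_def P_def intro!: convex_body_slice)
  have D0: "D \<noteq> {}" using D by (simp add: convex_body_def)
  have row: "(\<Sum>q\<in>{..<n} \<times> J. g q * fibre_area (P q) Q) = (\<Sum>q\<in>I. g q * fibre_area (P q) Q)" for g Q
    using fin by (intro sum.mono_neutral_right) (auto simp: I_def fibre_area_def)
  have pairs: "(\<Sum>r<n. \<Sum>i\<in>J. g r i) = (\<Sum>q\<in>{..<n} \<times> J. g (fst q) (snd q))" for g :: "nat \<Rightarrow> 'j \<Rightarrow> real"
    by (simp add: sum.cartesian_product split_beta')
  have "(\<Sum>c\<leftarrow>cs. \<Sum>i\<in>J. x i * fibre_area (Pair c -` C i) D) = (\<Sum>q\<in>{..<n} \<times> J. x (snd q) * fibre_area (P q) D)"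
    by (simp add: sum_list_sum_nth n_def atLeast0LessThan P_def sum.cartesian_product split_beta')
  also have "\<dots> = (\<Sum>q\<in>I. x (snd q) * mixed_area (P q) D)"
    unfolding row using D0 by (intro sum.cong) (auto simp: I_def fibre_area_def)
  finally have lin: "(\<Sum>c\<leftarrow>cs. \<Sum>i\<in>J. x i * fibre_area (Pair c -` C i) D) = (\<Sum>q\<in>I. x (snd q) * mixed_area (P q) D)" .
  have "(\<Sum>c\<leftarrow>cs. \<Sum>d\<leftarrow>cs. \<Sum>i\<in>J. \<Sum>j\<in>J. x i * x j * fibre_area (Pair c -` C i) (Pair d -` C j))
      = (\<Sum>r<n. \<Sum>s<n. \<Sum>i\<in>J. \<Sum>j\<in>J. x i * x j * fibre_area (P (r, i)) (P (s, j)))"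
    by (simp add: sum_list_sum_nth n_def atLeast0LessThan P_def)
  also have "\<dots> = (\<Sum>r<n. \<Sum>i\<in>J. \<Sum>s<n. \<Sum>j\<in>J. x i * x j * fibre_area (P (r, i)) (P (s, j)))"
    by (intro sum.cong refl sum.swap)
  also have "\<dots> = (\<Sum>q\<in>{..<n} \<times> J. \<Sum>q'\<in>{..<n} \<times> J. x (snd q) * x (snd q') * fibre_area (P q) (P q'))"
    unfolding pairs by simp
  also have "\<dots> = (\<Sum>q\<in>{..<n} \<times> J. (\<Sum>q'\<in>I. x (snd q') * x (snd q) * fibre_area (P q') (P q)))"
    unfolding row[symmetric] by (intro sum.cong refl) (simp add: fibre_area_commute mult_ac)
  also have "\<dots> = (\<Sum>q'\<in>I. \<Sum>q\<in>{..<n} \<times> J. (x (snd q') * x (snd q)) * fibre_area (P q) (P q'))"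
    by (subst sum.swap) (intro sum.cong refl, simp add: fibre_area_commute)
  also have "\<dots> = (\<Sum>q'\<in>I. \<Sum>q\<in>I. x (snd q') * x (snd q) * mixed_area (P q') (P q))"
    unfolding row by (intro sum.cong refl) (auto simp: I_def fibre_area_def mixed_area_commute)
  finally have quad: "(\<Sum>c\<leftarrow>cs. \<Sum>d\<leftarrow>cs. \<Sum>i\<in>J. \<Sum>j\<in>J. x i * x j * fibre_area (Pair c -` C i) (Pair d -` C j))
      = (\<Sum>q'\<in>I. \<Sum>q\<in>I. x (snd q') * x (snd q) * mixed_area (P q') (P q))" .
  show ?thesis unfolding lin quad by (rule mixed_area_hyperbolic[OF I P D])
qed

text \<open>The kernel \<open>V(P, D) V(Q, D) - V(P, Q) V(D, D)\<close>, evaluated at the fibres and weighted by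
  \<open>x\<close>, is positive semidefinite, bounded and supported on a compact set, so its double integral is
  nonnegative.\<close>

lemma cross_area_hyperbolic:
  fixes C :: "'j \<Rightarrow> ('c::euclidean_space \<times> plane) set"
  assumes J: "finite J" and C: "\<And>j. j \<in> J \<Longrightarrow> convex_body (C j)" and D: "convex_body D"
  shows "vol D * (\<Sum>i\<in>J. \<Sum>j\<in>J. x i * x j * cross_area (C i) (C j))
    \<le> (\<Sum>i\<in>J. x i * (\<integral>c. fibre_area (Pair c -` C i) D \<partial>lborel))\<^sup>2"
proof -
  define f where "f c = (\<Sum>i\<in>J. x i * fibre_area (Pair c -` C i) D)" for c
  define h where "h c d = (\<Sum>i\<in>J. \<Sum>j\<in>J. x i * x j * fibre_area (Pair c -` C i) (Pair d -` C j))" for c d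
  define G where "G c d = f c * f d - vol D * h c d" for c d
  define U where "U = (\<Union>j\<in>J. fst ` C j)"
  have U: "compact U"
    unfolding U_def using J C convex_body_fst by (intro compact_UN) (auto simp: convex_body_def)
  have f0: "f c = 0" if "c \<notin> U" for c
    unfolding f_def using that
    by (intro sum.neutral ballI) (auto simp: U_def fibre_area_def slice_empty_iff)
  have h0: "h c d = 0" if "c \<notin> U \<or> d \<notin> U" for c d
    unfolding h_def
  proof (intro sum.neutral ballI)
    fix i j assume ij: "i \<in> J" "j \<in> J"
    then have "fibre_area (Pair c -` C i) (Pair d -` C j) = 0"
      using that C by (intro fibre_area_support) (auto simp: U_def)
    then show "x i * x j * fibre_area (Pair c -` C i) (Pair d -` C j) = 0" by simp
  qed
  have G0: "G c d = 0" if "c \<notin> U \<or> d \<notin> U" for c d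
    using that f0 h0 by (auto simp: G_def)
  have fm: "f \<in> borel_measurable borel"
    unfolding f_def using fibre_area_body(1)[OF C D] by (intro borel_measurable_sum borel_measurable_times) auto
  have hm: "(\<lambda>p. h (fst p) (snd p)) \<in> borel_measurable borel"
    unfolding h_def using fibre_area_measurable[OF C C]
    by (intro borel_measurable_sum borel_measurable_times) auto
  have Gm: "(\<lambda>p. G (fst p) (snd p)) \<in> borel_measurable borel"
    unfolding G_def
    by (intro borel_measurable_diff borel_measurable_times hm borel_measurable_const
        measurable_compose[OF measurable_fst_borel fm] measurable_compose[OF measurable_snd_borel fm])
  have "\<forall>i. \<exists>B. i \<in> J \<longrightarrow> (\<forall>c. \<bar>fibre_area (Pair c -` C i) D\<bar> \<le> B)"
    using fibre_area_body(2)[OF C D] by blast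
  then obtain Bf where Bf: "\<And>i c. i \<in> J \<Longrightarrow> \<bar>fibre_area (Pair c -` C i) D\<bar> \<le> Bf i" by metis
  have "\<forall>i j. \<exists>B. i \<in> J \<and> j \<in> J \<longrightarrow> (\<forall>c d. \<bar>fibre_area (Pair c -` C i) (Pair d -` C j)\<bar> \<le> B)"
    using fibre_area_bounded[OF C C] by blast
  then obtain Bh where Bh: "\<And>i j c d. i \<in> J \<Longrightarrow> j \<in> J \<Longrightarrow> \<bar>fibre_area (Pair c -` C i) (Pair d -` C j)\<bar> \<le> Bh i j"
    by metis
  define b1 where "b1 = (\<Sum>i\<in>J. \<bar>x i\<bar> * Bf i)"
  define b2 where "b2 = (\<Sum>i\<in>J. \<Sum>j\<in>J. \<bar>x i * x j\<bar> * Bh i j)"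
  have fb: "\<bar>f c\<bar> \<le> b1" for c
    unfolding f_def b1_def by (rule order_trans[OF sum_abs]) (auto simp: abs_mult intro!: sum_mono mult_left_mono Bf)
  have hb: "\<bar>h c d\<bar> \<le> b2" for c d
    unfolding h_def b2_def
    by (rule order_trans[OF sum_abs], intro sum_mono, rule order_trans[OF sum_abs])
      (auto simp: abs_mult intro!: sum_mono mult_left_mono Bh)
  have Gb: "\<bar>G c d\<bar> \<le> b1 * b1 + vol D * b2" for c d
  proof -
    have "\<bar>f c * f d\<bar> \<le> b1 * b1"
      unfolding abs_mult using fb[of c] fb[of d] by (intro mult_mono) auto
    moreover have "\<bar>vol D * h c d\<bar> \<le> vol D * b2"
      using hb[of c d] by (simp add: abs_mult mult_left_mono)
    ultimately show ?thesis unfolding G_def by linarith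
  qed
  have hsym: "h c d = h d c" for c d
    unfolding h_def by (subst sum.swap) (simp add: fibre_area_commute[of "Pair c -` _"] mult.commute)
  have Gsym: "G c d = G d c" for c d
    unfolding G_def hsym[of c d] by (simp add: mult.commute)
  have psd: "0 \<le> (\<Sum>c\<leftarrow>cs. \<Sum>d\<leftarrow>cs. G c d)" for cs
  proof -
    have "(\<Sum>c\<leftarrow>cs. \<Sum>d\<leftarrow>cs. G c d) = (\<Sum>c\<leftarrow>cs. f c)\<^sup>2 - vol D * (\<Sum>c\<leftarrow>cs. \<Sum>d\<leftarrow>cs. h c d)"
      by (simp add: G_def sum_list_subtractf sum_list_const_mult sum_list_mult_const power2_eq_square)
    then show ?thesis
      using psd_fibre_kernel[where cs=cs and x=x, OF J C D] by (simp add: f_def h_def)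
  qed
  define M where "M = density lborel (indicator U :: 'c \<Rightarrow> ennreal)"
  have Ub: "U \<in> sets borel" using U by (simp add: borel_compact)
  have space: "space M = UNIV" and sets: "sets M = sets borel" by (simp_all add: M_def)
  have "emeasure M UNIV = emeasure lborel U"
    unfolding M_def using Ub by (simp add: emeasure_density)
  then interpret M: finite_measure M
    using emeasure_compact_finite[OF U] by (intro finite_measureI) (simp add: space)
  have "sets (M \<Otimes>\<^sub>M M) = sets (borel :: ('c \<times> 'c) measure)"
    using sets_pair_measure_cong[OF sets sets] unfolding borel_prod .
  then have "case_prod G \<in> borel_measurable (M \<Otimes>\<^sub>M M)"
    using Gm by (simp add: split_beta' cong: measurable_cong_sets)
  from M.psd_kernel_integral_nonneg[OF space this Gb Gsym psd]
  have "0 \<le> (\<integral>c. (\<integral>d. G c d \<partial>M) \<partial>M)" .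
  also have "(\<integral>c. (\<integral>d. G c d \<partial>M) \<partial>M) = (\<integral>c. (\<integral>d. G c d \<partial>lborel) \<partial>lborel)"
  proof -
    have on_M: "(\<integral>c. g c \<partial>M) = (\<integral>c. g c \<partial>lborel)"
      if "g \<in> borel_measurable borel" "\<And>c. c \<notin> U \<Longrightarrow> g c = 0" for g :: "'c \<Rightarrow> real"
    proof -
      have "(\<integral>c. g c \<partial>M) = (\<integral>c. indicator U c *\<^sub>R g c \<partial>lborel)"
        using integral_density[of g lborel "indicator U"] that Ub by (simp add: M_def ennreal_indicator)
      also have "\<dots> = (\<integral>c. g c \<partial>lborel)"
        using that by (intro Bochner_Integration.integral_cong) (auto simp: indicator_def)
      finally show ?thesis .
    qed
    have slice: "G c \<in> borel_measurable borel" for c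
    proof -
      have "Pair c \<in> borel_measurable (borel :: 'c measure)"
        by (intro borel_measurable_continuous_onI continuous_on_Pair continuous_on_id continuous_on_const)
      from measurable_compose[OF this Gm] show ?thesis by simp
    qed
    have "(\<lambda>c. \<integral>d. G c d \<partial>lborel) \<in> borel_measurable lborel"
      using Gm by (intro lborel.borel_measurable_lebesgue_integral) (simp add: split_beta' lborel_prod)
    moreover have "(\<integral>d. G c d \<partial>lborel) = 0" if "c \<notin> U" for c
      using G0 that by simp
    ultimately show ?thesis
      using on_M[OF slice G0] on_M[of "\<lambda>c. \<integral>d. G c d \<partial>lborel"] by simp
  qed
  also have "\<dots> = (\<integral>c. f c \<partial>lborel)\<^sup>2 - vol D * (\<integral>p. h (fst p) (snd p) \<partial>lborel)"
  proof -
    have inth: "integrable lborel (\<lambda>p. h (fst p) (snd p))"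
      using hm hb compact_Times[OF U U] by (rule integrable_bounded_support) (auto intro!: h0)
    have intff: "integrable lborel (\<lambda>p. f (fst p) * f (snd p))"
    proof (rule integrable_bounded_support[OF _ _ compact_Times[OF U U]])
      show "(\<lambda>p. f (fst p) * f (snd p)) \<in> borel_measurable borel"
        by (intro borel_measurable_times measurable_compose[OF measurable_fst_borel fm]
            measurable_compose[OF measurable_snd_borel fm])
      show "\<bar>f (fst p) * f (snd p)\<bar> \<le> b1 * b1" for p
        unfolding abs_mult using fb[of "fst p"] fb[of "snd p"] by (intro mult_mono) auto
    qed (metis f0 mem_Times_iff mult_zero_left mult_zero_right)
    have intG: "integrable lborel (\<lambda>p. G (fst p) (snd p))"
      unfolding G_def using intff inth by simp
    have "(\<integral>c. (\<integral>d. G c d \<partial>lborel) \<partial>lborel) = (\<integral>p. G (fst p) (snd p) \<partial>lborel)"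
      using integral_lborel_product[OF intG] by simp
    also have "\<dots> = (\<integral>p. f (fst p) * f (snd p) \<partial>lborel) - vol D * (\<integral>p. h (fst p) (snd p) \<partial>lborel)"
      unfolding G_def using intff inth by simp
    also have "(\<integral>p. f (fst p) * f (snd p) \<partial>lborel) = (\<integral>c. f c \<partial>lborel)\<^sup>2"
      using integral_lborel_product[OF intff] by (simp add: power2_eq_square)
    finally show ?thesis .
  qed
  also have "(\<integral>p. h (fst p) (snd p) \<partial>lborel) = (\<Sum>i\<in>J. \<Sum>j\<in>J. x i * x j * cross_area (C i) (C j))"
    unfolding h_def cross_area_def using fibre_area_integrable[OF C C]
    by (subst Bochner_Integration.integral_sum; simp add: Bochner_Integration.integral_sum)
  also have "(\<integral>c. f c \<partial>lborel) = (\<Sum>i\<in>J. x i * (\<integral>c. fibre_area (Pair c -` C i) D \<partial>lborel))"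
  proof -
    have "integrable lborel (\<lambda>c. fibre_area (Pair c -` C i) D)" if "i \<in> J" for i
    proof (rule integrable_bounded_support[OF fibre_area_body(1)[OF C[OF that] D] Bf[OF that]])
      show "compact (fst ` C i)" using convex_body_fst[OF C[OF that]] by (simp add: convex_body_def)
      show "fibre_area (Pair c -` C i) D = 0" if "c \<notin> fst ` C i" for c
        using that by (simp add: fibre_area_def slice_empty_iff)
    qed
    then show ?thesis unfolding f_def by (subst Bochner_Integration.integral_sum) auto
  qed
  finally show ?thesis by simp
qed

lemma integral_lborel_scale:
  fixes f :: "'c::euclidean_space \<Rightarrow> real"
  assumes "f \<in> borel_measurable borel" "0 < t"
  shows "(\<integral>d. f d \<partial>lborel) = t ^ DIM('c) * (\<integral>d. f (t *\<^sub>R d) \<partial>lborel)"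
proof -
  have "(\<lambda>d :: 'c. 0 + t *\<^sub>R d) \<in> borel_measurable borel" by measurable
  then have "(\<integral>d. f d \<partial>lborel) = (\<integral>d. f d \<partial>density (distr lborel borel (\<lambda>d :: 'c. 0 + t *\<^sub>R d)) (\<lambda>_. \<bar>t\<bar> ^ DIM('c)))"
    using assms(2) by (subst lborel_affine[of t 0]) auto
  also have "\<dots> = t ^ DIM('c) * (\<integral>d. f (t *\<^sub>R d) \<partial>lborel)"
    using assms by (subst integral_density) (auto simp: integral_distr)
  finally show ?thesis .
qed

text \<open>The fibre over \<open>(c, t d)\<close> of the sum is the planar sum of \<open>C\<^sub>c\<close> and \<open>t\<close> times the fibre
  of \<open>C'\<close> over \<open>d\<close>; its area is a quadratic polynomial in \<open>t\<close>, and the substitution in the second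
  base variable produces the power of \<open>t\<close>.\<close>

lemma join_measure_scaled:
  fixes C C' :: "('c::euclidean_space \<times> plane) set"
  assumes C: "convex_body C" and C': "convex_body C'"
  shows "\<exists>\<alpha> \<gamma>. \<forall>t>0. vol (left_embed ` C + right_embed ` (*\<^sub>R) t ` C') =
    t ^ DIM('c) * (\<alpha> + 2 * t * cross_area C C' + t\<^sup>2 * \<gamma>)"
proof -
  define a where "a p = indicator (fst ` C') (snd p) * vol (Pair (fst p) -` C)" for p :: "'c \<times> 'c"
  define g where "g p = indicator (fst ` C) (fst p) * vol (Pair (snd p) -` C')" for p :: "'c \<times> 'c"
  define b where "b p = fibre_area (Pair (fst p) -` C) (Pair (snd p) -` C')" for p
  have [measurable]: "fst ` C \<in> sets borel" "fst ` C' \<in> sets borel"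
    using C C' by (auto intro: convex_body_measurable convex_body_fst)
  have [measurable]: "(\<lambda>x. vol (Pair x -` C)) \<in> borel_measurable borel"
      "(\<lambda>x. vol (Pair x -` C')) \<in> borel_measurable borel"
    using C C' by (auto intro!: slice_measure_measurable convex_body_measurable)
  note [measurable] = measurable_fst_borel measurable_snd_borel
  have K: "compact (fst ` C \<times> fst ` C')"
    using convex_body_fst[OF C] convex_body_fst[OF C'] by (intro compact_Times) (auto simp: convex_body_def)
  have inta: "integrable lborel a"
  proof (rule integrable_bounded_support[OF _ _ K])
    show "a \<in> borel_measurable borel" unfolding a_def by measurable
    show "\<bar>a p\<bar> \<le> vol (snd ` C)" for p
      using slice_measure_bounded[OF C, of "fst p"] by (auto simp: a_def indicator_def)
    show "a p = 0" if "p \<notin> fst ` C \<times> fst ` C'" for p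
      using that slice_empty_iff[of "fst p" C] by (auto simp: a_def indicator_def mem_Times_iff)
  qed
  have intg: "integrable lborel g"
  proof (rule integrable_bounded_support[OF _ _ K])
    show "g \<in> borel_measurable borel" unfolding g_def by measurable
    show "\<bar>g p\<bar> \<le> vol (snd ` C')" for p
      using slice_measure_bounded[OF C', of "snd p"] by (auto simp: g_def indicator_def)
    show "g p = 0" if "p \<notin> fst ` C \<times> fst ` C'" for p
      using that slice_empty_iff[of "snd p" C'] by (auto simp: g_def indicator_def mem_Times_iff)
  qed
  have intb: "integrable lborel b" unfolding b_def by (rule fibre_area_integrable[OF C C'])
  have main: "vol (left_embed ` C + right_embed ` (*\<^sub>R) t ` C') =
      t ^ DIM('c) * ((\<integral>p. a p \<partial>lborel) + 2 * t * (\<integral>p. b p \<partial>lborel) + t\<^sup>2 * (\<integral>p. g p \<partial>lborel))"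
    if t: "t > 0" for t
  proof -
    let ?W = "left_embed ` C + right_embed ` (*\<^sub>R) t ` C'"
    have W: "convex_body ?W" using C C' by (intro convex_body_join convex_body_scale)
    define w where "w p = vol (Pair p -` ?W)" for p
    have intw: "integrable lborel w" unfolding w_def by (rule slice_measure_integrable[OF W])
    have wm: "w \<in> borel_measurable borel"
      unfolding w_def by (rule slice_measure_measurable[OF convex_body_measurable[OF W]])
    have w_scaled: "w (c, t *\<^sub>R d) = a (c, d) + 2 * t * b (c, d) + t\<^sup>2 * g (c, d)" for c d
    proof -
      have "Pair (t *\<^sub>R d) -` (*\<^sub>R) t ` C' = (*\<^sub>R) t ` Pair d -` C'"
      proof (intro equalityI subsetI)
        fix y assume "y \<in> Pair (t *\<^sub>R d) -` (*\<^sub>R) t ` C'"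
        then obtain z where z: "z \<in> C'" "(t *\<^sub>R d, y) = t *\<^sub>R z" by auto
        then have "fst z = d" "y = t *\<^sub>R snd z" using t by (auto simp: prod_eq_iff)
        then show "y \<in> (*\<^sub>R) t ` Pair d -` C'" using z(1) by auto
      next
        fix y assume "y \<in> (*\<^sub>R) t ` Pair d -` C'"
        then obtain v where "(d, v) \<in> C'" "y = t *\<^sub>R v" by auto
        then show "y \<in> Pair (t *\<^sub>R d) -` (*\<^sub>R) t ` C'"
          using imageI[of "(d, v)" C' "(*\<^sub>R) t"] by simp
      qed
      then have w: "w (c, t *\<^sub>R d) = vol (Pair c -` C + (*\<^sub>R) t ` Pair d -` C')"
        unfolding w_def join_slice by simp
      show ?thesis
      proof (cases "Pair c -` C = {} \<or> Pair d -` C' = {}")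
        case True
        then have "Pair c -` C + (*\<^sub>R) t ` Pair d -` C' = {}" by (auto simp: set_plus_def)
        moreover have "a (c, d) = 0" "g (c, d) = 0" "b (c, d) = 0"
          using True slice_empty_iff[of c C] slice_empty_iff[of d C']
          by (auto simp: a_def g_def b_def fibre_area_def indicator_def)
        ultimately show ?thesis unfolding w by simp
      next
        case False
        then have body: "convex_body (Pair c -` C)" "convex_body (Pair d -` C')"
          using C C' by (auto intro: convex_body_slice)
        have "mixed_area ((*\<^sub>R) t ` Pair d -` C') (Pair c -` C) = t * mixed_area (Pair d -` C') (Pair c -` C)"
          using body t by (intro mixed_area_scale) auto
        moreover have "vol ((*\<^sub>R) t ` Pair d -` C') = t\<^sup>2 * vol (Pair d -` C')"
          using measure_lborel_scaleR[OF body(2), of t] t by (simp add: power2_eq_square)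
        moreover have "a (c, d) = vol (Pair c -` C)" "g (c, d) = vol (Pair d -` C')"
          "b (c, d) = mixed_area (Pair d -` C') (Pair c -` C)"
          using False slice_empty_iff[of c C] slice_empty_iff[of d C']
          by (auto simp: a_def g_def b_def fibre_area_def indicator_def mixed_area_commute)
        ultimately show ?thesis
          unfolding w mixed_area_def[of "(*\<^sub>R) t ` _"] by (simp add: add.commute field_simps)
      qed
    qed
    have inner: "(\<integral>d. w (c, d) \<partial>lborel) = t ^ DIM('c) * (\<integral>d. w (c, t *\<^sub>R d) \<partial>lborel)" for c
    proof (rule integral_lborel_scale[OF _ t])
      have "Pair c \<in> borel_measurable (borel :: 'c measure)"
        by (intro borel_measurable_continuous_onI continuous_on_Pair continuous_on_id continuous_on_const)
      from measurable_compose[OF this wm] show "(\<lambda>d. w (c, d)) \<in> borel_measurable borel" .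
    qed
    have int: "integrable lborel (\<lambda>p. a p + 2 * t * b p + t\<^sup>2 * g p)"
      using inta intb intg by simp
    have "vol ?W = (\<integral>p. w p \<partial>lborel)"
      unfolding w_def by (rule measure_eq_integral_slices[OF W])
    also have "\<dots> = (\<integral>c. (\<integral>d. w (c, d) \<partial>lborel) \<partial>lborel)"
      by (rule integral_lborel_product[OF intw])
    also have "\<dots> = t ^ DIM('c) * (\<integral>c. (\<integral>d. a (c, d) + 2 * t * b (c, d) + t\<^sup>2 * g (c, d) \<partial>lborel) \<partial>lborel)"
      unfolding inner w_scaled by simp
    also have "(\<integral>c. (\<integral>d. a (c, d) + 2 * t * b (c, d) + t\<^sup>2 * g (c, d) \<partial>lborel) \<partial>lborel)
        = (\<integral>p. a p + 2 * t * b p + t\<^sup>2 * g p \<partial>lborel)"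
      by (rule integral_lborel_product[OF int, symmetric])
    also have "\<dots> = (\<integral>p. a p \<partial>lborel) + 2 * t * (\<integral>p. b p \<partial>lborel) + t\<^sup>2 * (\<integral>p. g p \<partial>lborel)"
      using inta intb intg by simp
    finally show ?thesis .
  qed
  show ?thesis
    by (rule exI[of _ "\<integral>p. a p \<partial>lborel"], rule exI[of _ "\<integral>p. g p \<partial>lborel"])
      (use main in \<open>simp add: cross_area_def b_def\<close>)
qed

section \<open>Mixed volumes of bodies that share a plane\<close>

lemma polarize_Plus:
  assumes "finite I" "finite J"
  shows "polarize (I <+> J) F = polarize I (\<lambda>S. polarize J (\<lambda>R. F (S <+> R)))"
proof -
  have parts: "(Inl -` X) <+> (Inr -` X) = X" for X :: "('a + 'b) set"
  proof (rule set_eqI)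
    fix z show "z \<in> (Inl -` X) <+> (Inr -` X) \<longleftrightarrow> z \<in> X" by (cases z) auto
  qed
  have "polarize (I <+> J) F = (\<Sum>(S, R)\<in>Pow I \<times> Pow J. (-1) ^ card ((I <+> J) - (S <+> R)) * F (S <+> R))"
    unfolding polarize_def
    by (rule sum.reindex_bij_witness[where i="\<lambda>(S, R). S <+> R" and j="\<lambda>X. (Inl -` X, Inr -` X)"])
      (auto simp: parts)
  also have "\<dots> = (\<Sum>(S, R)\<in>Pow I \<times> Pow J. (-1) ^ card (I - S) * ((-1) ^ card (J - R) * F (S <+> R)))"
  proof (intro sum.cong refl, clarify)
    fix S R assume "S \<subseteq> I" "R \<subseteq> J"
    have "(I <+> J) - (S <+> R) = (I - S) <+> (J - R)" by auto
    then have "card ((I <+> J) - (S <+> R)) = card (I - S) + card (J - R)"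
      using assms by (simp add: card_Plus)
    then show "(-1) ^ card ((I <+> J) - (S <+> R)) * F (S <+> R) =
        (-1) ^ card (I - S) * ((-1) ^ card (J - R) * F (S <+> R))"
      by (simp add: power_add)
  qed
  finally show ?thesis
    by (simp add: polarize_def sum_distrib_left sum.cartesian_product)
qed

lemma mixvol_scale_part:
  fixes K :: "'i \<Rightarrow> 'a::euclidean_space set"
  assumes I: "finite I" "card I = DIM('a)" and K: "\<And>i. i \<in> I \<Longrightarrow> convex_body (K i)"
    and J: "finite J" "J \<subseteq> I" and t: "0 \<le> t"
  shows "mixvol vol I (\<lambda>i. if i \<in> J then (*\<^sub>R) t ` K i else K i)
    = t ^ card J * mixvol vol I K"
  using J
proof (induction J rule: finite_induct)
  case (insert j J)
  let ?L = "\<lambda>i. if i \<in> J then (*\<^sub>R) t ` K i else K i"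
  have "(\<lambda>i. if i \<in> insert j J then (*\<^sub>R) t ` K i else K i) = ?L(j := (*\<^sub>R) t ` K j)"
    by (auto simp: fun_eq_iff)
  moreover have "?L = ?L(j := K j)" using insert.hyps by (auto simp: fun_eq_iff)
  moreover have "mixvol vol I (?L(j := (*\<^sub>R) t ` K j)) = t * mixvol vol I (?L(j := K j))"
    using insert.prems K t by (intro mixvol_scale I) (auto intro: convex_body_scale)
  ultimately show ?case using insert by simp
qed simp

definition join_tuple :: "('i \<Rightarrow> ('c::euclidean_space \<times> plane) set) \<Rightarrow> ('i \<Rightarrow> ('c \<times> plane) set)
    \<Rightarrow> 'i + 'i \<Rightarrow> (('c \<times> 'c) \<times> plane) set" where
  "join_tuple A B = case_sum (\<lambda>i. left_embed ` A i) (\<lambda>i. right_embed ` B i)"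

lemma convex_body_join_tuple:
  assumes "\<And>i. i \<in> I \<Longrightarrow> convex_body (A i)" "\<And>i. i \<in> I \<Longrightarrow> convex_body (B i)" "z \<in> I <+> I"
  shows "convex_body (join_tuple A B z)"
  using assms unfolding join_tuple_def
  by (auto intro!: convex_body_linear_image linear_left_embed linear_right_embed)

lemma sum_join_tuple:
  assumes "finite S" "finite R"
  shows "sum (join_tuple A B) (S <+> R) = left_embed ` (\<Sum>i\<in>S. A i) + right_embed ` (\<Sum>i\<in>R. B i)"
  unfolding join_tuple_def sum.Plus[OF assms]
  by (simp add: comp_def image_sum_linear linear_left_embed linear_right_embed)

lemma quadratic_fit:
  fixes X a b g :: real
  assumes "\<And>t. t > 0 \<Longrightarrow> t * X = a + 2 * t * b + t\<^sup>2 * g"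
  shows "X = 2 * b"
  using assms[of 1] assms[of 2] assms[of 3] by (simp add: power2_eq_square)

text \<open>Scaling all \<open>B i\<close> by \<open>t\<close> multiplies the left-hand side by \<open>t ^ Suc k\<close>, where \<open>k\<close> is the
  dimension of the base, while each volume in the polarization formula is \<open>t ^ k\<close> times a
  quadratic polynomial in \<open>t\<close>.  Comparing the two at several \<open>t\<close> isolates the linear coefficient,
  which is twice the cross area.\<close>

lemma join_mixvol:
  fixes A B :: "'i \<Rightarrow> ('c::euclidean_space \<times> plane) set"
  assumes I: "finite I" "card I = Suc DIM('c)"
    and A: "\<And>i. i \<in> I \<Longrightarrow> convex_body (A i)" and B: "\<And>i. i \<in> I \<Longrightarrow> convex_body (B i)"
  shows "fact (2 * card I) * mixvol vol (I <+> I) (join_tuple A B) =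
    2 * polarize I (\<lambda>S. polarize I (\<lambda>R. cross_area (\<Sum>i\<in>S. A i) (\<Sum>i\<in>R. B i)))"
proof -
  let ?V = "mixvol vol (I <+> I)" and ?k = "DIM('c)"
  have II: "finite (I <+> I)" "card (I <+> I) = DIM(('c \<times> 'c) \<times> plane)" "card (I <+> I) = 2 * card I"
    using I by (simp_all add: card_Plus)
  have body: "convex_body (\<Sum>i\<in>S. A i)" "convex_body (\<Sum>i\<in>S. B i)" if "S \<subseteq> I" for S
    using that A B by (auto intro!: convex_body_sum)
  have "\<forall>S R. \<exists>\<alpha> \<gamma>. S \<subseteq> I \<and> R \<subseteq> I \<longrightarrow> (\<forall>t>0. vol
      (left_embed ` (\<Sum>i\<in>S. A i) + right_embed ` (*\<^sub>R) t ` (\<Sum>i\<in>R. B i)) =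
      t ^ ?k * (\<alpha> + 2 * t * cross_area (\<Sum>i\<in>S. A i) (\<Sum>i\<in>R. B i) + t\<^sup>2 * \<gamma>))"
    using join_measure_scaled[OF body(1) body(2)] by blast
  then obtain \<alpha> \<gamma> where poly: "\<And>S R t. S \<subseteq> I \<Longrightarrow> R \<subseteq> I \<Longrightarrow> t > 0 \<Longrightarrow> vol
      (left_embed ` (\<Sum>i\<in>S. A i) + right_embed ` (*\<^sub>R) t ` (\<Sum>i\<in>R. B i)) =
      t ^ ?k * (\<alpha> S R + 2 * t * cross_area (\<Sum>i\<in>S. A i) (\<Sum>i\<in>R. B i) + t\<^sup>2 * \<gamma> S R)"
    by metis
  define X where "X = fact (2 * card I) * ?V (join_tuple A B)"
  define a where "a = polarize I (\<lambda>S. polarize I (\<alpha> S))"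
  define b where "b = polarize I (\<lambda>S. polarize I (\<lambda>R. cross_area (\<Sum>i\<in>S. A i) (\<Sum>i\<in>R. B i)))"
  define g where "g = polarize I (\<lambda>S. polarize I (\<gamma> S))"
  have "t * X = a + 2 * t * b + t\<^sup>2 * g" if t: "t > 0" for t
  proof -
    let ?B = "\<lambda>i. (*\<^sub>R) t ` B i"
    have "?V (join_tuple A ?B) = ?V (\<lambda>z. if z \<in> Inr ` I then (*\<^sub>R) t ` join_tuple A B z else join_tuple A B z)"
    proof (rule mixvol_cong)
      fix z assume "z \<in> I <+> I"
      then show "join_tuple A ?B z = (if z \<in> Inr ` I then (*\<^sub>R) t ` join_tuple A B z else join_tuple A B z)"
        by (elim PlusE) (simp_all add: join_tuple_def image_image linear_cmul[OF linear_right_embed] image_iff)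
    qed
    also have "\<dots> = t ^ card (Inr ` I :: ('i + 'i) set) * ?V (join_tuple A B)"
      using I t A B by (intro mixvol_scale_part II) (auto intro!: convex_body_join_tuple[of I])
    also have "card (Inr ` I :: ('i + 'i) set) = card I" by (simp add: card_image)
    finally have "fact (2 * card I) * ?V (join_tuple A ?B) = t ^ ?k * (t * X)"
      using I(2) by (simp add: X_def)
    moreover have "fact (2 * card I) * ?V (join_tuple A ?B) =
        polarize I (\<lambda>S. polarize I (\<lambda>R. vol (sum (join_tuple A ?B) (S <+> R))))"
      unfolding mixvol_def II(3) polarize_Plus[OF I(1) I(1)] by simp
    moreover have "\<dots> = polarize I (\<lambda>S. polarize I (\<lambda>R.
        t ^ ?k * (\<alpha> S R + 2 * t * cross_area (\<Sum>i\<in>S. A i) (\<Sum>i\<in>R. B i) + t\<^sup>2 * \<gamma> S R)))"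
    proof (intro polarize_cong)
      fix S R assume SR: "S \<subseteq> I" "R \<subseteq> I"
      have "finite S" "finite R" using SR I finite_subset by auto
      then have "sum (join_tuple A ?B) (S <+> R) = left_embed ` (\<Sum>i\<in>S. A i) + right_embed ` (*\<^sub>R) t ` (\<Sum>i\<in>R. B i)"
        by (simp add: sum_join_tuple image_sum_linear linear_scale_self)
      then show "vol (sum (join_tuple A ?B) (S <+> R)) =
          t ^ ?k * (\<alpha> S R + 2 * t * cross_area (\<Sum>i\<in>S. A i) (\<Sum>i\<in>R. B i) + t\<^sup>2 * \<gamma> S R)"
        using poly[OF SR t] by simp
    qed
    moreover have "\<dots> = t ^ ?k * (a + 2 * t * b + t\<^sup>2 * g)"
      by (simp only: polarize_mult polarize_add a_def b_def g_def)
    ultimately have "t ^ ?k * (t * X) = t ^ ?k * (a + 2 * t * b + t\<^sup>2 * g)" by metis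
    then show ?thesis using t by simp
  qed
  then have "X = 2 * b" by (rule quadratic_fit)
  then show ?thesis by (simp add: X_def b_def)
qed

text \<open>Evaluate the form at \<open>u = y\<close>, \<open>v = - x\<close>, where the linear functional on the right
  vanishes.\<close>

lemma reversed_cauchy_schwarz:
  fixes p r w x y :: real
  assumes "0 \<le> p" "0 \<le> r" and form: "\<And>u v. u\<^sup>2 * p + 2 * u * v * w + v\<^sup>2 * r \<le> (u * x + v * y)\<^sup>2"
  shows "p * r \<le> w\<^sup>2"
proof (cases "p = 0 \<or> r = 0")
  case True
  then show ?thesis by auto
next
  case False
  then have pr: "0 < p" "0 < r" using assms by auto
  have x: "p \<le> x\<^sup>2" and y: "r \<le> y\<^sup>2" using form[of 1 0] form[of 0 1] by simp_all
  have "y\<^sup>2 * p + 2 * y * (- x) * w + (- x)\<^sup>2 * r \<le> 0"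
    using form[of y "- x"] by (simp add: algebra_simps)
  then have "y\<^sup>2 * p + x\<^sup>2 * r \<le> 2 * (x * y * w)" by (simp add: algebra_simps)
  moreover have "0 \<le> y\<^sup>2 * p + x\<^sup>2 * r" using pr by simp
  ultimately have "(y\<^sup>2 * p + x\<^sup>2 * r)\<^sup>2 \<le> (2 * (x * y * w))\<^sup>2" by (intro power_mono)
  moreover have "4 * (x\<^sup>2 * y\<^sup>2) * (p * r) \<le> (y\<^sup>2 * p + x\<^sup>2 * r)\<^sup>2"
    using zero_le_power2[of "y\<^sup>2 * p - x\<^sup>2 * r"] by (simp add: power2_eq_square algebra_simps)
  moreover have "(2 * (x * y * w))\<^sup>2 = 4 * (x\<^sup>2 * y\<^sup>2) * w\<^sup>2" by (simp add: power_mult_distrib)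
  ultimately have "4 * (x\<^sup>2 * y\<^sup>2) * (p * r) \<le> 4 * (x\<^sup>2 * y\<^sup>2) * w\<^sup>2" by linarith
  moreover have "0 < 4 * (x\<^sup>2 * y\<^sup>2)"
    using order.strict_trans2[OF pr(1) x] order.strict_trans2[OF pr(2) y] by simp
  ultimately show ?thesis by (simp only: mult_le_cancel_left_pos)
qed

text \<open>The form \<open>q\<close> is nonnegative on the diagonal because mixed volumes are, and on the span
  of the two alternating sums it is dominated by the square of a linear functional; these are the
  hypotheses of the reversed Cauchy-Schwarz inequality.\<close>

lemma join_mixvol_inequality:
  fixes A B :: "'i \<Rightarrow> ('c::euclidean_space \<times> plane) set"
  assumes I: "finite I" "card I = Suc DIM('c)"
    and A: "\<And>i. i \<in> I \<Longrightarrow> convex_body (A i)" and B: "\<And>i. i \<in> I \<Longrightarrow> convex_body (B i)"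
  shows "mixvol vol (I <+> I) (join_tuple A A) * mixvol vol (I <+> I) (join_tuple B B)
    \<le> (mixvol vol (I <+> I) (join_tuple A B))\<^sup>2"
proof -
  let ?V = "mixvol vol (I <+> I)"
  define q where "q A B = polarize I (\<lambda>S. polarize I (\<lambda>R. cross_area (\<Sum>i\<in>S. A i) (\<Sum>i\<in>R. B i)))"
    for A B :: "'i \<Rightarrow> ('c \<times> plane) set"
  define F :: real where "F = fact (2 * card I)"
  have F: "F > 0" by (simp add: F_def)
  have Vq: "F * ?V (join_tuple K L) = 2 * q K L"
    if "\<And>i. i \<in> I \<Longrightarrow> convex_body (K i)" "\<And>i. i \<in> I \<Longrightarrow> convex_body (L i)" for K L
    unfolding F_def q_def by (intro join_mixvol I that)
  have nonneg: "0 \<le> q K K" if K: "\<And>i. i \<in> I \<Longrightarrow> convex_body (K i)" for K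
  proof -
    have "0 \<le> ?V (join_tuple K K)"
    proof (rule mixvol_nonneg)
      show "convex_body (join_tuple K K z)" if "z \<in> I <+> I" for z
        using K K that by (rule convex_body_join_tuple)
    qed (use I in \<open>simp_all add: card_Plus\<close>)
    then have "0 \<le> F * ?V (join_tuple K K)" using F by simp
    also have "\<dots> = 2 * q K K" by (intro Vq K)
    finally show ?thesis by simp
  qed
  define \<epsilon> :: "'i set \<Rightarrow> real" where "\<epsilon> S = (-1) ^ card (I - S)" for S
  have q_sum: "q K L = (\<Sum>S\<in>Pow I. \<Sum>R\<in>Pow I. \<epsilon> S * \<epsilon> R * cross_area (\<Sum>i\<in>S. K i) (\<Sum>i\<in>R. L i))" for K L
    by (simp add: q_def polarize_def \<epsilon>_def sum_distrib_left mult.assoc)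
  have body: "convex_body (\<Sum>i\<in>S. A i)" "convex_body (\<Sum>i\<in>S. B i)" if "S \<subseteq> I" for S
    using that A B by (auto intro!: convex_body_sum)
  have qBA: "q B A = q A B"
    unfolding q_sum by (subst sum.swap, intro sum.cong refl)
      (use body in \<open>auto simp: cross_area_commute mult.commute\<close>)
  define D :: "plane set" where "D = cbox 0 One"
  have D: "convex_body D" "vol D = 1" by (simp_all add: D_def convex_body_def content_unit)
  define \<delta> where "\<delta> C = (\<integral>c. fibre_area (Pair c -` C) D \<partial>lborel)" for C :: "('c \<times> plane) set"
  define x where "x = (\<Sum>S\<in>Pow I. \<epsilon> S * \<delta> (\<Sum>i\<in>S. A i))"
  define y where "y = (\<Sum>S\<in>Pow I. \<epsilon> S * \<delta> (\<Sum>i\<in>S. B i))"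
  have form: "u\<^sup>2 * q A A + 2 * u * v * q A B + v\<^sup>2 * q B B \<le> (u * x + v * y)\<^sup>2" for u v
  proof -
    let ?J = "Pow I <+> Pow I"
    let ?C = "case_sum (\<lambda>S. \<Sum>i\<in>S. A i) (\<lambda>S. \<Sum>i\<in>S. B i)"
    let ?x = "case_sum (\<lambda>S. u * \<epsilon> S) (\<lambda>S. v * \<epsilon> S)"
    have P: "finite (Pow I)" using I by simp
    have split: "(\<Sum>j\<in>?J. f j) = (\<Sum>S\<in>Pow I. f (Inl S)) + (\<Sum>S\<in>Pow I. f (Inr S))" for f :: "_ \<Rightarrow> real"
      using sum.Plus[OF P P, of f] by (simp add: comp_def)
    have "vol D * (\<Sum>i\<in>?J. \<Sum>j\<in>?J. ?x i * ?x j * cross_area (?C i) (?C j))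
        \<le> (\<Sum>i\<in>?J. ?x i * (\<integral>c. fibre_area (Pair c -` ?C i) D \<partial>lborel))\<^sup>2"
      using P body by (intro cross_area_hyperbolic D) auto
    moreover have "(\<Sum>i\<in>?J. ?x i * (\<integral>c. fibre_area (Pair c -` ?C i) D \<partial>lborel)) = u * x + v * y"
      unfolding split by (simp add: x_def y_def \<delta>_def sum_distrib_left mult.assoc)
    moreover have "(\<Sum>i\<in>?J. \<Sum>j\<in>?J. ?x i * ?x j * cross_area (?C i) (?C j))
        = u * u * q A A + u * v * q A B + (v * u * q B A + v * v * q B B)"
      unfolding split by (simp add: q_sum sum.distrib sum_distrib_left mult_ac)
    ultimately show ?thesis
      by (simp add: D(2) qBA power2_eq_square algebra_simps)
  qed
  have "q A A * q B B \<le> (q A B)\<^sup>2"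
    by (rule reversed_cauchy_schwarz[OF nonneg[OF A] nonneg[OF B] form])
  moreover have V: "F * ?V (join_tuple A A) = 2 * q A A" "F * ?V (join_tuple B B) = 2 * q B B"
      "F * ?V (join_tuple A B) = 2 * q A B"
    by (intro Vq A B; assumption)+
  ultimately have "(F * ?V (join_tuple A A)) * (F * ?V (join_tuple B B)) \<le> (F * ?V (join_tuple A B))\<^sup>2"
    unfolding V by (simp add: power2_eq_square)
  then have "F\<^sup>2 * (?V (join_tuple A A) * ?V (join_tuple B B)) \<le> F\<^sup>2 * (?V (join_tuple A B))\<^sup>2"
    by (simp add: power_mult_distrib power2_eq_square mult_ac)
  then show ?thesis using F by simp
qed

section \<open>Linear images and product measures\<close>

lemma measure_linear_image_scale:
  fixes T :: "'b::euclidean_space \<Rightarrow> 'a::euclidean_space"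
  assumes T: "linear T" and dim: "DIM('b) = DIM('a)"
  shows "\<exists>\<kappa>. \<forall>S. compact S \<longrightarrow> vol (T ` S) = \<kappa> * vol S"
proof -
  obtain U :: "'b \<Rightarrow> real^'b basis_index" where U: "linear U" "bij U"
    "\<And>S. S \<in> sets borel \<Longrightarrow> vol (U ` S) = vol S"
    using lborel_isomorphism[where 'b='b and 'a="real^'b basis_index"] by (auto simp: CARD_basis_index)
  obtain W :: "'a \<Rightarrow> real^'b basis_index" where W: "linear W" "bij W"
    "\<And>S. S \<in> sets borel \<Longrightarrow> vol (W ` S) = vol S"
    using lborel_isomorphism[where 'b='a and 'a="real^'b basis_index"] dim by (auto simp: CARD_basis_index)
  obtain U' where U': "linear U'" "\<And>x. U' (U x) = x"
    using linear_injective_left_inverse[OF U(1)] U(2) by (auto simp: bij_def fun_eq_iff)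
  define L where "L = W \<circ> T \<circ> U'"
  have L: "linear L" unfolding L_def using W(1) T U'(1) by (intro linear_compose)
  have cont: "compact (f ` S)" if "linear f" "compact S" for f :: "'e::euclidean_space \<Rightarrow> 'f::euclidean_space" and S
    using that by (intro compact_continuous_image linear_continuous_on) (auto simp: linear_conv_bounded_linear)
  have leb: "measure lebesgue S = vol S" if "compact S" for S :: "(real^'b basis_index) set"
    using that by (simp add: measure_completion borel_compact)
  have "vol (T ` S) = \<bar>det (matrix L)\<bar> * vol S" if S: "compact S" for S
  proof -
    have "vol (T ` S) = vol (W ` T ` S)"
      using W(3) cont[OF T S] by (simp add: borel_compact)
    also have "W ` T ` S = L ` U ` S" by (simp add: L_def image_image U'(2))
    also have "vol (L ` U ` S) = \<bar>det (matrix L)\<bar> * vol (U ` S)"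
      using measure_linear_image[OF L, of "U ` S"] cont[OF U(1) S] cont[OF L cont[OF U(1) S]]
      by (simp add: leb lmeasurable_compact)
    also have "vol (U ` S) = vol S" using U(3) S by (simp add: borel_compact)
    finally show ?thesis .
  qed
  then show ?thesis by blast
qed

lemma measure_pair_positive_lebesgue:
  fixes \<mu> :: "'a::euclidean_space measure"
  assumes "positive_lebesgue_measure \<mu>"
  shows "\<exists>c. \<forall>K. measure (\<mu> \<Otimes>\<^sub>M (lborel :: 'b::euclidean_space measure)) K = c * vol K"
proof -
  obtain c where c: "c > 0" and \<mu>: "\<mu> = scale_measure (ennreal c) lborel"
    using assms by (auto simp: positive_lebesgue_measure_def)
  have sets: "sets (\<mu> \<Otimes>\<^sub>M (lborel :: 'b measure)) = sets (lborel \<Otimes>\<^sub>M lborel)"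
    by (intro sets_pair_measure_cong) (simp_all add: \<mu>)
  have "measure (\<mu> \<Otimes>\<^sub>M (lborel :: 'b measure)) K = c * vol K" for K
  proof (cases "K \<in> sets (\<mu> \<Otimes>\<^sub>M (lborel :: 'b measure))")
    case False
    then have "K \<notin> sets lborel" unfolding sets lborel_prod .
    then show ?thesis using False by (simp add: measure_notin_sets)
  next
    case True
    then have K: "K \<in> sets (lborel \<Otimes>\<^sub>M lborel)" using sets by simp
    have "emeasure (\<mu> \<Otimes>\<^sub>M lborel) K = (\<integral>\<^sup>+x. emeasure lborel (Pair x -` K) \<partial>\<mu>)"
      by (rule lborel.emeasure_pair_measure_alt[OF True])
    also have "\<dots> = ennreal c * (\<integral>\<^sup>+x. emeasure lborel (Pair x -` K) \<partial>lborel)"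
      unfolding \<mu> by (intro nn_integral_scale_measure lborel.measurable_emeasure_Pair K)
    also have "(\<integral>\<^sup>+x. emeasure lborel (Pair x -` K) \<partial>lborel) = emeasure lborel K"
      using lborel.emeasure_pair_measure_alt[OF K] by (simp add: lborel_prod)
    finally show ?thesis using c by (simp add: measure_def enn2real_mult)
  qed
  then show ?thesis by blast
qed

lemma dim_kernel_surjective:
  fixes f :: "'a::euclidean_space \<Rightarrow> 'b::euclidean_space"
  assumes f: "linear f" and s: "linear s" "\<And>x. f (s x) = x"
  shows "dim {w. f w = 0} + DIM('b) = DIM('a)"
proof -
  let ?K = "{w. f w = 0}"
  have K: "subspace ?K" by (rule linear_subspace_kernel[OF f])
  have R: "subspace (range s)" by (rule linear_subspace_image[OF s(1) subspace_UNIV])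
  have "{x + y |x y. x \<in> ?K \<and> y \<in> range s} = UNIV"
  proof (intro equalityI subsetI)
    fix w :: 'a
    have "w = (w - s (f w)) + s (f w)" "f (w - s (f w)) = 0"
      using f s by (simp_all add: linear_diff)
    then show "w \<in> {x + y |x y. x \<in> ?K \<and> y \<in> range s}" by blast
  qed simp
  moreover have "?K \<inter> range s = {0}"
    using s linear_0[OF s(1)] linear_0[OF f] by (auto simp: image_iff)
  moreover have "dim (range s) = DIM('b)"
    using dim_image_eq[OF s(1), of UNIV] s(2) by (metis dim_UNIV inj_on_def)
  ultimately show ?thesis using dim_sums_Int[OF K R] by simp
qed

section \<open>Flat bodies and graphs\<close>

lemma linear_graphing_map:
  fixes \<xi> :: "'k::finite \<Rightarrow> 'a::euclidean_space \<Rightarrow> real"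
  assumes "\<And>j. linear (\<xi> j)"
  shows "linear (graphing_map \<xi>)"
  using assms by (auto intro!: linearI simp: graphing_map_def vec_eq_iff linear_add linear_scale)

lemma convex_body_flat: "convex_body A \<Longrightarrow> convex_body (A \<times> {0})"
  for A :: "'a::euclidean_space set"
  by (auto simp: convex_body_def intro: compact_Times convex_Times)

lemma length_flat_graph_tuple: "length (flat_graph_tuple m \<xi> A B) = 2 * m"
  by (simp add: flat_graph_tuple_def)

lemma flat_graph_tuple_nth:
  "i < m \<Longrightarrow> flat_graph_tuple m \<xi> A B ! i = A i \<times> {0}"
  "i < m \<Longrightarrow> flat_graph_tuple m \<xi> A B ! (m + i) = graphing_map \<xi> ` B i"
  by (simp_all add: flat_graph_tuple_def nth_append)

lemma body_tuple_flat_graph: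
  fixes \<xi> :: "'k::finite \<Rightarrow> 'a::euclidean_space \<Rightarrow> real"
  assumes "\<And>j. linear (\<xi> j)" "2 * m = DIM('a) + CARD('k)"
    and "\<And>i. i < m \<Longrightarrow> convex_body (A i)" "\<And>i. i < m \<Longrightarrow> convex_body (B i)"
  shows "body_tuple (flat_graph_tuple m \<xi> A B)"
  using assms unfolding body_tuple_def
  by (auto simp: length_flat_graph_tuple flat_graph_tuple_def
      intro!: convex_body_flat convex_body_linear_image linear_graphing_map)

lemma bij_betw_halves: "bij_betw (case_sum (\<lambda>i. i) (\<lambda>i. m + i)) ({..<m} <+> {..<m}) {..<2 * (m::nat)}"
  by (rule bij_betw_byWitness[where f'="\<lambda>j. if j < m then Inl j else Inr (j - m)"]) auto

lemma mixvol_transport: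
  fixes T :: "'b::euclidean_space \<Rightarrow> 'a::euclidean_space"
  assumes T: "linear T" and K: "\<And>i. i \<in> I \<Longrightarrow> convex_body (K i)"
    and m: "\<And>S. compact S \<Longrightarrow> m (T ` S) = \<kappa> * vol S"
  shows "mixvol m I (\<lambda>i. T ` K i) = \<kappa> * mixvol vol I K"
proof -
  have "polarize I (\<lambda>S. m (\<Sum>i\<in>S. T ` K i)) = polarize I (\<lambda>S. \<kappa> * vol (\<Sum>i\<in>S. K i))"
  proof (rule polarize_cong)
    fix S assume "S \<subseteq> I"
    then have "convex_body (\<Sum>i\<in>S. K i)" using K by (intro convex_body_sum) auto
    then show "m (\<Sum>i\<in>S. T ` K i) = \<kappa> * vol (\<Sum>i\<in>S. K i)"
      using m by (simp add: image_sum_linear[OF T, symmetric] convex_body_def)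
  qed
  then show ?thesis by (simp add: mixvol_def polarize_mult)
qed

text \<open>All partial sums stay in a proper subspace, which is a null set.\<close>

lemma mixvol_subspace:
  fixes K :: "'i \<Rightarrow> 'a::euclidean_space set"
  assumes V: "subspace V" "V \<noteq> UNIV" and K: "\<And>i. i \<in> I \<Longrightarrow> convex_body (K i) \<and> K i \<subseteq> V"
  shows "mixvol (\<lambda>S. c * vol S) I K = 0"
proof -
  have "dim V < DIM('a)"
    using V dim_eq_full[of V] dim_subset_UNIV[of V] by (metis le_neq_implies_less span_eq_iff)
  then have neg: "negligible V" by (rule negligible_lowdim)
  have "c * vol (sum K S) = 0" if "S \<subseteq> I" for S
  proof -
    have sub: "sum K S \<subseteq> V"
      using that
    proof (induction S rule: infinite_finite_induct)
      case (insert i S)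
      then have "K i + sum K S \<subseteq> V + V" using K by (intro set_plus_mono2) auto
      also have "V + V \<subseteq> V" using V(1) by (auto simp: set_plus_def subspace_add)
      finally show ?case using insert by simp
    qed (use subspace_0[OF V(1)] in auto)
    have "convex_body (sum K S)" using K that by (intro convex_body_sum) auto
    then have "vol (sum K S) = measure lebesgue (sum K S)"
      by (simp add: measure_completion convex_body_measurable)
    also have "\<dots> = 0" using negligible_subset[OF neg sub] by (rule negligible_imp_measure0)
    finally show ?thesis by simp
  qed
  then have "polarize I (\<lambda>S. c * vol (sum K S)) = polarize I (\<lambda>S. 0 * 0)"
    by (intro polarize_cong) simp
  then show ?thesis by (simp add: mixvol_def polarize_def)
qed

text \<open>A right inverse of \<open>f\<close> and an isomorphism of the plane with the kernel of \<open>f\<close>, whose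
  dimension is two.\<close>

lemma fibre_coordinates:
  fixes f :: "'a::euclidean_space \<Rightarrow> 'c::euclidean_space"
  assumes f: "linear f" "surj f" and dim: "DIM('a) = DIM('c) + 2"
  shows "\<exists>(s :: 'c \<Rightarrow> 'a) (\<psi> :: plane \<Rightarrow> 'a). linear s \<and> linear \<psi> \<and> (\<forall>c. f (s c) = c) \<and> range \<psi> = {w. f w = 0}"
proof -
  obtain s where s: "linear s" "\<And>c. f (s c) = c"
    using linear_surjective_right_inverse[OF f] by (auto simp: fun_eq_iff)
  have "dim (UNIV :: plane set) = dim {w. f w = 0}"
    using dim_kernel_surjective[OF f(1) s] dim by simp
  then obtain \<psi> :: "plane \<Rightarrow> 'a" where "linear \<psi>" "\<psi> ` UNIV = {w. f w = 0}"
    using isometries_subspaces[OF subspace_UNIV linear_subspace_kernel[OF f(1)]] by metis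
  then show ?thesis using s by blast
qed

text \<open>In the coordinates given by a right inverse \<open>s\<close> of \<open>f\<close> and a parametrization \<open>\<psi>\<close> of its
  kernel, the map \<open>((c, d), y) \<mapsto> (s c + s d + \<psi> y, d)\<close> sends \<open>((c, 0), y)\<close> to the point
  \<open>w = s c + \<psi> y\<close> of \<open>W\<close>, and it sends \<open>((0, d), y)\<close> to the point of the graph over
  \<open>w = s d + \<psi> y\<close>, since \<open>f w = d\<close>.\<close>

lemma flat_graph_mixvol_inequality:
  fixes \<xi> :: "'k::finite \<Rightarrow> 'a::euclidean_space \<Rightarrow> real" and c :: real
  assumes dim: "DIM('a) = CARD('k) + 2" and m: "m = CARD('k) + 1"
    and \<xi>: "\<And>j. linear (\<xi> j)"
    and A: "\<And>i. i < m \<Longrightarrow> convex_body (A i)" and B: "\<And>i. i < m \<Longrightarrow> convex_body (B i)"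
  defines "V \<equiv> \<lambda>K L. mixvol (\<lambda>S. c * vol S) {..<2 * m} (\<lambda>i. flat_graph_tuple m \<xi> K L ! i)"
  shows "V A A * V B B \<le> (V A B)\<^sup>2"
proof -
  define f where "f w = (\<chi> j. \<xi> j w)" for w
  have f: "linear f"
    using \<xi> by (auto intro!: linearI simp: f_def vec_eq_iff linear_add linear_scale)
  have graph: "graphing_map \<xi> w = (w, f w)" for w by (simp add: graphing_map_def f_def)
  let ?I = "{..<m}"
  have split: "V K L = mixvol (\<lambda>S. c * vol S) (?I <+> ?I)
      (case_sum (\<lambda>i. K i \<times> {0}) (\<lambda>i. graphing_map \<xi> ` L i))" for K L
    unfolding V_def mixvol_reindex[OF bij_betw_halves]
    by (rule mixvol_cong) (auto simp: flat_graph_tuple_nth elim!: PlusE)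
  show ?thesis
  proof (cases "surj f")
    case False
    define W where "W = (UNIV :: 'a set) \<times> range f"
    have W: "subspace W" unfolding W_def
      by (intro subspace_Times subspace_UNIV linear_subspace_image[OF f])
    have "W \<noteq> UNIV" using False by (auto simp: W_def)
    have zero: "V K L = 0" if "\<And>i. i < m \<Longrightarrow> convex_body (K i)" "\<And>i. i < m \<Longrightarrow> convex_body (L i)" for K L
      unfolding split
    proof (rule mixvol_subspace[OF W \<open>W \<noteq> UNIV\<close>])
      fix z assume "z \<in> ?I <+> ?I"
      moreover have "0 \<in> range f" using linear_0[OF f] by (metis rangeI)
      ultimately show "convex_body (case_sum (\<lambda>i. K i \<times> {0}) (\<lambda>i. graphing_map \<xi> ` L i) z) \<and>
          case_sum (\<lambda>i. K i \<times> {0}) (\<lambda>i. graphing_map \<xi> ` L i) z \<subseteq> W"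
        using that linear_graphing_map[of \<xi>, OF \<xi>]
        by (auto simp: W_def intro!: convex_body_flat convex_body_linear_image) (auto simp: graph)
    qed
    show ?thesis using zero A B by simp
  next
    case True
    obtain s :: "real^'k \<Rightarrow> 'a" and \<psi> :: "plane \<Rightarrow> 'a"
      where s: "linear s" "\<And>c. f (s c) = c" and \<psi>: "linear \<psi>" "range \<psi> = {w. f w = 0}"
      using fibre_coordinates[OF f True] dim by auto
    have f\<psi>: "f (\<psi> y) = 0" for y using \<psi>(2) by auto
    define \<Phi> where "\<Phi> z = s (fst z) + \<psi> (snd z)" for z
    have f\<Phi>: "f (\<Phi> z) = fst z" for z
      using s f\<psi> linear_add[OF f] by (simp add: \<Phi>_def)
    have \<Phi>: "linear \<Phi>"
      unfolding \<Phi>_def using s(1) \<psi>(1)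
      by (intro linearI) (simp_all add: linear_add linear_scale scaleR_add_right)
    have "surj \<Phi>"
    proof (rule surjI)
      fix w
      have "f (w - s (f w)) = 0" using linear_diff[OF f] s(2) by simp
      then have "w - s (f w) \<in> range \<psi>" using \<psi>(2) by simp
      then have "\<psi> (inv \<psi> (w - s (f w))) = w - s (f w)" by (rule f_inv_into_f)
      then show "\<Phi> ((\<lambda>w. (f w, inv \<psi> (w - s (f w)))) w) = w" by (simp add: \<Phi>_def)
    qed
    obtain \<Theta> where \<Theta>: "linear \<Theta>" "\<And>w. \<Phi> (\<Theta> w) = w"
      using linear_surjective_right_inverse[OF \<Phi> \<open>surj \<Phi>\<close>] by (auto simp: fun_eq_iff)
    define T where "T z = (s (fst (fst z)) + s (snd (fst z)) + \<psi> (snd z), snd (fst z))" for z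
    have T: "linear T"
      unfolding T_def using s(1) \<psi>(1)
      by (intro linearI) (simp_all add: linear_add linear_scale scaleR_add_right)
    have left: "T (left_embed z) = (\<Phi> z, 0)" and right: "T (right_embed z) = graphing_map \<xi> (\<Phi> z)" for z
      using linear_0[OF s(1)] f\<Phi>[of z]
      by (simp_all add: T_def \<Phi>_def left_embed_def right_embed_def graph)
    have "DIM(((real^'k) \<times> (real^'k)) \<times> plane) = DIM('a \<times> (real^'k))" using dim by simp
    from measure_linear_image_scale[OF T this] obtain \<kappa>
      where \<kappa>: "\<And>S. compact S \<Longrightarrow> vol (T ` S) = \<kappa> * vol S" by blast
    have body: "convex_body (\<Theta> ` K)" if "convex_body K" for K
      using that by (rule convex_body_linear_image[OF \<Theta>(1)])
    have V: "V K L = (c * \<kappa>) * mixvol vol (?I <+> ?I) (join_tuple (\<lambda>i. \<Theta> ` K i) (\<lambda>i. \<Theta> ` L i))"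
      if KL: "\<And>i. i < m \<Longrightarrow> convex_body (K i)" "\<And>i. i < m \<Longrightarrow> convex_body (L i)" for K L
    proof -
      have "T ` left_embed ` \<Theta> ` X = X \<times> {0}" for X
        by (auto simp: image_image left \<Theta>(2))
      moreover have "T ` right_embed ` \<Theta> ` X = graphing_map \<xi> ` X" for X
        by (simp add: image_image right \<Theta>(2))
      ultimately have "V K L = mixvol (\<lambda>S. c * vol S) (?I <+> ?I)
          (\<lambda>z. T ` join_tuple (\<lambda>i. \<Theta> ` K i) (\<lambda>i. \<Theta> ` L i) z)"
        unfolding split by (intro mixvol_cong) (auto simp: join_tuple_def split: sum.splits)
      also have "\<dots> = (c * \<kappa>) * mixvol vol (?I <+> ?I) (join_tuple (\<lambda>i. \<Theta> ` K i) (\<lambda>i. \<Theta> ` L i))"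
        using KL by (intro mixvol_transport[OF T]) (auto simp: \<kappa> intro!: convex_body_join_tuple[of ?I] body)
      finally show ?thesis .
    qed
    have le: "mixvol vol (?I <+> ?I) (join_tuple (\<lambda>i. \<Theta> ` A i) (\<lambda>i. \<Theta> ` A i))
        * mixvol vol (?I <+> ?I) (join_tuple (\<lambda>i. \<Theta> ` B i) (\<lambda>i. \<Theta> ` B i))
      \<le> (mixvol vol (?I <+> ?I) (join_tuple (\<lambda>i. \<Theta> ` A i) (\<lambda>i. \<Theta> ` B i)))\<^sup>2"
      using A B m by (intro join_mixvol_inequality) (auto intro: body)
    have VA: "V A A = (c * \<kappa>) * mixvol vol (?I <+> ?I) (join_tuple (\<lambda>i. \<Theta> ` A i) (\<lambda>i. \<Theta> ` A i))"
      and VB: "V B B = (c * \<kappa>) * mixvol vol (?I <+> ?I) (join_tuple (\<lambda>i. \<Theta> ` B i) (\<lambda>i. \<Theta> ` B i))"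
      and VAB: "V A B = (c * \<kappa>) * mixvol vol (?I <+> ?I) (join_tuple (\<lambda>i. \<Theta> ` A i) (\<lambda>i. \<Theta> ` B i))"
      by (intro V A B; assumption)+
    from mult_left_mono[OF le zero_le_power2[of "c * \<kappa>"]] show ?thesis
      unfolding VA VB VAB by (simp add: power2_eq_square mult_ac)
  qed
qed

theorem theorem6p3:
  fixes n :: nat
    and \<mu> :: "'a::euclidean_space measure"
    and \<xi> :: "'k::finite \<Rightarrow> 'a \<Rightarrow> real"
    and A B :: "nat \<Rightarrow> 'a set"
  assumes "n \<ge> 3"
    and "DIM('a) = n"
    and "CARD('k) = n - 2"
    and "positive_lebesgue_measure \<mu>"
    and "\<And>j. linear (\<xi> j)"
    and "\<And>i. i < n - 1 \<Longrightarrow> convex_body (A i)"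
    and "\<And>i. i < n - 1 \<Longrightarrow> convex_body (B i)"
    and "\<And>i. i < n - 1 \<Longrightarrow> centrally_symmetric (B i)"
  shows "(mixed_volume (\<mu> \<Otimes>\<^sub>M lborel) (flat_graph_tuple (n - 1) \<xi> A B))\<^sup>2
    \<ge> mixed_volume (\<mu> \<Otimes>\<^sub>M lborel) (flat_graph_tuple (n - 1) \<xi> A A)
      * mixed_volume (\<mu> \<Otimes>\<^sub>M lborel) (flat_graph_tuple (n - 1) \<xi> B B)"
proof -
  let ?M = "\<mu> \<Otimes>\<^sub>M (lborel :: (real^'k) measure)" and ?m = "n - 1"
  obtain c where c: "\<And>K. measure ?M K = c * vol K"
    using measure_pair_positive_lebesgue[OF assms(4)] by blast
  have V: "is_mixed_volume ?M (mixed_volume ?M)"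
    unfolding mixed_volume_def using mixed_volume_exists[OF c] by (rule someI_ex)
  have m: "2 * ?m = DIM('a) + CARD('k)" "DIM('a) = CARD('k) + 2" "?m = CARD('k) + 1"
    using assms(1-3) by simp_all
  have eq: "mixed_volume ?M (flat_graph_tuple ?m \<xi> K L) =
      mixvol (\<lambda>S. c * vol S) {..<2 * ?m} (\<lambda>i. flat_graph_tuple ?m \<xi> K L ! i)"
    if "\<And>i. i < ?m \<Longrightarrow> convex_body (K i)" "\<And>i. i < ?m \<Longrightarrow> convex_body (L i)" for K L
  proof -
    have "measure ?M = (\<lambda>S. c * vol S)" using c by (rule ext)
    moreover have "DIM('a \<times> (real^'k)) = 2 * ?m" using m(1) by simp
    ultimately show ?thesis
      using mixed_volume_eq[OF V body_tuple_flat_graph[of \<xi>, OF assms(5) m(1) that]] by simp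
  qed
  show ?thesis
    using flat_graph_mixvol_inequality[where \<xi>=\<xi> and c=c and A=A and B=B, OF m(2,3) assms(5-7)]
      eq[of A A] eq[of B B] eq[of A B] assms(6,7) by simp
qed

end
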